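(* Let $H:\mathbb{A}\to\mathcal{B}$ be an $\mathcal{F}$-functor from an $\mathcal{F}$-category to a 2-category $\mathcal{B}$. Let $w\in\{l,p,c\}$ and suppose that 1. $H_\tau:\mathcal{A}_\tau\to\mathcal{B}$ is monadic; 2. $\mathbb{A}$ admits $\bar{w}$-limits of loose morphisms; 3. $\mathcal{B}$ admits $\bar{w}$-limits of arrows; 4. $H$ is $w$-doctrinal (for which it suffices that $H$ satisfies $w$-doctrinal adjunction, is locally faithful and reflects identity 2-cells). Let $T$ be the induced 2-monad on $\mathcal{B}$. Then the Eilenberg–Moore comparison 2-equivalence $E:\mathcal{A}_\tau\to\text{T-Alg}_s$ extends uniquely to an equivalence of $\mathcal{F}$-categories $E_w:\mathbb{A}\to\text{T-}\mathbb{A}\text{lg}_w$ over $\mathcal{B}$ (i.e. $E_wj=j_wE$ and $UE_w=H$). Moreover, if $H_\tau$ is strictly monadic then $E_w:\mathbb{A}\to\text{T-}\mathbb{A}\text{lg}_w$ is an isomorphism of $\mathcal{F}$-categories.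
   Context: **$\mathcal{F}$-categories.** An $\mathcal{F}$-category $\mathbb{A}$ is a pair of 2-categories $\mathcal{A}_\tau,\mathcal{A}_\lambda$ with a 2-functor $j:\mathcal{A}_\tau\to\mathcal{A}_\lambda$ that is the identity on objects, faithful (injective on 1-cells) and locally fully faithful. The 1-cells of $\mathcal{A}_\lambda$ are the loose morphisms (written $A\rightsquigarrow B$); those coming from $\mathcal{A}_\tau$ are the tight morphisms (written $A\to B$). An $\mathcal{F}$-functor $F:\mathbb{A}\to\mathbb{B}$ is a 2-functor $F_\lambda:\mathcal{A}_\lambda\to\mathcal{B}_\lambda$ taking tight morphisms to tight morphisms; $F_\tau:\mathcal{A}_\tau\to\mathcal{B}_\tau$ is its restriction. A 2-category is viewed as an $\mathcal{F}$-category in which all morphisms are tight. Thus there is an $\mathcal{F}$-functor $j:\mathcal{A}_\tau\to\mathbb{A}$, the identity on tight morphisms and given by $j:\mathcal{A}_\tau\to\mathcal{A}_\lambda$ on loose ones. $\mathbb{A}^{co}$ is obtained by reversing 2-cells. An $\mathcal{F}$-functor $F$ is an equivalence of $\mathcal{F}$-categories just when both $F_\tau$ and $F_\lambda$ are 2-equivalences (essentially surjective on objects and isomorphisms on hom-categories). An adjunction (or adjoint equivalence) $(\epsilon,f\dashv g,\eta)$ in $\mathbb{A}$ means one in $\mathcal{A}_\lambda$ (counit $\epsilon$, unit $\eta$). A lifting along $H:\mathbb{A}\to\mathbb{B}$ of an adjunction in $\mathbb{B}$ is an adjunction in $\mathbb{A}$ whose adjoints, unit and counit are sent by $H$ to the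 given ones. **Monadicity.** A 2-functor with a left 2-adjoint is monadic if the induced Eilenberg–Moore comparison 2-functor is a 2-equivalence, strictly monadic if it is an isomorphism. **Reflections.** An $l$-reflection $(1,f\dashv g,\eta)$ is an adjunction with tight left adjoint $f$ and identity counit; it is a $p$-reflection if moreover $\eta$ is invertible. For $w\in\{l,p\}$, given $w$-reflections $(1,f_i\dashv g_i,\eta_i)$, $i=1,2$, a tight commuting square $(r,s):f_1\to f_2$ (i.e. $r,s$ tight with $f_2r=sf_1$) is a morphism of $w$-reflections if $g_2s=rg_1$ and $r\eta_1=\eta_2r$. **$w$-doctrinal.** For $w\in\{l,p\}$ an $\mathcal{F}$-functor $H:\mathbb{A}\to\mathbb{B}$ satisfies $w$-Refl if for each tight $f$ in $\mathbb{A}$, each $w$-reflection $(1,Hf\dashv g,\eta)$ in $\mathbb{B}$ lifts uniquely along $H$ to a $w$-reflection $(1,f\dashv g',\eta')$ in $\mathbb{A}$; and $w$-Morph if, given $w$-reflections $(1,f_i\dashv g_i,\eta_i)$ in $\mathbb{A}$, $i=1,2$, a tight commuting square $(r,s):f_1\to f_2$ is a morphism of $w$-reflections just when $(Hr,Hs)$ is one. $H$ satisfies $c$-Refl or $c$-Morph if $H^{co}:\mathbb{A}^{co}\to\mathbb{B}^{co}$ satisfies $l$-Refl or $l$-Morph. For $w\in\{l,p,c\}$, $H$ is $w$-doctrinal if it satisfies $w$-Refl, $w$-Morph and is locally faithful. Here $H$ is locally faithful (resp. reflects identity 2-cells) if $H_\lambda$ reflects equality of parallel 2-cells (resp. reflects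 the property of a 2-cell being an identity). **$w$-doctrinal adjunction.** $H$ satisfies $l$-doctrinal (resp. $p$-doctrinal) adjunction if for each tight $f$ in $\mathbb{A}$ each adjunction (resp. adjoint equivalence) $(\epsilon,Hf\dashv g,\eta)$ in $\mathbb{B}$ lifts uniquely along $H$ to an adjunction (resp. adjoint equivalence) in $\mathbb{A}$ with left adjoint $f$; $c$-doctrinal adjunction if for each tight $f$ each adjunction $(\epsilon,g\dashv Hf,\eta)$ in $\mathbb{B}$ lifts uniquely along $H$ to an adjunction in $\mathbb{A}$ with right adjoint $f$. **Limits of loose morphisms.** Put $\bar{l}=c$, $\bar{p}=p$, $\bar{c}=l$. The colax limit ($c$-limit) of a loose $f:A\rightsquigarrow B$ consists of an object $C_f$, tight morphisms $p_f:C_f\to A$, $q_f:C_f\to B$ and a 2-cell $\lambda_f:q_f\Rightarrow fp_f$ such that: (1) for every colax cone $(r:X\rightsquigarrow A,\ \alpha:s\Rightarrow fr,\ s:X\rightsquigarrow B)$ there is a unique $t:X\rightsquigarrow C_f$ with $p_ft=r$, $q_ft=s$, $\lambda_ft=\alpha$; (2) given colax cones $(r,\alpha,s)$, $(r',\alpha',s')$ from $X$, with induced $t,t'$, and 2-cells $\theta_r:r\Rightarrow r'$, $\theta_s:s\Rightarrow s'$ with $\alpha'\circ\theta_s=(f\theta_r)\circ\alpha$, there is a unique 2-cell $\phi:t\Rightarrow t'$ with $p_f\phi=\theta_r$, $q_f\phi=\theta_s$; (3) $t:X\rightsquigarrow C_f$ is tight just when $p_ft$ and $q_ft$ are tight.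 The pseudolimit ($p$-limit) is defined in the same way with $\lambda_f$ and the 2-cells $\alpha$ of all cones required invertible. The lax limit ($l$-limit) of $f$ in $\mathbb{A}$ is the colax limit of $f$ in $\mathbb{A}^{co}$. $\bar w$-limits of arrows in a 2-category are these limits with all morphisms regarded as tight (so (3) is vacuous). **Algebras.** Let $T=(T,\mu,\eta)$ be a 2-monad on $\mathcal{B}$. Algebras are strict $T$-algebras $(A,a:TA\to A)$. A lax morphism $(f,\bar f):(A,a)\rightsquigarrow(B,b)$ is $f:A\to B$ with a 2-cell $\bar f:b\,Tf\Rightarrow fa$ satisfying $\bar f\mu_A=(\bar f\,Ta)\circ(b\,T\bar f)$ and $\bar f\eta_A=1_f$; it is a pseudo morphism if $\bar f$ is invertible and strict if $\bar f$ is an identity. A colax morphism has $\bar f:fa\Rightarrow b\,Tf$ satisfying the dual conditions. An algebra 2-cell $\alpha:(f,\bar f)\Rightarrow(g,\bar g)$ of lax morphisms is a 2-cell $\alpha:f\Rightarrow g$ with $(\alpha a)\circ\bar f=\bar g\circ(b\,T\alpha)$; dually for colax. For $w=s,p,l,c$ (strict, pseudo, lax, colax) $\text{T-Alg}_w$ is the 2-category of algebras, $w$-morphisms and algebra 2-cells, with forgetful 2-functor $U_w:\text{T-Alg}_w\to\mathcal{B}$. For $w\in\{l,p,c\}$, $\text{T-}\mathbb{A}\text{lg}_w$ is the $\mathcal{F}$-category given by the inclusion $\text{T-Alg}_s\to\text{T-Alg}_w$ (tight = strict, loose = $w$-morphisms); $j_w:\text{T-Alg}_s\to\text{T-}\mathbb{A}\text{lg}_w$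 is its inclusion of tight morphisms and $U:\text{T-}\mathbb{A}\text{lg}_w\to\mathcal{B}$ the forgetful $\mathcal{F}$-functor, with $U_\tau=U_s$, $U_\lambda=U_w$. *)

theory Defs
  imports Main
begin

section \<open>Strict 2-categories and 2-functors\<close>

text \<open>
  Composition is written in applicative order: \<open>g \<cdot> f\<close> for 1-cells, \<open>\<beta> \<bullet> \<alpha>\<close> for
  vertical and \<open>\<beta> \<star> \<alpha>\<close> for horizontal composition of 2-cells.  The operations are
  total functions that are only meaningful on the three carriers.
\<close>

record ('o, 'm, 'c) two_cat =
  obs :: "'o set"
  ones :: "'m set"
  twos :: "'c set"
  src :: "'m \<Rightarrow> 'o"
  tgt :: "'m \<Rightarrow> 'o"
  dm :: "'c \<Rightarrow> 'm"
  cd :: "'c \<Rightarrow> 'm"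
  id1 :: "'o \<Rightarrow> 'm"
  comp1 :: "'m \<Rightarrow> 'm \<Rightarrow> 'm" (infixr \<open>\<cdot>\<index>\<close> 75)
  id2 :: "'m \<Rightarrow> 'c"
  vcomp :: "'c \<Rightarrow> 'c \<Rightarrow> 'c" (infixr \<open>\<bullet>\<index>\<close> 65)
  hcomp :: "'c \<Rightarrow> 'c \<Rightarrow> 'c" (infixr \<open>\<star>\<index>\<close> 70)

definition hom :: "('o, 'm, 'c) two_cat \<Rightarrow> 'o \<Rightarrow> 'o \<Rightarrow> 'm set" where
  "hom C X Y = {f \<in> ones C. src C f = X \<and> tgt C f = Y}"

definition cells :: "('o, 'm, 'c) two_cat \<Rightarrow> 'm \<Rightarrow> 'm \<Rightarrow> 'c set" where
  "cells C f g = {\<alpha> \<in> twos C. dm C \<alpha> = f \<and> cd C \<alpha> = g}"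

definition lwhisker :: "('o, 'm, 'c) two_cat \<Rightarrow> 'm \<Rightarrow> 'c \<Rightarrow> 'c" (infixr \<open>\<rhd>\<index>\<close> 70) where
  "f \<rhd>\<^bsub>C\<^esub> \<alpha> = id2 C f \<star>\<^bsub>C\<^esub> \<alpha>"

definition rwhisker :: "('o, 'm, 'c) two_cat \<Rightarrow> 'c \<Rightarrow> 'm \<Rightarrow> 'c" (infixl \<open>\<lhd>\<index>\<close> 71) where
  "\<alpha> \<lhd>\<^bsub>C\<^esub> f = \<alpha> \<star>\<^bsub>C\<^esub> id2 C f"

locale two_category =
  fixes C :: "('o, 'm, 'c) two_cat" (structure)
  assumes src_ob: "f \<in> ones C \<Longrightarrow> src C f \<in> obs C"
    and tgt_ob: "f \<in> ones C \<Longrightarrow> tgt C f \<in> obs C"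
    and id1_hom: "X \<in> obs C \<Longrightarrow> id1 C X \<in> hom C X X"
    and comp1_hom: "\<lbrakk>f \<in> hom C X Y; g \<in> hom C Y Z\<rbrakk> \<Longrightarrow> g \<cdot> f \<in> hom C X Z"
    and comp1_assoc: "\<lbrakk>f \<in> hom C W X; g \<in> hom C X Y; h \<in> hom C Y Z\<rbrakk>
          \<Longrightarrow> h \<cdot> (g \<cdot> f) = (h \<cdot> g) \<cdot> f"
    and id1_left: "f \<in> hom C X Y \<Longrightarrow> id1 C Y \<cdot> f = f"
    and id1_right: "f \<in> hom C X Y \<Longrightarrow> f \<cdot> id1 C X = f"
    and dm_one: "\<alpha> \<in> twos C \<Longrightarrow> dm C \<alpha> \<in> ones C"
    and cd_one: "\<alpha> \<in> twos C \<Longrightarrow> cd C \<alpha> \<in> ones C"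
    and src_par: "\<alpha> \<in> twos C \<Longrightarrow> src C (dm C \<alpha>) = src C (cd C \<alpha>)"
    and tgt_par: "\<alpha> \<in> twos C \<Longrightarrow> tgt C (dm C \<alpha>) = tgt C (cd C \<alpha>)"
    and id2_cell: "f \<in> ones C \<Longrightarrow> id2 C f \<in> cells C f f"
    and vcomp_cell: "\<lbrakk>\<alpha> \<in> cells C f g; \<beta> \<in> cells C g h\<rbrakk> \<Longrightarrow> \<beta> \<bullet> \<alpha> \<in> cells C f h"
    and vcomp_assoc: "\<lbrakk>\<alpha> \<in> cells C f g; \<beta> \<in> cells C g h; \<gamma> \<in> cells C h k\<rbrakk>
          \<Longrightarrow> \<gamma> \<bullet> (\<beta> \<bullet> \<alpha>) = (\<gamma> \<bullet> \<beta>) \<bullet> \<alpha>"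
    and id2_left: "\<alpha> \<in> cells C f g \<Longrightarrow> id2 C g \<bullet> \<alpha> = \<alpha>"
    and id2_right: "\<alpha> \<in> cells C f g \<Longrightarrow> \<alpha> \<bullet> id2 C f = \<alpha>"
    and hcomp_cell: "\<lbrakk>\<alpha> \<in> cells C f f'; \<beta> \<in> cells C g g'; tgt C f = src C g\<rbrakk>
          \<Longrightarrow> \<beta> \<star> \<alpha> \<in> cells C (g \<cdot> f) (g' \<cdot> f')"
    and hcomp_assoc: "\<lbrakk>\<alpha> \<in> cells C f f'; \<beta> \<in> cells C g g'; \<gamma> \<in> cells C h h';
            tgt C f = src C g; tgt C g = src C h\<rbrakk>
          \<Longrightarrow> \<gamma> \<star> (\<beta> \<star> \<alpha>) = (\<gamma> \<star> \<beta>) \<star> \<alpha>"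
    and hcomp_id_left: "\<alpha> \<in> cells C f f' \<Longrightarrow> id2 C (id1 C (tgt C f)) \<star> \<alpha> = \<alpha>"
    and hcomp_id_right: "\<alpha> \<in> cells C f f' \<Longrightarrow> \<alpha> \<star> id2 C (id1 C (src C f)) = \<alpha>"
    and hcomp_id2: "\<lbrakk>f \<in> hom C X Y; g \<in> hom C Y Z\<rbrakk> \<Longrightarrow> id2 C g \<star> id2 C f = id2 C (g \<cdot> f)"
    and interchange: "\<lbrakk>\<alpha> \<in> cells C f f'; \<alpha>' \<in> cells C f' f''; \<beta> \<in> cells C g g';
            \<beta>' \<in> cells C g' g''; tgt C f = src C g\<rbrakk>
          \<Longrightarrow> (\<beta>' \<bullet> \<beta>) \<star> (\<alpha>' \<bullet> \<alpha>) = (\<beta>' \<star> \<alpha>') \<bullet> (\<beta> \<star> \<alpha>)"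

definition invertible :: "('o, 'm, 'c) two_cat \<Rightarrow> 'c \<Rightarrow> bool" where
  "invertible C \<alpha> \<longleftrightarrow> \<alpha> \<in> twos C \<and> (\<exists>\<beta> \<in> cells C (cd C \<alpha>) (dm C \<alpha>).
     \<beta> \<bullet>\<^bsub>C\<^esub> \<alpha> = id2 C (dm C \<alpha>) \<and> \<alpha> \<bullet>\<^bsub>C\<^esub> \<beta> = id2 C (cd C \<alpha>))"

definition is_identity :: "('o, 'm, 'c) two_cat \<Rightarrow> 'c \<Rightarrow> bool" where
  "is_identity C \<alpha> \<longleftrightarrow> (\<exists>f \<in> ones C. \<alpha> = id2 C f)"

definition isomorphic :: "('o, 'm, 'c) two_cat \<Rightarrow> 'o \<Rightarrow> 'o \<Rightarrow> bool" where
  "isomorphic C X Y \<longleftrightarrow> (\<exists>u \<in> hom C X Y. \<exists>v \<in> hom C Y X.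
     v \<cdot>\<^bsub>C\<^esub> u = id1 C X \<and> u \<cdot>\<^bsub>C\<^esub> v = id1 C Y)"

definition co :: "('o, 'm, 'c) two_cat \<Rightarrow> ('o, 'm, 'c) two_cat" where
  "co C = C\<lparr>dm := cd C, cd := dm C, vcomp := (\<lambda>\<beta> \<alpha>. \<alpha> \<bullet>\<^bsub>C\<^esub> \<beta>)\<rparr>"

record ('o, 'm, 'c, 'p, 'n, 'd) map2 =
  on0 :: "'o \<Rightarrow> 'p"
  on1 :: "'m \<Rightarrow> 'n"
  on2 :: "'c \<Rightarrow> 'd"

definition id_map2 :: "('o, 'm, 'c, 'o, 'm, 'c) map2" where
  "id_map2 = \<lparr>on0 = (\<lambda>X. X), on1 = (\<lambda>f. f), on2 = (\<lambda>\<alpha>. \<alpha>)\<rparr>"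

definition comp_map2 :: "('p, 'n, 'd, 'q, 'k, 'e) map2 \<Rightarrow> ('o, 'm, 'c, 'p, 'n, 'd) map2
    \<Rightarrow> ('o, 'm, 'c, 'q, 'k, 'e) map2" (infixr \<open>\<circ>\<^sub>2\<close> 75) where
  "G \<circ>\<^sub>2 F = \<lparr>on0 = on0 G \<circ> on0 F, on1 = on1 G \<circ> on1 F, on2 = on2 G \<circ> on2 F\<rparr>"

text \<open>Equality of 2-functors with domain \<open>C\<close>; values off the carriers are irrelevant.\<close>

definition eq_on :: "('o, 'm, 'c) two_cat \<Rightarrow> ('o, 'm, 'c, 'p, 'n, 'd) map2
    \<Rightarrow> ('o, 'm, 'c, 'p, 'n, 'd) map2 \<Rightarrow> bool" where
  "eq_on C F G \<longleftrightarrow> (\<forall>X \<in> obs C. on0 F X = on0 G X) \<and> (\<forall>f \<in> ones C. on1 F f = on1 G f)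
     \<and> (\<forall>\<alpha> \<in> twos C. on2 F \<alpha> = on2 G \<alpha>)"

locale two_functor = S: two_category C + T: two_category D
  for C :: "('o, 'm, 'c) two_cat" and D :: "('p, 'n, 'd) two_cat" +
  fixes F :: "('o, 'm, 'c, 'p, 'n, 'd) map2"
  assumes on0_ob: "X \<in> obs C \<Longrightarrow> on0 F X \<in> obs D"
    and on1_hom: "f \<in> hom C X Y \<Longrightarrow> on1 F f \<in> hom D (on0 F X) (on0 F Y)"
    and on2_cell: "\<alpha> \<in> cells C f g \<Longrightarrow> on2 F \<alpha> \<in> cells D (on1 F f) (on1 F g)"
    and on1_id: "X \<in> obs C \<Longrightarrow> on1 F (id1 C X) = id1 D (on0 F X)"
    and on1_comp: "\<lbrakk>f \<in> hom C X Y; g \<in> hom C Y Z\<rbrakk>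
          \<Longrightarrow> on1 F (g \<cdot>\<^bsub>C\<^esub> f) = on1 F g \<cdot>\<^bsub>D\<^esub> on1 F f"
    and on2_id: "f \<in> ones C \<Longrightarrow> on2 F (id2 C f) = id2 D (on1 F f)"
    and on2_vcomp: "\<lbrakk>\<alpha> \<in> cells C f g; \<beta> \<in> cells C g h\<rbrakk>
          \<Longrightarrow> on2 F (\<beta> \<bullet>\<^bsub>C\<^esub> \<alpha>) = on2 F \<beta> \<bullet>\<^bsub>D\<^esub> on2 F \<alpha>"
    and on2_hcomp: "\<lbrakk>\<alpha> \<in> cells C f f'; \<beta> \<in> cells C g g'; tgt C f = src C g\<rbrakk>
          \<Longrightarrow> on2 F (\<beta> \<star>\<^bsub>C\<^esub> \<alpha>) = on2 F \<beta> \<star>\<^bsub>D\<^esub> on2 F \<alpha>"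

definition two_equivalence :: "('o, 'm, 'c) two_cat \<Rightarrow> ('p, 'n, 'd) two_cat
    \<Rightarrow> ('o, 'm, 'c, 'p, 'n, 'd) map2 \<Rightarrow> bool" where
  "two_equivalence C D F \<longleftrightarrow> two_functor C D F
     \<and> (\<forall>Y \<in> obs D. \<exists>X \<in> obs C. isomorphic D (on0 F X) Y)
     \<and> (\<forall>X \<in> obs C. \<forall>Y \<in> obs C.
          bij_betw (on1 F) (hom C X Y) (hom D (on0 F X) (on0 F Y))
        \<and> bij_betw (on2 F) {\<alpha> \<in> twos C. dm C \<alpha> \<in> hom C X Y}
            {\<beta> \<in> twos D. dm D \<beta> \<in> hom D (on0 F X) (on0 F Y)})"

definition two_isomorphism :: "('o, 'm, 'c) two_cat \<Rightarrow> ('p, 'n, 'd) two_cat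
    \<Rightarrow> ('o, 'm, 'c, 'p, 'n, 'd) map2 \<Rightarrow> bool" where
  "two_isomorphism C D F \<longleftrightarrow> two_functor C D F \<and> bij_betw (on0 F) (obs C) (obs D)
     \<and> bij_betw (on1 F) (ones C) (ones D) \<and> bij_betw (on2 F) (twos C) (twos D)"

definition two_natural :: "('o, 'm, 'c) two_cat \<Rightarrow> ('p, 'n, 'd) two_cat
    \<Rightarrow> ('o, 'm, 'c, 'p, 'n, 'd) map2 \<Rightarrow> ('o, 'm, 'c, 'p, 'n, 'd) map2 \<Rightarrow> ('o \<Rightarrow> 'n) \<Rightarrow> bool" where
  "two_natural C D F G \<tau> \<longleftrightarrow>
     (\<forall>X \<in> obs C. \<tau> X \<in> hom D (on0 F X) (on0 G X))
   \<and> (\<forall>f \<in> ones C. on1 G f \<cdot>\<^bsub>D\<^esub> \<tau> (src C f) = \<tau> (tgt C f) \<cdot>\<^bsub>D\<^esub> on1 F f)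
   \<and> (\<forall>\<alpha> \<in> twos C. on2 G \<alpha> \<lhd>\<^bsub>D\<^esub> \<tau> (src C (dm C \<alpha>)) = \<tau> (tgt C (dm C \<alpha>)) \<rhd>\<^bsub>D\<^esub> on2 F \<alpha>)"

text \<open>The 2-adjunction \<open>L \<stileturn> U\<close> with \<open>U : C \<rightarrow> D\<close>, unit \<open>\<eta>\<close> and counit \<open>\<epsilon>\<close>.\<close>

definition two_adjunction :: "('o, 'm, 'c) two_cat \<Rightarrow> ('p, 'n, 'd) two_cat
    \<Rightarrow> ('o, 'm, 'c, 'p, 'n, 'd) map2 \<Rightarrow> ('p, 'n, 'd, 'o, 'm, 'c) map2
    \<Rightarrow> ('p \<Rightarrow> 'n) \<Rightarrow> ('o \<Rightarrow> 'm) \<Rightarrow> bool" where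
  "two_adjunction C D U L \<eta> \<epsilon> \<longleftrightarrow> two_functor C D U \<and> two_functor D C L
     \<and> two_natural D D id_map2 (U \<circ>\<^sub>2 L) \<eta> \<and> two_natural C C (L \<circ>\<^sub>2 U) id_map2 \<epsilon>
     \<and> (\<forall>X \<in> obs C. on1 U (\<epsilon> X) \<cdot>\<^bsub>D\<^esub> \<eta> (on0 U X) = id1 D (on0 U X))
     \<and> (\<forall>Y \<in> obs D. \<epsilon> (on0 L Y) \<cdot>\<^bsub>C\<^esub> on1 L (\<eta> Y) = id1 C (on0 L Y))"

text \<open>Adjunctions \<open>(\<epsilon>, f \<stileturn> g, \<eta>)\<close> inside a 2-category.\<close>

definition adjunction :: "('o, 'm, 'c) two_cat \<Rightarrow> 'c \<Rightarrow> 'm \<Rightarrow> 'm \<Rightarrow> 'c \<Rightarrow> bool" where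
  "adjunction C \<epsilon> f g \<eta> \<longleftrightarrow> f \<in> ones C \<and> g \<in> hom C (tgt C f) (src C f)
     \<and> \<eta> \<in> cells C (id1 C (src C f)) (g \<cdot>\<^bsub>C\<^esub> f)
     \<and> \<epsilon> \<in> cells C (f \<cdot>\<^bsub>C\<^esub> g) (id1 C (tgt C f))
     \<and> (\<epsilon> \<lhd>\<^bsub>C\<^esub> f) \<bullet>\<^bsub>C\<^esub> (f \<rhd>\<^bsub>C\<^esub> \<eta>) = id2 C f
     \<and> (g \<rhd>\<^bsub>C\<^esub> \<epsilon>) \<bullet>\<^bsub>C\<^esub> (\<eta> \<lhd>\<^bsub>C\<^esub> g) = id2 C g"

definition adjoint_equivalence :: "('o, 'm, 'c) two_cat \<Rightarrow> 'c \<Rightarrow> 'm \<Rightarrow> 'm \<Rightarrow> 'c \<Rightarrow> bool" where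
  "adjoint_equivalence C \<epsilon> f g \<eta> \<longleftrightarrow>
     adjunction C \<epsilon> f g \<eta> \<and> invertible C \<epsilon> \<and> invertible C \<eta>"


section \<open>F-categories\<close>

record ('o, 'm, 'c, 'n, 'd) f_cat =
  tau :: "('o, 'm, 'c) two_cat"
  lam :: "('o, 'n, 'd) two_cat"
  incl :: "('o, 'm, 'c, 'o, 'n, 'd) map2"

locale f_category =
  fixes A :: "('o, 'm, 'c, 'n, 'd) f_cat"
  assumes incl_functor: "two_functor (tau A) (lam A) (incl A)"
    and obs_eq: "obs (tau A) = obs (lam A)"
    and incl_ob: "X \<in> obs (tau A) \<Longrightarrow> on0 (incl A) X = X"
    and incl_inj: "inj_on (on1 (incl A)) (ones (tau A))"
    and incl_locally_ff: "\<lbrakk>f \<in> hom (tau A) X Y; g \<in> hom (tau A) X Y\<rbrakk> \<Longrightarrow>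
      bij_betw (on2 (incl A)) (cells (tau A) f g) (cells (lam A) (on1 (incl A) f) (on1 (incl A) g))"

definition tight :: "('o, 'm, 'c, 'n, 'd) f_cat \<Rightarrow> 'n \<Rightarrow> bool" where
  "tight A f \<longleftrightarrow> f \<in> on1 (incl A) ` ones (tau A)"

text \<open>A 2-category viewed as an F-category all of whose morphisms are tight.\<close>

definition chordate :: "('o, 'm, 'c) two_cat \<Rightarrow> ('o, 'm, 'c, 'm, 'c) f_cat" where
  "chordate C = \<lparr>tau = C, lam = C, incl = id_map2\<rparr>"

definition f_co :: "('o, 'm, 'c, 'n, 'd) f_cat \<Rightarrow> ('o, 'm, 'c, 'n, 'd) f_cat" where
  "f_co A = \<lparr>tau = co (tau A), lam = co (lam A), incl = incl A\<rparr>"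

text \<open>An F-functor is given by its action on loose morphisms.\<close>

definition f_functor :: "('o, 'm, 'c, 'n, 'd) f_cat \<Rightarrow> ('o', 'm', 'c', 'n', 'd') f_cat
    \<Rightarrow> ('o, 'n, 'd, 'o', 'n', 'd') map2 \<Rightarrow> bool" where
  "f_functor A B F \<longleftrightarrow> f_category A \<and> f_category B \<and> two_functor (lam A) (lam B) F
     \<and> (\<forall>f. tight A f \<longrightarrow> tight B (on1 F f))"

text \<open>
  The restriction of \<open>F\<close> to tight parts: the map \<open>G\<close> with
  \<open>incl B \<circ>\<^sub>2 G = F \<circ>\<^sub>2 incl A\<close>, obtained by inverting the injection \<open>incl B\<close>.
\<close>

definition tight_part :: "('o, 'm, 'c, 'n, 'd) f_cat \<Rightarrow> ('o', 'm', 'c', 'n', 'd') f_cat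
    \<Rightarrow> ('o, 'n, 'd, 'o', 'n', 'd') map2 \<Rightarrow> ('o, 'm, 'c, 'o', 'm', 'c') map2" where
  "tight_part A B F =
     \<lparr>on0 = on0 F,
      on1 = (\<lambda>f. inv_into (ones (tau B)) (on1 (incl B)) (on1 F (on1 (incl A) f))),
      on2 = (\<lambda>\<alpha>. inv_into (twos (tau B)) (on2 (incl B)) (on2 F (on2 (incl A) \<alpha>)))\<rparr>"

definition f_equivalence :: "('o, 'm, 'c, 'n, 'd) f_cat \<Rightarrow> ('o', 'm', 'c', 'n', 'd') f_cat
    \<Rightarrow> ('o, 'n, 'd, 'o', 'n', 'd') map2 \<Rightarrow> bool" where
  "f_equivalence A B F \<longleftrightarrow> f_functor A B F
     \<and> two_equivalence (tau A) (tau B) (tight_part A B F) \<and> two_equivalence (lam A) (lam B) F"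

definition f_isomorphism :: "('o, 'm, 'c, 'n, 'd) f_cat \<Rightarrow> ('o', 'm', 'c', 'n', 'd') f_cat
    \<Rightarrow> ('o, 'n, 'd, 'o', 'n', 'd') map2 \<Rightarrow> bool" where
  "f_isomorphism A B F \<longleftrightarrow> f_functor A B F
     \<and> two_isomorphism (tau A) (tau B) (tight_part A B F) \<and> two_isomorphism (lam A) (lam B) F"

definition locally_faithful :: "('o, 'm, 'c, 'n, 'd) f_cat
    \<Rightarrow> ('o, 'n, 'd, 'o', 'n', 'd') map2 \<Rightarrow> bool" where
  "locally_faithful A H \<longleftrightarrow> (\<forall>f g. inj_on (on2 H) (cells (lam A) f g))"

definition reflects_identities :: "('o, 'm, 'c, 'n, 'd) f_cat \<Rightarrow> ('o', 'm', 'c', 'n', 'd') f_cat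
    \<Rightarrow> ('o, 'n, 'd, 'o', 'n', 'd') map2 \<Rightarrow> bool" where
  "reflects_identities A B H \<longleftrightarrow>
     (\<forall>\<alpha> \<in> twos (lam A). is_identity (lam B) (on2 H \<alpha>) \<longrightarrow> is_identity (lam A) \<alpha>)"


section \<open>Doctrinal F-functors\<close>

datatype weakness = Lax | Pseudo | Colax

text \<open>
  The flag \<open>ps\<close> distinguishes the pseudo version of a notion (\<open>True\<close>: the relevant 2-cells are
  invertible) from the lax one (\<open>False\<close>); the colax version is the lax one in the co-dual.
\<close>

definition reflection :: "bool \<Rightarrow> ('o, 'm, 'c, 'n, 'd) f_cat \<Rightarrow> 'n \<Rightarrow> 'n \<Rightarrow> 'd \<Rightarrow> bool" where
  "reflection ps A f g \<eta> \<longleftrightarrow> adjunction (lam A) (id2 (lam A) (id1 (lam A) (tgt (lam A) f))) f g \<eta>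
     \<and> tight A f \<and> (ps \<longrightarrow> invertible (lam A) \<eta>)"

definition tight_square :: "('o, 'm, 'c, 'n, 'd) f_cat \<Rightarrow> 'n \<Rightarrow> 'n \<Rightarrow> 'n \<Rightarrow> 'n \<Rightarrow> bool" where
  "tight_square A f1 f2 r s \<longleftrightarrow> tight A r \<and> tight A s
     \<and> r \<in> hom (lam A) (src (lam A) f1) (src (lam A) f2)
     \<and> s \<in> hom (lam A) (tgt (lam A) f1) (tgt (lam A) f2)
     \<and> f2 \<cdot>\<^bsub>lam A\<^esub> r = s \<cdot>\<^bsub>lam A\<^esub> f1"

text \<open>
  When a tight commuting square \<open>(r, s)\<close> between the left adjoints of two reflections
  is a morphism of reflections.
\<close>

definition reflection_morphism :: "('o, 'm, 'c, 'n, 'd) f_cat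
    \<Rightarrow> 'n \<Rightarrow> 'd \<Rightarrow> 'n \<Rightarrow> 'd \<Rightarrow> 'n \<Rightarrow> 'n \<Rightarrow> bool" where
  "reflection_morphism A g1 \<eta>1 g2 \<eta>2 r s \<longleftrightarrow>
     g2 \<cdot>\<^bsub>lam A\<^esub> s = r \<cdot>\<^bsub>lam A\<^esub> g1 \<and> r \<rhd>\<^bsub>lam A\<^esub> \<eta>1 = \<eta>2 \<lhd>\<^bsub>lam A\<^esub> r"

definition lifts_reflections :: "bool \<Rightarrow> ('o, 'm, 'c, 'n, 'd) f_cat
    \<Rightarrow> ('o', 'm', 'c', 'n', 'd') f_cat \<Rightarrow> ('o, 'n, 'd, 'o', 'n', 'd') map2 \<Rightarrow> bool" where
  "lifts_reflections ps A B H \<longleftrightarrow> (\<forall>f g \<eta>. tight A f \<and> reflection ps B (on1 H f) g \<eta> \<longrightarrow>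
     (\<exists>!(g', \<eta>'). reflection ps A f g' \<eta>' \<and> on1 H g' = g \<and> on2 H \<eta>' = \<eta>))"

definition detects_reflection_morphisms :: "bool \<Rightarrow> ('o, 'm, 'c, 'n, 'd) f_cat
    \<Rightarrow> ('o', 'm', 'c', 'n', 'd') f_cat \<Rightarrow> ('o, 'n, 'd, 'o', 'n', 'd') map2 \<Rightarrow> bool" where
  "detects_reflection_morphisms ps A B H \<longleftrightarrow> (\<forall>f1 g1 \<eta>1 f2 g2 \<eta>2 r s.
     reflection ps A f1 g1 \<eta>1 \<and> reflection ps A f2 g2 \<eta>2 \<and> tight_square A f1 f2 r s \<longrightarrow>
     (reflection_morphism A g1 \<eta>1 g2 \<eta>2 r s \<longleftrightarrow>
      reflection_morphism B (on1 H g1) (on2 H \<eta>1) (on1 H g2) (on2 H \<eta>2) (on1 H r) (on1 H s)))"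

definition w_Refl :: "weakness \<Rightarrow> ('o, 'm, 'c, 'n, 'd) f_cat
    \<Rightarrow> ('o', 'm', 'c', 'n', 'd') f_cat \<Rightarrow> ('o, 'n, 'd, 'o', 'n', 'd') map2 \<Rightarrow> bool" where
  "w_Refl w A B H = (case w of
     Lax \<Rightarrow> lifts_reflections False A B H
   | Pseudo \<Rightarrow> lifts_reflections True A B H
   | Colax \<Rightarrow> lifts_reflections False (f_co A) (f_co B) H)"

definition w_Morph :: "weakness \<Rightarrow> ('o, 'm, 'c, 'n, 'd) f_cat
    \<Rightarrow> ('o', 'm', 'c', 'n', 'd') f_cat \<Rightarrow> ('o, 'n, 'd, 'o', 'n', 'd') map2 \<Rightarrow> bool" where
  "w_Morph w A B H = (case w of
     Lax \<Rightarrow> detects_reflection_morphisms False A B H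
   | Pseudo \<Rightarrow> detects_reflection_morphisms True A B H
   | Colax \<Rightarrow> detects_reflection_morphisms False (f_co A) (f_co B) H)"

definition w_doctrinal :: "weakness \<Rightarrow> ('o, 'm, 'c, 'n, 'd) f_cat
    \<Rightarrow> ('o', 'm', 'c', 'n', 'd') f_cat \<Rightarrow> ('o, 'n, 'd, 'o', 'n', 'd') map2 \<Rightarrow> bool" where
  "w_doctrinal w A B H \<longleftrightarrow> w_Refl w A B H \<and> w_Morph w A B H \<and> locally_faithful A H"

definition w_doctrinal_adjunction :: "weakness \<Rightarrow> ('o, 'm, 'c, 'n, 'd) f_cat
    \<Rightarrow> ('o', 'm', 'c', 'n', 'd') f_cat \<Rightarrow> ('o, 'n, 'd, 'o', 'n', 'd') map2 \<Rightarrow> bool" where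
  "w_doctrinal_adjunction w A B H = (case w of
     Lax \<Rightarrow> (\<forall>f g \<epsilon> \<eta>. tight A f \<and> adjunction (lam B) \<epsilon> (on1 H f) g \<eta> \<longrightarrow>
       (\<exists>!(\<epsilon>', g', \<eta>'). adjunction (lam A) \<epsilon>' f g' \<eta>'
          \<and> on2 H \<epsilon>' = \<epsilon> \<and> on1 H g' = g \<and> on2 H \<eta>' = \<eta>))
   | Pseudo \<Rightarrow> (\<forall>f g \<epsilon> \<eta>. tight A f \<and> adjoint_equivalence (lam B) \<epsilon> (on1 H f) g \<eta> \<longrightarrow>
       (\<exists>!(\<epsilon>', g', \<eta>'). adjoint_equivalence (lam A) \<epsilon>' f g' \<eta>'
          \<and> on2 H \<epsilon>' = \<epsilon> \<and> on1 H g' = g \<and> on2 H \<eta>' = \<eta>))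
   | Colax \<Rightarrow> (\<forall>f g \<epsilon> \<eta>. tight A f \<and> adjunction (lam B) \<epsilon> g (on1 H f) \<eta> \<longrightarrow>
       (\<exists>!(\<epsilon>', g', \<eta>'). adjunction (lam A) \<epsilon>' g' f \<eta>'
          \<and> on2 H \<epsilon>' = \<epsilon> \<and> on1 H g' = g \<and> on2 H \<eta>' = \<eta>)))"


section \<open>Limits of loose morphisms\<close>

text \<open>With \<open>ps = True\<close> only cones with invertible 2-cell are considered.\<close>

definition colax_cone :: "bool \<Rightarrow> ('o, 'm, 'c, 'n, 'd) f_cat \<Rightarrow> 'n \<Rightarrow> 'o \<Rightarrow> 'n \<Rightarrow> 'd \<Rightarrow> 'n \<Rightarrow> bool" where
  "colax_cone ps A f X r \<alpha> s \<longleftrightarrow>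
     r \<in> hom (lam A) X (src (lam A) f) \<and> s \<in> hom (lam A) X (tgt (lam A) f)
   \<and> \<alpha> \<in> cells (lam A) s (f \<cdot>\<^bsub>lam A\<^esub> r) \<and> (ps \<longrightarrow> invertible (lam A) \<alpha>)"

definition induces :: "('o, 'm, 'c, 'n, 'd) f_cat \<Rightarrow> 'o \<Rightarrow> 'n \<Rightarrow> 'n \<Rightarrow> 'd
    \<Rightarrow> 'o \<Rightarrow> 'n \<Rightarrow> 'd \<Rightarrow> 'n \<Rightarrow> 'n \<Rightarrow> bool" where
  "induces A K p q l X r \<alpha> s t \<longleftrightarrow> t \<in> hom (lam A) X K
     \<and> p \<cdot>\<^bsub>lam A\<^esub> t = r \<and> q \<cdot>\<^bsub>lam A\<^esub> t = s \<and> l \<lhd>\<^bsub>lam A\<^esub> t = \<alpha>"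

definition colax_limit :: "bool \<Rightarrow> ('o, 'm, 'c, 'n, 'd) f_cat \<Rightarrow> 'n
    \<Rightarrow> 'o \<Rightarrow> 'n \<Rightarrow> 'n \<Rightarrow> 'd \<Rightarrow> bool" where
  "colax_limit ps A f K p q l \<longleftrightarrow>
     tight A p \<and> tight A q \<and> colax_cone ps A f K p l q
   \<and> (\<forall>X r \<alpha> s. colax_cone ps A f X r \<alpha> s \<longrightarrow> (\<exists>!t. induces A K p q l X r \<alpha> s t))
   \<and> (\<forall>X r \<alpha> s r' \<alpha>' s' t t' \<theta>r \<theta>s.
        colax_cone ps A f X r \<alpha> s \<and> colax_cone ps A f X r' \<alpha>' s'
      \<and> induces A K p q l X r \<alpha> s t \<and> induces A K p q l X r' \<alpha>' s' t'
      \<and> \<theta>r \<in> cells (lam A) r r' \<and> \<theta>s \<in> cells (lam A) s s'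
      \<and> \<alpha>' \<bullet>\<^bsub>lam A\<^esub> \<theta>s = (f \<rhd>\<^bsub>lam A\<^esub> \<theta>r) \<bullet>\<^bsub>lam A\<^esub> \<alpha>
      \<longrightarrow> (\<exists>!\<phi>. \<phi> \<in> cells (lam A) t t' \<and> p \<rhd>\<^bsub>lam A\<^esub> \<phi> = \<theta>r \<and> q \<rhd>\<^bsub>lam A\<^esub> \<phi> = \<theta>s))
   \<and> (\<forall>X. \<forall>t \<in> hom (lam A) X K.
        tight A t \<longleftrightarrow> tight A (p \<cdot>\<^bsub>lam A\<^esub> t) \<and> tight A (q \<cdot>\<^bsub>lam A\<^esub> t))"

definition w_limit :: "weakness \<Rightarrow> ('o, 'm, 'c, 'n, 'd) f_cat \<Rightarrow> 'n
    \<Rightarrow> 'o \<Rightarrow> 'n \<Rightarrow> 'n \<Rightarrow> 'd \<Rightarrow> bool" where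
  "w_limit w A f K p q l = (case w of
     Lax \<Rightarrow> colax_limit False (f_co A) f K p q l
   | Pseudo \<Rightarrow> colax_limit True A f K p q l
   | Colax \<Rightarrow> colax_limit False A f K p q l)"

definition admits_limits :: "weakness \<Rightarrow> ('o, 'm, 'c, 'n, 'd) f_cat \<Rightarrow> bool" where
  "admits_limits w A \<longleftrightarrow> (\<forall>f \<in> ones (lam A). \<exists>K p q l. w_limit w A f K p q l)"

definition admits_limits_of_arrows :: "weakness \<Rightarrow> ('o, 'm, 'c) two_cat \<Rightarrow> bool" where
  "admits_limits_of_arrows w C \<longleftrightarrow> admits_limits w (chordate C)"

fun bar :: "weakness \<Rightarrow> weakness" where
  "bar Lax = Colax"
| "bar Pseudo = Pseudo"
| "bar Colax = Lax"


section \<open>2-monads and their algebras\<close>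

record ('o, 'm, 'c) monad2 =
  endo :: "('o, 'm, 'c, 'o, 'm, 'c) map2"
  mult :: "'o \<Rightarrow> 'm"
  munit :: "'o \<Rightarrow> 'm"

definition two_monad :: "('o, 'm, 'c) two_cat \<Rightarrow> ('o, 'm, 'c) monad2 \<Rightarrow> bool" where
  "two_monad B M \<longleftrightarrow> two_functor B B (endo M)
     \<and> two_natural B B (endo M \<circ>\<^sub>2 endo M) (endo M) (mult M)
     \<and> two_natural B B id_map2 (endo M) (munit M)
     \<and> (\<forall>X \<in> obs B.
          mult M X \<cdot>\<^bsub>B\<^esub> mult M (on0 (endo M) X) = mult M X \<cdot>\<^bsub>B\<^esub> on1 (endo M) (mult M X)
        \<and> mult M X \<cdot>\<^bsub>B\<^esub> munit M (on0 (endo M) X) = id1 B (on0 (endo M) X)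
        \<and> mult M X \<cdot>\<^bsub>B\<^esub> on1 (endo M) (munit M X) = id1 B (on0 (endo M) X))"

text \<open>An algebra is a pair \<open>(X, a)\<close> of a carrier and a structure map.\<close>

definition algebra :: "('o, 'm, 'c) two_cat \<Rightarrow> ('o, 'm, 'c) monad2 \<Rightarrow> 'o \<times> 'm \<Rightarrow> bool" where
  "algebra B M = (\<lambda>(X, a). X \<in> obs B \<and> a \<in> hom B (on0 (endo M) X) X
     \<and> a \<cdot>\<^bsub>B\<^esub> on1 (endo M) a = a \<cdot>\<^bsub>B\<^esub> mult M X \<and> a \<cdot>\<^bsub>B\<^esub> munit M X = id1 B X)"

datatype ('o, 'm, 'c) alg_mor =
  AlgMor (asrc: "'o \<times> 'm") (atgt: "'o \<times> 'm") (und1: 'm) (struct: 'c)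

datatype ('o, 'm, 'c) alg_cell =
  AlgCell (adm: "('o, 'm, 'c) alg_mor") (acd: "('o, 'm, 'c) alg_mor") (und2: 'c)

definition lax_morphism ::
  "('o, 'm, 'c) two_cat \<Rightarrow> ('o, 'm, 'c) monad2 \<Rightarrow> ('o, 'm, 'c) alg_mor \<Rightarrow> bool" where
  "lax_morphism B M F = (case F of AlgMor (X, a) (Y, b) f f' \<Rightarrow>
     algebra B M (X, a) \<and> algebra B M (Y, b) \<and> f \<in> hom B X Y
   \<and> f' \<in> cells B (b \<cdot>\<^bsub>B\<^esub> on1 (endo M) f) (f \<cdot>\<^bsub>B\<^esub> a)
   \<and> f' \<lhd>\<^bsub>B\<^esub> mult M X = (f' \<lhd>\<^bsub>B\<^esub> on1 (endo M) a) \<bullet>\<^bsub>B\<^esub> (b \<rhd>\<^bsub>B\<^esub> on2 (endo M) f')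
   \<and> f' \<lhd>\<^bsub>B\<^esub> munit M X = id2 B f)"

definition colax_morphism ::
  "('o, 'm, 'c) two_cat \<Rightarrow> ('o, 'm, 'c) monad2 \<Rightarrow> ('o, 'm, 'c) alg_mor \<Rightarrow> bool" where
  "colax_morphism B M F = (case F of AlgMor (X, a) (Y, b) f f' \<Rightarrow>
     algebra B M (X, a) \<and> algebra B M (Y, b) \<and> f \<in> hom B X Y
   \<and> f' \<in> cells B (f \<cdot>\<^bsub>B\<^esub> a) (b \<cdot>\<^bsub>B\<^esub> on1 (endo M) f)
   \<and> f' \<lhd>\<^bsub>B\<^esub> mult M X = (b \<rhd>\<^bsub>B\<^esub> on2 (endo M) f') \<bullet>\<^bsub>B\<^esub> (f' \<lhd>\<^bsub>B\<^esub> on1 (endo M) a)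
   \<and> f' \<lhd>\<^bsub>B\<^esub> munit M X = id2 B f)"

definition pseudo_morphism ::
  "('o, 'm, 'c) two_cat \<Rightarrow> ('o, 'm, 'c) monad2 \<Rightarrow> ('o, 'm, 'c) alg_mor \<Rightarrow> bool" where
  "pseudo_morphism B M F \<longleftrightarrow> lax_morphism B M F \<and> invertible B (struct F)"

definition strict_morphism ::
  "('o, 'm, 'c) two_cat \<Rightarrow> ('o, 'm, 'c) monad2 \<Rightarrow> ('o, 'm, 'c) alg_mor \<Rightarrow> bool" where
  "strict_morphism B M F \<longleftrightarrow> lax_morphism B M F \<and> is_identity B (struct F)"

definition w_morphism :: "weakness \<Rightarrow>
    ('o, 'm, 'c) two_cat \<Rightarrow> ('o, 'm, 'c) monad2 \<Rightarrow> ('o, 'm, 'c) alg_mor \<Rightarrow> bool" where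
  "w_morphism w = (case w of
     Lax \<Rightarrow> lax_morphism | Pseudo \<Rightarrow> pseudo_morphism | Colax \<Rightarrow> colax_morphism)"

text \<open>The algebra 2-cell condition between lax or pseudo morphisms, and between colax ones.\<close>

definition w_compatible :: "weakness \<Rightarrow>
    ('o, 'm, 'c) two_cat \<Rightarrow> ('o, 'm, 'c) monad2 \<Rightarrow> ('o, 'm, 'c) alg_cell \<Rightarrow> bool" where
  "w_compatible w B M \<Theta> = (let
       f' = struct (adm \<Theta>); g' = struct (acd \<Theta>); \<alpha> = und2 \<Theta>;
       a = snd (asrc (adm \<Theta>)); b = snd (atgt (adm \<Theta>))
     in if w = Colax
        then (b \<rhd>\<^bsub>B\<^esub> on2 (endo M) \<alpha>) \<bullet>\<^bsub>B\<^esub> f' = g' \<bullet>\<^bsub>B\<^esub> (\<alpha> \<lhd>\<^bsub>B\<^esub> a)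
        else (\<alpha> \<lhd>\<^bsub>B\<^esub> a) \<bullet>\<^bsub>B\<^esub> f' = g' \<bullet>\<^bsub>B\<^esub> (b \<rhd>\<^bsub>B\<^esub> on2 (endo M) \<alpha>))"

definition w_alg_cell :: "weakness \<Rightarrow>
    ('o, 'm, 'c) two_cat \<Rightarrow> ('o, 'm, 'c) monad2 \<Rightarrow> ('o, 'm, 'c) alg_cell \<Rightarrow> bool" where
  "w_alg_cell w B M \<Theta> \<longleftrightarrow> w_morphism w B M (adm \<Theta>) \<and> w_morphism w B M (acd \<Theta>)
     \<and> asrc (adm \<Theta>) = asrc (acd \<Theta>) \<and> atgt (adm \<Theta>) = atgt (acd \<Theta>)
     \<and> und2 \<Theta> \<in> cells B (und1 (adm \<Theta>)) (und1 (acd \<Theta>)) \<and> w_compatible w B M \<Theta>"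

definition alg_id1 :: "('o, 'm, 'c) two_cat \<Rightarrow> 'o \<times> 'm \<Rightarrow> ('o, 'm, 'c) alg_mor" where
  "alg_id1 B X = AlgMor X X (id1 B (fst X)) (id2 B (snd X))"

definition alg_comp1 :: "weakness \<Rightarrow> ('o, 'm, 'c) two_cat \<Rightarrow> ('o, 'm, 'c) monad2
    \<Rightarrow> ('o, 'm, 'c) alg_mor \<Rightarrow> ('o, 'm, 'c) alg_mor \<Rightarrow> ('o, 'm, 'c) alg_mor" where
  "alg_comp1 w B M G F = AlgMor (asrc F) (atgt G) (und1 G \<cdot>\<^bsub>B\<^esub> und1 F)
     (if w = Colax
      then (struct G \<lhd>\<^bsub>B\<^esub> on1 (endo M) (und1 F)) \<bullet>\<^bsub>B\<^esub> (und1 G \<rhd>\<^bsub>B\<^esub> struct F)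
      else (und1 G \<rhd>\<^bsub>B\<^esub> struct F) \<bullet>\<^bsub>B\<^esub> (struct G \<lhd>\<^bsub>B\<^esub> on1 (endo M) (und1 F)))"

definition TAlg :: "weakness \<Rightarrow> ('o, 'm, 'c) two_cat \<Rightarrow> ('o, 'm, 'c) monad2
    \<Rightarrow> ('o \<times> 'm, ('o, 'm, 'c) alg_mor, ('o, 'm, 'c) alg_cell) two_cat" where
  "TAlg w B M = \<lparr>
     obs = {X. algebra B M X},
     ones = {F. w_morphism w B M F},
     twos = {\<Theta>. w_alg_cell w B M \<Theta>},
     src = asrc, tgt = atgt, dm = adm, cd = acd,
     id1 = alg_id1 B,
     comp1 = alg_comp1 w B M,
     id2 = (\<lambda>F. AlgCell F F (id2 B (und1 F))),
     vcomp = (\<lambda>\<Psi> \<Theta>. AlgCell (adm \<Theta>) (acd \<Psi>) (und2 \<Psi> \<bullet>\<^bsub>B\<^esub> und2 \<Theta>)),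
     hcomp = (\<lambda>\<Psi> \<Theta>. AlgCell (alg_comp1 w B M (adm \<Psi>) (adm \<Theta>))
                 (alg_comp1 w B M (acd \<Psi>) (acd \<Theta>)) (und2 \<Psi> \<star>\<^bsub>B\<^esub> und2 \<Theta>))\<rparr>"

definition TAlg_s :: "('o, 'm, 'c) two_cat \<Rightarrow> ('o, 'm, 'c) monad2
    \<Rightarrow> ('o \<times> 'm, ('o, 'm, 'c) alg_mor, ('o, 'm, 'c) alg_cell) two_cat" where
  "TAlg_s B M = (TAlg Lax B M)\<lparr>
     ones := {F. strict_morphism B M F},
     twos := {\<Theta>. w_alg_cell Lax B M \<Theta>
                 \<and> strict_morphism B M (adm \<Theta>) \<and> strict_morphism B M (acd \<Theta>)}\<rparr>"

text \<open>
  A strict morphism is literally also a \<open>w\<close>-morphism for each \<open>w\<close>, since the equation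
  \<open>b \<cdot> T f = f \<cdot> a\<close> makes its identity 2-cell well typed in both directions; so the inclusion
  is the identity map.
\<close>

definition TAlg_F :: "weakness \<Rightarrow> ('o, 'm, 'c) two_cat \<Rightarrow> ('o, 'm, 'c) monad2
    \<Rightarrow> ('o \<times> 'm, ('o, 'm, 'c) alg_mor, ('o, 'm, 'c) alg_cell,
         ('o, 'm, 'c) alg_mor, ('o, 'm, 'c) alg_cell) f_cat" where
  "TAlg_F w B M = \<lparr>tau = TAlg_s B M, lam = TAlg w B M, incl = id_map2\<rparr>"

definition forget :: "('o \<times> 'm, ('o, 'm, 'c) alg_mor, ('o, 'm, 'c) alg_cell, 'o, 'm, 'c) map2" where
  "forget = \<lparr>on0 = fst, on1 = und1, on2 = und2\<rparr>"


section \<open>Monadicity\<close>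

definition induced_monad :: "('o, 'm, 'c, 'p, 'n, 'd) map2 \<Rightarrow> ('p, 'n, 'd, 'o, 'm, 'c) map2
    \<Rightarrow> ('p \<Rightarrow> 'n) \<Rightarrow> ('o \<Rightarrow> 'm) \<Rightarrow> ('p, 'n, 'd) monad2" where
  "induced_monad U L \<eta> \<epsilon> =
     \<lparr>endo = U \<circ>\<^sub>2 L, mult = (\<lambda>Y. on1 U (\<epsilon> (on0 L Y))), munit = \<eta>\<rparr>"

lemma two_monad_induced:
  assumes "two_adjunction C D U L \<eta> \<epsilon>"
  shows "two_monad D (induced_monad U L \<eta> \<epsilon>)"
proof -
  from assms have U: "two_functor C D U" and L: "two_functor D C L"
   and n: "two_natural D D id_map2 (U \<circ>\<^sub>2 L) \<eta>" and e: "two_natural C C (L \<circ>\<^sub>2 U) id_map2 \<epsilon>"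
   and t1: "\<And>X. X \<in> obs C \<Longrightarrow> on1 U (\<epsilon> X) \<cdot>\<^bsub>D\<^esub> \<eta> (on0 U X) = id1 D (on0 U X)"
   and t2: "\<And>Y. Y \<in> obs D \<Longrightarrow> \<epsilon> (on0 L Y) \<cdot>\<^bsub>C\<^esub> on1 L (\<eta> Y) = id1 C (on0 L Y)"
    by (auto simp: two_adjunction_def)
  interpret U: two_functor C D U by fact
  interpret L: two_functor D C L by fact
  have UL: "two_functor D D (U \<circ>\<^sub>2 L)"
    apply unfold_locales
    subgoal using U.on0_ob L.on0_ob by (simp add: comp_map2_def)
    subgoal using U.on1_hom L.on1_hom by (simp add: comp_map2_def)
    subgoal using U.on2_cell L.on2_cell by (simp add: comp_map2_def)
    subgoal using U.on1_id L.on1_id L.on0_ob by (simp add: comp_map2_def)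
    subgoal using U.on1_comp[OF L.on1_hom L.on1_hom] L.on1_comp by (simp add: comp_map2_def)
    subgoal premises p for f using U.on2_id L.on2_id L.on1_hom p by (simp add: comp_map2_def hom_def)
    subgoal using U.on2_vcomp[OF L.on2_cell L.on2_cell] L.on2_vcomp by (simp add: comp_map2_def)
    subgoal premises p for \<alpha> f f' \<beta> g g'
    proof -
      have "tgt C (on1 L f) = src C (on1 L g)"
        using p L.on1_hom[of f "src D f" "tgt D f"] L.on1_hom[of g "src D g" "tgt D g"]
          U.T.dm_one[of \<alpha>] U.T.dm_one[of \<beta>] by (auto simp: hom_def cells_def)
      then show ?thesis using U.on2_hcomp[OF L.on2_cell L.on2_cell] L.on2_hcomp p by (simp add: comp_map2_def)
    qed
    done
  have eh: "\<And>X. X \<in> obs C \<Longrightarrow> \<epsilon> X \<in> hom C (on0 L (on0 U X)) X"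
   and en: "\<And>f. f \<in> ones C \<Longrightarrow> f \<cdot>\<^bsub>C\<^esub> \<epsilon> (src C f) = \<epsilon> (tgt C f) \<cdot>\<^bsub>C\<^esub> on1 L (on1 U f)"
   and en2: "\<And>\<alpha>. \<alpha> \<in> twos C \<Longrightarrow> \<alpha> \<star>\<^bsub>C\<^esub> id2 C (\<epsilon> (src C (dm C \<alpha>))) = id2 C (\<epsilon> (tgt C (dm C \<alpha>))) \<star>\<^bsub>C\<^esub> on2 L (on2 U \<alpha>)"
    using e by (auto simp: two_natural_def comp_map2_def id_map2_def lwhisker_def rwhisker_def)
  have nh: "\<And>X. X \<in> obs D \<Longrightarrow> \<eta> X \<in> hom D X (on0 U (on0 L X))"
    using n by (auto simp: two_natural_def comp_map2_def id_map2_def lwhisker_def rwhisker_def)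
  have M: "two_natural D D ((U \<circ>\<^sub>2 L) \<circ>\<^sub>2 (U \<circ>\<^sub>2 L)) (U \<circ>\<^sub>2 L) (\<lambda>Y. on1 U (\<epsilon> (on0 L Y)))"
    unfolding two_natural_def
  proof (intro conjI ballI)
    fix X assume X: "X \<in> obs D"
    then show "on1 U (\<epsilon> (on0 L X)) \<in> hom D (on0 ((U \<circ>\<^sub>2 L) \<circ>\<^sub>2 (U \<circ>\<^sub>2 L)) X) (on0 (U \<circ>\<^sub>2 L) X)"
      using U.on1_hom[OF eh[OF L.on0_ob[OF X]]] by (simp add: comp_map2_def)
  next
    fix f assume f: "f \<in> ones D"
    then have Lf: "on1 L f \<in> hom C (on0 L (src D f)) (on0 L (tgt D f))" using L.on1_hom by (auto simp: hom_def)
    have s: "src D f \<in> obs D" "tgt D f \<in> obs D" using f U.T.src_ob U.T.tgt_ob by auto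
    have ULf: "on1 L (on1 U (on1 L f)) \<in> hom C (on0 L (on0 U (on0 L (src D f)))) (on0 L (on0 U (on0 L (tgt D f))))"
      using L.on1_hom[OF U.on1_hom[OF Lf]] .
    show "on1 (U \<circ>\<^sub>2 L) f \<cdot>\<^bsub>D\<^esub> on1 U (\<epsilon> (on0 L (src D f))) = on1 U (\<epsilon> (on0 L (tgt D f))) \<cdot>\<^bsub>D\<^esub> on1 ((U \<circ>\<^sub>2 L) \<circ>\<^sub>2 U \<circ>\<^sub>2 L) f"
      using en[of "on1 L f"] Lf U.on1_comp[OF eh[OF L.on0_ob[OF s(1)]] Lf] U.on1_comp[OF ULf eh[OF L.on0_ob[OF s(2)]]]
      by (simp add: comp_map2_def hom_def)
  next
    fix \<alpha> assume a: "\<alpha> \<in> twos D"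
    let ?f = "dm D \<alpha>" and ?g = "cd D \<alpha>"
    have f: "?f \<in> ones D" "?g \<in> ones D" using a U.T.dm_one U.T.cd_one by auto
    have s: "src D ?f \<in> obs D" "tgt D ?f \<in> obs D" using f U.T.src_ob U.T.tgt_ob by auto
    have ac: "\<alpha> \<in> cells D ?f ?g" using a by (simp add: cells_def)
    have Lf: "on1 L ?f \<in> hom C (on0 L (src D ?f)) (on0 L (tgt D ?f))" using f L.on1_hom by (auto simp: hom_def)
    have La: "on2 L \<alpha> \<in> cells C (on1 L ?f) (on1 L ?g)" using L.on2_cell[OF ac] .
    have ULa: "on2 L (on2 U (on2 L \<alpha>)) \<in> cells C (on1 L (on1 U (on1 L ?f))) (on1 L (on1 U (on1 L ?g)))"
      using L.on2_cell[OF U.on2_cell[OF La]] .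
    have ULf: "on1 L (on1 U (on1 L ?f)) \<in> hom C (on0 L (on0 U (on0 L (src D ?f)))) (on0 L (on0 U (on0 L (tgt D ?f))))"
      using L.on1_hom[OF U.on1_hom[OF Lf]] .
    have e1: "\<epsilon> (on0 L (src D ?f)) \<in> hom C (on0 L (on0 U (on0 L (src D ?f)))) (on0 L (src D ?f))"
      and e2: "\<epsilon> (on0 L (tgt D ?f)) \<in> hom C (on0 L (on0 U (on0 L (tgt D ?f)))) (on0 L (tgt D ?f))"
      using eh L.on0_ob s by auto
    have i: "f \<in> hom C X Y \<Longrightarrow> id2 C f \<in> cells C f f" for f X Y
      using U.S.id2_cell by (auto simp: hom_def)
    have i': "f \<in> hom C X Y \<Longrightarrow> on2 U (id2 C f) = id2 D (on1 U f)" for f X Y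
      using U.on2_id by (auto simp: hom_def)
    show "on2 (U \<circ>\<^sub>2 L) \<alpha> \<lhd>\<^bsub>D\<^esub> on1 U (\<epsilon> (on0 L (src D ?f))) = on1 U (\<epsilon> (on0 L (tgt D ?f))) \<rhd>\<^bsub>D\<^esub> on2 ((U \<circ>\<^sub>2 L) \<circ>\<^sub>2 U \<circ>\<^sub>2 L) \<alpha>"
      using en2[of "on2 L \<alpha>"] La Lf U.on2_hcomp[OF i[OF e1] La] U.on2_hcomp[OF ULa i[OF e2]] e1 e2 ULf
      by (simp add: comp_map2_def lwhisker_def rwhisker_def i'[OF e1] i'[OF e2])
         (simp add: hom_def cells_def i')
  qed
  have AX: "on1 U (\<epsilon> (on0 L X)) \<cdot>\<^bsub>D\<^esub> on1 U (\<epsilon> (on0 L (on0 U (on0 L X))))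
         = on1 U (\<epsilon> (on0 L X)) \<cdot>\<^bsub>D\<^esub> on1 U (on1 L (on1 U (\<epsilon> (on0 L X))))
      \<and> on1 U (\<epsilon> (on0 L X)) \<cdot>\<^bsub>D\<^esub> \<eta> (on0 U (on0 L X)) = id1 D (on0 U (on0 L X))
      \<and> on1 U (\<epsilon> (on0 L X)) \<cdot>\<^bsub>D\<^esub> on1 U (on1 L (\<eta> X)) = id1 D (on0 U (on0 L X))" if X: "X \<in> obs D" for X
  proof -
    have LX: "on0 L X \<in> obs C" by (rule L.on0_ob[OF X])
    have e1: "\<epsilon> (on0 L X) \<in> hom C (on0 L (on0 U (on0 L X))) (on0 L X)" by (rule eh[OF LX])
    have e2: "\<epsilon> (on0 L (on0 U (on0 L X))) \<in> hom C (on0 L (on0 U (on0 L (on0 U (on0 L X))))) (on0 L (on0 U (on0 L X)))"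
      by (intro eh L.on0_ob U.on0_ob X)
    have e3: "on1 L (on1 U (\<epsilon> (on0 L X))) \<in> hom C (on0 L (on0 U (on0 L (on0 U (on0 L X))))) (on0 L (on0 U (on0 L X)))"
      by (rule L.on1_hom[OF U.on1_hom[OF e1]])
    show ?thesis
      using en[of "\<epsilon> (on0 L X)"] e1 U.on1_comp[OF e2 e1] U.on1_comp[OF e3 e1] t1[OF LX]
        U.on1_comp[OF L.on1_hom[OF nh[OF X]] e1] t2[OF X] U.on1_id[OF LX]
      by (auto simp: hom_def)
  qed
  show ?thesis
    unfolding two_monad_def induced_monad_def using UL M n AX by (simp add: comp_map2_def)
qed

definition comparison :: "('o, 'm, 'c) two_cat \<Rightarrow> ('p, 'n, 'd) two_cat
    \<Rightarrow> ('o, 'm, 'c, 'p, 'n, 'd) map2 \<Rightarrow> ('o \<Rightarrow> 'm)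
    \<Rightarrow> ('o, 'm, 'c, 'p \<times> 'n, ('p, 'n, 'd) alg_mor, ('p, 'n, 'd) alg_cell) map2" where
  "comparison C D U \<epsilon> = (let
       E0 = (\<lambda>X. (on0 U X, on1 U (\<epsilon> X)));
       E1 = (\<lambda>f. AlgMor (E0 (src C f)) (E0 (tgt C f)) (on1 U f)
                  (id2 D (on1 U f \<cdot>\<^bsub>D\<^esub> on1 U (\<epsilon> (src C f)))))
     in \<lparr>on0 = E0, on1 = E1, on2 = (\<lambda>\<alpha>. AlgCell (E1 (dm C \<alpha>)) (E1 (cd C \<alpha>)) (on2 U \<alpha>))\<rparr>)"

text \<open>Monadicity of \<open>U : C \<rightarrow> D\<close>, witnessed by the left 2-adjoint \<open>(L, \<eta>, \<epsilon>)\<close>.\<close>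

definition monadic :: "('o, 'm, 'c) two_cat \<Rightarrow> ('p, 'n, 'd) two_cat
    \<Rightarrow> ('o, 'm, 'c, 'p, 'n, 'd) map2 \<Rightarrow> ('p, 'n, 'd, 'o, 'm, 'c) map2
    \<Rightarrow> ('p \<Rightarrow> 'n) \<Rightarrow> ('o \<Rightarrow> 'm) \<Rightarrow> bool" where
  "monadic C D U L \<eta> \<epsilon> \<longleftrightarrow> two_adjunction C D U L \<eta> \<epsilon>
     \<and> two_equivalence C (TAlg_s D (induced_monad U L \<eta> \<epsilon>)) (comparison C D U \<epsilon>)"

definition strictly_monadic :: "('o, 'm, 'c) two_cat \<Rightarrow> ('p, 'n, 'd) two_cat
    \<Rightarrow> ('o, 'm, 'c, 'p, 'n, 'd) map2 \<Rightarrow> ('p, 'n, 'd, 'o, 'm, 'c) map2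
    \<Rightarrow> ('p \<Rightarrow> 'n) \<Rightarrow> ('o \<Rightarrow> 'm) \<Rightarrow> bool" where
  "strictly_monadic C D U L \<eta> \<epsilon> \<longleftrightarrow> two_adjunction C D U L \<eta> \<epsilon>
     \<and> two_isomorphism C (TAlg_s D (induced_monad U L \<eta> \<epsilon>)) (comparison C D U \<epsilon>)"

end

theory Submission
  imports Defs
begin

text \<open>
  The extension exists because a loose morphism is determined by tight data, on which monadicity
  already has control.  The limit of a loose \<open>f\<close> supplies tight projections \<open>p\<close>, \<open>q\<close> and a 2-cell
  \<open>l : q \<Rightarrow> f \<cdot> p\<close>; the cone \<open>(1, id, f)\<close> induces a loose section \<open>r\<close> of \<open>p\<close> with \<open>q \<cdot> r = f\<close>, and
  \<open>p \<stileturn> r\<close> is a reflection whose unit \<open>\<eta>\<close> satisfies \<open>q \<rhd> \<eta> = l\<close> (\<open>limit_reflection\<close>).  So \<open>f\<close> is a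
  tight morphism after the right adjoint of a tight morphism.  Writing \<open>a X : T H X \<rightarrow> H X\<close> for the
  algebra structure given by monadicity, Kelly's doctrinal adjunction turns \<open>H r\<close>, hence \<open>H f\<close>, into
  a lax morphism, with structure cell \<open>H (q \<rhd> \<eta>) \<lhd> (a \<cdot> T H r)\<close> (\<open>right_adjoint_lax\<close>).

  This cell depends on \<open>f\<close> alone: any other presentation \<open>f = q \<cdot> r\<close> of this kind compares with the
  limit by an arrow that is tight, by the tightness clause in the definition of the limit, and the
  algebra structures slide along tight arrows (\<open>str_cell_eq_span_cell\<close>).  Similar comparisons give
  compatibility with composition (\<open>str_cell_comp\<close>) and with 2-cells (\<open>str_cell_natural\<close>).  The
  structure cell is the only possible one, since the unit of a reflection has to become an algebra
  2-cell, which leaves no choice for the structure of \<open>H r\<close> (\<open>str_cell_unique\<close>).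

  For fullness, the limit \<open>K\<close> in \<open>B\<close> of the underlying 1-cell of a lax morphism \<open>(k, s)\<close> carries an
  algebra structure that makes its projections strict (\<open>limit_algebra\<close>).  By monadicity \<open>K\<close> is \<open>H C\<close> up to
  isomorphism, its projections come from tight arrows \<open>p\<close>, \<open>q\<close>, the reflection \<open>H p \<stileturn> r\<close> lifts by the
  condition on reflections, and \<open>q\<close> after the lifted right adjoint is the required loose morphism
  (\<open>lift_morphism\<close>).  The condition on morphisms of reflections shows that no other loose morphism
  has the same image (\<open>lift_unique\<close>), and fullness on 2-cells uses the same comparison arrow.

  The lax and the pseudo case are treated together, through a flag \<open>ps\<close>; they differ where a
  2-cell that need not be invertible would have to induce a cone.  There the pseudo case presents
  both loose morphisms over one reflection (\<open>common_presentation\<close>).  The colax case is the lax case in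
  the co-duals (\<open>strict_comparison_co\<close>, \<open>algebra_extension_co\<close>).
\<close>

section \<open>Whiskering in strict 2-categories\<close>

text \<open>
  The defining axioms are restated with the carriers, sources and targets as separate premises, so
  that the simplifier can discharge them.  Composites are normalised to right-nested products, with
  1-cells split off one at a time on the left of a 2-cell and gathered into one product on its right.
\<close>

context two_category begin

lemma comp1_one [simp]:
  assumes "f \<in> ones C" "g \<in> ones C" "tgt C f = src C g"
  shows "g \<cdot> f \<in> ones C" "src C (g \<cdot> f) = src C f" "tgt C (g \<cdot> f) = tgt C g"
  using comp1_hom[of f "src C f" "tgt C f" g "tgt C g"] assms by (auto simp: hom_def)

lemma id1_one [simp]:
  assumes "X \<in> obs C"
  shows "id1 C X \<in> ones C" "src C (id1 C X) = X" "tgt C (id1 C X) = X"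
  using id1_hom[OF assms] by (auto simp: hom_def)

lemma comp1_assoc' [simp]:
  "\<lbrakk>f \<in> ones C; g \<in> ones C; h \<in> ones C; tgt C f = src C g; tgt C g = src C h\<rbrakk>
    \<Longrightarrow> (h \<cdot> g) \<cdot> f = h \<cdot> (g \<cdot> f)"
  using comp1_assoc[of f "src C f" "tgt C f" g "tgt C g" h "tgt C h"] by (auto simp: hom_def)

lemma id1_left' [simp]: "\<lbrakk>f \<in> ones C; tgt C f = Y\<rbrakk> \<Longrightarrow> id1 C Y \<cdot> f = f"
  using id1_left[of f "src C f" Y] by (auto simp: hom_def)

lemma id1_right' [simp]: "\<lbrakk>f \<in> ones C; src C f = X\<rbrakk> \<Longrightarrow> f \<cdot> id1 C X = f"
  using id1_right[of f X "tgt C f"] by (auto simp: hom_def)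

declare src_ob [simp] tgt_ob [simp] dm_one [simp] cd_one [simp]

lemma src_cd [simp]: "\<alpha> \<in> twos C \<Longrightarrow> src C (cd C \<alpha>) = src C (dm C \<alpha>)"
  and tgt_cd [simp]: "\<alpha> \<in> twos C \<Longrightarrow> tgt C (cd C \<alpha>) = tgt C (dm C \<alpha>)"
  using src_par tgt_par by simp_all

lemma id2_two [simp]:
  assumes "f \<in> ones C"
  shows "id2 C f \<in> twos C" "dm C (id2 C f) = f" "cd C (id2 C f) = f"
  using id2_cell[OF assms] by (auto simp: cells_def)

lemma vcomp_two [simp]:
  assumes "\<alpha> \<in> twos C" "\<beta> \<in> twos C" "cd C \<alpha> = dm C \<beta>"
  shows "\<beta> \<bullet> \<alpha> \<in> twos C" "dm C (\<beta> \<bullet> \<alpha>) = dm C \<alpha>" "cd C (\<beta> \<bullet> \<alpha>) = cd C \<beta>"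
  using vcomp_cell[of \<alpha> "dm C \<alpha>" "cd C \<alpha>" \<beta> "cd C \<beta>"] assms by (auto simp: cells_def)

lemma vcomp_assoc' [simp]:
  "\<lbrakk>\<alpha> \<in> twos C; \<beta> \<in> twos C; \<gamma> \<in> twos C; cd C \<alpha> = dm C \<beta>; cd C \<beta> = dm C \<gamma>\<rbrakk>
    \<Longrightarrow> (\<gamma> \<bullet> \<beta>) \<bullet> \<alpha> = \<gamma> \<bullet> (\<beta> \<bullet> \<alpha>)"
  using vcomp_assoc[of \<alpha> "dm C \<alpha>" "cd C \<alpha>" \<beta> "cd C \<beta>" \<gamma> "cd C \<gamma>"] by (auto simp: cells_def)

lemma id2_left' [simp]: "\<lbrakk>\<alpha> \<in> twos C; cd C \<alpha> = g\<rbrakk> \<Longrightarrow> id2 C g \<bullet> \<alpha> = \<alpha>"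
  using id2_left[of \<alpha> "dm C \<alpha>" g] by (auto simp: cells_def)

lemma id2_right' [simp]: "\<lbrakk>\<alpha> \<in> twos C; dm C \<alpha> = f\<rbrakk> \<Longrightarrow> \<alpha> \<bullet> id2 C f = \<alpha>"
  using id2_right[of \<alpha> f "cd C \<alpha>"] by (auto simp: cells_def)

lemma hcomp_two [simp]:
  assumes "\<alpha> \<in> twos C" "\<beta> \<in> twos C" "tgt C (dm C \<alpha>) = src C (dm C \<beta>)"
  shows "\<beta> \<star> \<alpha> \<in> twos C" "dm C (\<beta> \<star> \<alpha>) = dm C \<beta> \<cdot> dm C \<alpha>" "cd C (\<beta> \<star> \<alpha>) = cd C \<beta> \<cdot> cd C \<alpha>"
  using hcomp_cell[of \<alpha> "dm C \<alpha>" "cd C \<alpha>" \<beta> "dm C \<beta>" "cd C \<beta>"] assms by (auto simp: cells_def)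

lemma lwhisker_two [simp]:
  assumes "g \<in> ones C" "\<alpha> \<in> twos C" "src C g = tgt C (dm C \<alpha>)"
  shows "g \<rhd> \<alpha> \<in> twos C" "dm C (g \<rhd> \<alpha>) = g \<cdot> dm C \<alpha>" "cd C (g \<rhd> \<alpha>) = g \<cdot> cd C \<alpha>"
  using assms by (auto simp: lwhisker_def)

lemma rwhisker_two [simp]:
  assumes "f \<in> ones C" "\<alpha> \<in> twos C" "tgt C f = src C (dm C \<alpha>)"
  shows "\<alpha> \<lhd> f \<in> twos C" "dm C (\<alpha> \<lhd> f) = dm C \<alpha> \<cdot> f" "cd C (\<alpha> \<lhd> f) = cd C \<alpha> \<cdot> f"
  using assms by (auto simp: rwhisker_def)

lemma hcomp_assoc':
  "\<lbrakk>\<alpha> \<in> twos C; \<beta> \<in> twos C; \<gamma> \<in> twos C; tgt C (dm C \<alpha>) = src C (dm C \<beta>); tgt C (dm C \<beta>) = src C (dm C \<gamma>)\<rbrakk>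
    \<Longrightarrow> (\<gamma> \<star> \<beta>) \<star> \<alpha> = \<gamma> \<star> (\<beta> \<star> \<alpha>)"
  using hcomp_assoc[of \<alpha> "dm C \<alpha>" "cd C \<alpha>" \<beta> "dm C \<beta>" "cd C \<beta>" \<gamma> "dm C \<gamma>" "cd C \<gamma>"]
  by (auto simp: cells_def)

lemma hcomp_id2' [simp]: "\<lbrakk>f \<in> ones C; g \<in> ones C; tgt C f = src C g\<rbrakk> \<Longrightarrow> id2 C g \<star> id2 C f = id2 C (g \<cdot> f)"
  using hcomp_id2[of f "src C f" "tgt C f" g "tgt C g"] by (auto simp: hom_def)

lemma whisker_id2 [simp]:
  assumes "f \<in> ones C" "g \<in> ones C" "tgt C f = src C g"
  shows "g \<rhd> id2 C f = id2 C (g \<cdot> f)" "id2 C g \<lhd> f = id2 C (g \<cdot> f)"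
  using assms by (auto simp: lwhisker_def rwhisker_def)

lemma interchange':
  "\<lbrakk>\<alpha> \<in> twos C; \<alpha>' \<in> twos C; \<beta> \<in> twos C; \<beta>' \<in> twos C; cd C \<alpha> = dm C \<alpha>'; cd C \<beta> = dm C \<beta>';
     tgt C (dm C \<alpha>) = src C (dm C \<beta>)\<rbrakk> \<Longrightarrow> (\<beta>' \<bullet> \<beta>) \<star> (\<alpha>' \<bullet> \<alpha>) = (\<beta>' \<star> \<alpha>') \<bullet> (\<beta> \<star> \<alpha>)"
  using interchange[of \<alpha> "dm C \<alpha>" "cd C \<alpha>" \<alpha>' "cd C \<alpha>'" \<beta> "dm C \<beta>" "cd C \<beta>" \<beta>' "cd C \<beta>'"]
  by (auto simp: cells_def)

lemma lwhisker_lwhisker [simp]: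
  "\<lbrakk>g \<in> ones C; h \<in> ones C; \<alpha> \<in> twos C; src C g = tgt C (dm C \<alpha>); src C h = tgt C g\<rbrakk>
    \<Longrightarrow> (h \<cdot> g) \<rhd> \<alpha> = h \<rhd> (g \<rhd> \<alpha>)"
  using hcomp_assoc'[of \<alpha> "id2 C g" "id2 C h"] by (auto simp: lwhisker_def)

lemma rwhisker_rwhisker [simp]:
  "\<lbrakk>f \<in> ones C; g \<in> ones C; \<alpha> \<in> twos C; tgt C g = src C (dm C \<alpha>); src C g = tgt C f\<rbrakk>
    \<Longrightarrow> (\<alpha> \<lhd> g) \<lhd> f = \<alpha> \<lhd> (g \<cdot> f)"
  using hcomp_assoc'[of "id2 C f" "id2 C g" \<alpha>] by (auto simp: rwhisker_def)

lemma lwhisker_rwhisker [simp]: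
  "\<lbrakk>f \<in> ones C; g \<in> ones C; \<alpha> \<in> twos C; src C g = tgt C (dm C \<alpha>); src C (dm C \<alpha>) = tgt C f\<rbrakk>
    \<Longrightarrow> (g \<rhd> \<alpha>) \<lhd> f = g \<rhd> (\<alpha> \<lhd> f)"
  using hcomp_assoc'[of "id2 C f" \<alpha> "id2 C g"] by (auto simp: rwhisker_def lwhisker_def)

lemma lwhisker_vcomp [simp]:
  "\<lbrakk>g \<in> ones C; \<alpha> \<in> twos C; \<beta> \<in> twos C; cd C \<alpha> = dm C \<beta>; src C g = tgt C (dm C \<alpha>)\<rbrakk>
    \<Longrightarrow> g \<rhd> (\<beta> \<bullet> \<alpha>) = (g \<rhd> \<beta>) \<bullet> (g \<rhd> \<alpha>)"
  using interchange'[of \<alpha> \<beta> "id2 C g" "id2 C g"] by (auto simp: lwhisker_def)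

lemma rwhisker_vcomp [simp]:
  "\<lbrakk>f \<in> ones C; \<alpha> \<in> twos C; \<beta> \<in> twos C; cd C \<alpha> = dm C \<beta>; tgt C f = src C (dm C \<alpha>)\<rbrakk>
    \<Longrightarrow> (\<beta> \<bullet> \<alpha>) \<lhd> f = (\<beta> \<lhd> f) \<bullet> (\<alpha> \<lhd> f)"
  using interchange'[of "id2 C f" "id2 C f" \<alpha> \<beta>] by (auto simp: rwhisker_def)

lemma lwhisker_id1 [simp]: "\<lbrakk>\<alpha> \<in> twos C; tgt C (dm C \<alpha>) = Y\<rbrakk> \<Longrightarrow> id1 C Y \<rhd> \<alpha> = \<alpha>"
  using hcomp_id_left[of \<alpha> "dm C \<alpha>" "cd C \<alpha>"] by (auto simp: lwhisker_def cells_def)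

lemma rwhisker_id1 [simp]: "\<lbrakk>\<alpha> \<in> twos C; src C (dm C \<alpha>) = X\<rbrakk> \<Longrightarrow> \<alpha> \<lhd> id1 C X = \<alpha>"
  using hcomp_id_right[of \<alpha> "dm C \<alpha>" "cd C \<alpha>"] by (auto simp: rwhisker_def cells_def)

text \<open>Horizontal composition is redundant once whiskering is available; the two expressions for it
  are the exchange law that drives most calculations below.\<close>
lemma hcomp_whisker:
  assumes "\<alpha> \<in> twos C" "\<beta> \<in> twos C" "tgt C (dm C \<alpha>) = src C (dm C \<beta>)"
  shows "\<beta> \<star> \<alpha> = (\<beta> \<lhd> cd C \<alpha>) \<bullet> (dm C \<beta> \<rhd> \<alpha>)" "\<beta> \<star> \<alpha> = (cd C \<beta> \<rhd> \<alpha>) \<bullet> (\<beta> \<lhd> dm C \<alpha>)"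
  using interchange'[of \<alpha> "id2 C (cd C \<alpha>)" "id2 C (dm C \<beta>)" \<beta>]
    interchange'[of "id2 C (dm C \<alpha>)" \<alpha> \<beta> "id2 C (cd C \<beta>)"] assms
  by (auto simp: rwhisker_def lwhisker_def)

lemma whisker_exchange:
  assumes "\<alpha> \<in> twos C" "\<beta> \<in> twos C" "tgt C (dm C \<alpha>) = src C (dm C \<beta>)"
  shows "(\<beta> \<lhd> cd C \<alpha>) \<bullet> (dm C \<beta> \<rhd> \<alpha>) = (cd C \<beta> \<rhd> \<alpha>) \<bullet> (\<beta> \<lhd> dm C \<alpha>)"
  using hcomp_whisker[OF assms] by simp

text \<open>In the normal form the left-hand side of an equation between composites may be hidden inside
  a longer product.  The next lemmas restate an equation for such occurrences.\<close>
lemma comp1_reduce: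
  assumes "g \<cdot> f = h" "f \<in> ones C" "g \<in> ones C" "tgt C f = src C g"
  shows "\<lbrakk>z \<in> ones C; tgt C z = src C f\<rbrakk> \<Longrightarrow> g \<cdot> (f \<cdot> z) = h \<cdot> z"
    and "\<lbrakk>\<alpha> \<in> twos C; tgt C (dm C \<alpha>) = src C f\<rbrakk> \<Longrightarrow> g \<rhd> (f \<rhd> \<alpha>) = h \<rhd> \<alpha>"
  using assms comp1_assoc'[of z f g] lwhisker_lwhisker[of f g \<alpha>] by auto

lemma lwhisker_reduce:
  assumes "g \<rhd> \<alpha> = \<theta>" "g \<in> ones C" "\<alpha> \<in> twos C" "src C g = tgt C (dm C \<alpha>)"
  shows "\<lbrakk>z \<in> ones C; tgt C z = src C (dm C \<alpha>)\<rbrakk> \<Longrightarrow> g \<rhd> (\<alpha> \<lhd> z) = \<theta> \<lhd> z"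
  using assms lwhisker_rwhisker[of z g \<alpha>] by auto

lemma rwhisker_reduce:
  assumes "\<alpha> \<lhd> f = \<theta>" "f \<in> ones C" "\<alpha> \<in> twos C" "tgt C f = src C (dm C \<alpha>)"
  shows "\<lbrakk>z \<in> ones C; tgt C z = src C f\<rbrakk> \<Longrightarrow> \<alpha> \<lhd> (f \<cdot> z) = \<theta> \<lhd> z"
  using assms rwhisker_rwhisker[of z f \<alpha>] by auto

lemma comp1_square:
  assumes "g \<cdot> f = k \<cdot> h" "f \<in> ones C" "g \<in> ones C" "h \<in> ones C" "k \<in> ones C"
    "tgt C f = src C g" "tgt C h = src C k"
  shows "\<lbrakk>z \<in> ones C; tgt C z = src C f; src C f = src C h\<rbrakk> \<Longrightarrow> g \<cdot> (f \<cdot> z) = k \<cdot> (h \<cdot> z)"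
    and "\<lbrakk>\<alpha> \<in> twos C; tgt C (dm C \<alpha>) = src C f; src C f = src C h\<rbrakk> \<Longrightarrow> g \<rhd> (f \<rhd> \<alpha>) = k \<rhd> (h \<rhd> \<alpha>)"
    and "\<lbrakk>\<alpha> \<in> twos C; src C (dm C \<alpha>) = tgt C g; z \<in> ones C; tgt C z = src C f; src C f = src C h; tgt C g = tgt C k\<rbrakk>
       \<Longrightarrow> \<alpha> \<lhd> (g \<cdot> (f \<cdot> z)) = \<alpha> \<lhd> (k \<cdot> (h \<cdot> z))"
  using assms comp1_assoc'[of z f g] comp1_assoc'[of z h k]
    lwhisker_lwhisker[of f g \<alpha>] lwhisker_lwhisker[of h k \<alpha>] by auto

lemma invertibleI:
  "\<lbrakk>\<alpha> \<in> twos C; \<beta> \<in> twos C; dm C \<beta> = cd C \<alpha>; cd C \<beta> = dm C \<alpha>;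
    \<beta> \<bullet> \<alpha> = id2 C (dm C \<alpha>); \<alpha> \<bullet> \<beta> = id2 C (cd C \<alpha>)\<rbrakk> \<Longrightarrow> invertible C \<alpha>"
  unfolding invertible_def cells_def by blast

lemma invertibleE:
  assumes "invertible C \<alpha>"
  obtains \<beta> where "\<beta> \<in> twos C" "dm C \<beta> = cd C \<alpha>" "cd C \<beta> = dm C \<alpha>"
    "\<beta> \<bullet> \<alpha> = id2 C (dm C \<alpha>)" "\<alpha> \<bullet> \<beta> = id2 C (cd C \<alpha>)"
  using assms unfolding invertible_def cells_def by blast

lemma invertible_id2 [simp]: "f \<in> ones C \<Longrightarrow> invertible C (id2 C f)"
  by (rule invertibleI[of _ "id2 C f"]) auto

lemma invertible_vcomp:
  assumes "invertible C \<alpha>" "invertible C \<beta>" "cd C \<alpha> = dm C \<beta>"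
  shows "invertible C (\<beta> \<bullet> \<alpha>)"
proof -
  have [simp]: "\<alpha> \<in> twos C" "\<beta> \<in> twos C" using assms by (auto simp: invertible_def)
  from assms(1) obtain \<alpha>' where a [simp]: "\<alpha>' \<in> twos C" "dm C \<alpha>' = cd C \<alpha>" "cd C \<alpha>' = dm C \<alpha>"
    and aa: "\<alpha>' \<bullet> \<alpha> = id2 C (dm C \<alpha>)" "\<alpha> \<bullet> \<alpha>' = id2 C (cd C \<alpha>)" by (rule invertibleE)
  from assms(2) obtain \<beta>' where b [simp]: "\<beta>' \<in> twos C" "dm C \<beta>' = cd C \<beta>" "cd C \<beta>' = dm C \<beta>"
    and bb: "\<beta>' \<bullet> \<beta> = id2 C (dm C \<beta>)" "\<beta> \<bullet> \<beta>' = id2 C (cd C \<beta>)" by (rule invertibleE)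
  have "(\<alpha>' \<bullet> \<beta>') \<bullet> (\<beta> \<bullet> \<alpha>) = \<alpha>' \<bullet> ((\<beta>' \<bullet> \<beta>) \<bullet> \<alpha>)" using assms(3) by (simp del: )
  also have "\<dots> = id2 C (dm C \<alpha>)" using assms(3) aa bb by (simp del: vcomp_assoc')
  finally have 1: "(\<alpha>' \<bullet> \<beta>') \<bullet> (\<beta> \<bullet> \<alpha>) = id2 C (dm C \<alpha>)" .
  have "(\<beta> \<bullet> \<alpha>) \<bullet> (\<alpha>' \<bullet> \<beta>') = \<beta> \<bullet> ((\<alpha> \<bullet> \<alpha>') \<bullet> \<beta>')" using assms(3) by simp
  also have "\<dots> = id2 C (cd C \<beta>)" using assms(3) aa bb by (simp del: vcomp_assoc')
  finally have 2: "(\<beta> \<bullet> \<alpha>) \<bullet> (\<alpha>' \<bullet> \<beta>') = id2 C (cd C \<beta>)" .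
  show ?thesis by (rule invertibleI[of _ "\<alpha>' \<bullet> \<beta>'"]) (use 1 2 assms(3) in \<open>auto simp del: vcomp_assoc'\<close>)
qed

lemma invertible_lwhisker:
  assumes "invertible C \<alpha>" "g \<in> ones C" "src C g = tgt C (dm C \<alpha>)"
  shows "invertible C (g \<rhd> \<alpha>)"
proof -
  have [simp]: "\<alpha> \<in> twos C" using assms by (auto simp: invertible_def)
  from assms(1) obtain \<alpha>' where a [simp]: "\<alpha>' \<in> twos C" "dm C \<alpha>' = cd C \<alpha>" "cd C \<alpha>' = dm C \<alpha>"
    and aa: "\<alpha>' \<bullet> \<alpha> = id2 C (dm C \<alpha>)" "\<alpha> \<bullet> \<alpha>' = id2 C (cd C \<alpha>)" by (rule invertibleE)
  show ?thesis
    by (rule invertibleI[of _ "g \<rhd> \<alpha>'"])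
      (use assms aa in \<open>auto simp: lwhisker_vcomp[symmetric] simp del: lwhisker_vcomp\<close>)
qed

lemma invertible_rwhisker:
  assumes "invertible C \<alpha>" "f \<in> ones C" "tgt C f = src C (dm C \<alpha>)"
  shows "invertible C (\<alpha> \<lhd> f)"
proof -
  have [simp]: "\<alpha> \<in> twos C" using assms by (auto simp: invertible_def)
  from assms(1) obtain \<alpha>' where a [simp]: "\<alpha>' \<in> twos C" "dm C \<alpha>' = cd C \<alpha>" "cd C \<alpha>' = dm C \<alpha>"
    and aa: "\<alpha>' \<bullet> \<alpha> = id2 C (dm C \<alpha>)" "\<alpha> \<bullet> \<alpha>' = id2 C (cd C \<alpha>)" by (rule invertibleE)
  show ?thesis
    by (rule invertibleI[of _ "\<alpha>' \<lhd> f"])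
      (use assms aa in \<open>auto simp: rwhisker_vcomp[symmetric] simp del: rwhisker_vcomp\<close>)
qed

lemma homD: "f \<in> hom C X Y \<Longrightarrow> f \<in> ones C" "f \<in> hom C X Y \<Longrightarrow> src C f = X" "f \<in> hom C X Y \<Longrightarrow> tgt C f = Y"
  by (auto simp: hom_def)

end

context two_functor begin

lemma on1_one [simp]:
  assumes "f \<in> ones C"
  shows "on1 F f \<in> ones D" "src D (on1 F f) = on0 F (src C f)" "tgt D (on1 F f) = on0 F (tgt C f)"
  using on1_hom[of f "src C f" "tgt C f"] assms by (auto simp: hom_def)

lemma on2_two [simp]:
  assumes "\<alpha> \<in> twos C"
  shows "on2 F \<alpha> \<in> twos D" "dm D (on2 F \<alpha>) = on1 F (dm C \<alpha>)" "cd D (on2 F \<alpha>) = on1 F (cd C \<alpha>)"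
  using on2_cell[of \<alpha> "dm C \<alpha>" "cd C \<alpha>"] assms by (auto simp: cells_def)

declare on0_ob [simp] on1_id [simp] on2_id [simp]

lemma on1_comp' [simp]: "\<lbrakk>f \<in> ones C; g \<in> ones C; tgt C f = src C g\<rbrakk>
          \<Longrightarrow> on1 F (g \<cdot>\<^bsub>C\<^esub> f) = on1 F g \<cdot>\<^bsub>D\<^esub> on1 F f"
  using on1_comp[of f "src C f" "tgt C f" g "tgt C g"] by (auto simp: hom_def)

lemma on2_vcomp' [simp]: "\<lbrakk>\<alpha> \<in> twos C; \<beta> \<in> twos C; cd C \<alpha> = dm C \<beta>\<rbrakk>
          \<Longrightarrow> on2 F (\<beta> \<bullet>\<^bsub>C\<^esub> \<alpha>) = on2 F \<beta> \<bullet>\<^bsub>D\<^esub> on2 F \<alpha>"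
  using on2_vcomp[of \<alpha> "dm C \<alpha>" "cd C \<alpha>" \<beta> "cd C \<beta>"] by (auto simp: cells_def)

lemma on2_hcomp' [simp]: "\<lbrakk>\<alpha> \<in> twos C; \<beta> \<in> twos C; tgt C (dm C \<alpha>) = src C (dm C \<beta>)\<rbrakk>
          \<Longrightarrow> on2 F (\<beta> \<star>\<^bsub>C\<^esub> \<alpha>) = on2 F \<beta> \<star>\<^bsub>D\<^esub> on2 F \<alpha>"
  using on2_hcomp[of \<alpha> "dm C \<alpha>" "cd C \<alpha>" \<beta> "dm C \<beta>" "cd C \<beta>"] by (auto simp: cells_def)

lemma on2_whisker [simp]:
  "\<lbrakk>g \<in> ones C; \<alpha> \<in> twos C; src C g = tgt C (dm C \<alpha>)\<rbrakk> \<Longrightarrow> on2 F (g \<rhd>\<^bsub>C\<^esub> \<alpha>) = on1 F g \<rhd>\<^bsub>D\<^esub> on2 F \<alpha>"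
  "\<lbrakk>f \<in> ones C; \<alpha> \<in> twos C; tgt C f = src C (dm C \<alpha>)\<rbrakk> \<Longrightarrow> on2 F (\<alpha> \<lhd>\<^bsub>C\<^esub> f) = on2 F \<alpha> \<lhd>\<^bsub>D\<^esub> on1 F f"
  by (auto simp: lwhisker_def rwhisker_def)

lemma on2_invertible:
  assumes "invertible C \<alpha>" shows "invertible D (on2 F \<alpha>)"
proof -
  have [simp]: "\<alpha> \<in> twos C" using assms by (auto simp: invertible_def)
  from assms obtain \<alpha>' where a [simp]: "\<alpha>' \<in> twos C" "dm C \<alpha>' = cd C \<alpha>" "cd C \<alpha>' = dm C \<alpha>"
    and aa: "\<alpha>' \<bullet>\<^bsub>C\<^esub> \<alpha> = id2 C (dm C \<alpha>)" "\<alpha> \<bullet>\<^bsub>C\<^esub> \<alpha>' = id2 C (cd C \<alpha>)" by (rule S.invertibleE)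
  show ?thesis
    by (rule T.invertibleI[of _ "on2 F \<alpha>'"])
      (use aa in \<open>auto simp: on2_vcomp'[symmetric] simp del: on2_vcomp'\<close>)
qed

end

section \<open>Algebras and doctrinal adjunction\<close>
locale monad_on = two_category B for B :: "('o, 'm, 'c) two_cat" (structure) +
  fixes M :: "('o, 'm, 'c) monad2"
  assumes two_monad: "two_monad B M"
begin

abbreviation "T0 \<equiv> on0 (endo M)"
abbreviation "T1 \<equiv> on1 (endo M)"
abbreviation "T2 \<equiv> on2 (endo M)"

sublocale T: two_functor B B "endo M"
  using two_monad by (simp add: two_monad_def)

lemma mult_one [simp]:
  assumes "X \<in> obs B"
  shows "mult M X \<in> ones B" "src B (mult M X) = T0 (T0 X)" "tgt B (mult M X) = T0 X"
  using two_monad assms by (auto simp: two_monad_def two_natural_def comp_map2_def hom_def)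

lemma munit_one [simp]:
  assumes "X \<in> obs B"
  shows "munit M X \<in> ones B" "src B (munit M X) = X" "tgt B (munit M X) = T0 X"
  using two_monad assms by (auto simp: two_monad_def two_natural_def comp_map2_def id_map2_def hom_def)

lemma mult_natural:
  "f \<in> ones B \<Longrightarrow> T1 f \<cdot> mult M (src B f) = mult M (tgt B f) \<cdot> T1 (T1 f)"
  "\<alpha> \<in> twos B \<Longrightarrow> T2 \<alpha> \<lhd> mult M (src B (dm B \<alpha>)) = mult M (tgt B (dm B \<alpha>)) \<rhd> T2 (T2 \<alpha>)"
  using two_monad by (auto simp: two_monad_def two_natural_def comp_map2_def)

lemma munit_natural:
  "f \<in> ones B \<Longrightarrow> T1 f \<cdot> munit M (src B f) = munit M (tgt B f) \<cdot> f"
  "\<alpha> \<in> twos B \<Longrightarrow> T2 \<alpha> \<lhd> munit M (src B (dm B \<alpha>)) = munit M (tgt B (dm B \<alpha>)) \<rhd> \<alpha>"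
  using two_monad by (auto simp: two_monad_def two_natural_def comp_map2_def id_map2_def)

lemma algebraD:
  assumes "algebra B M (X, a)"
  shows "X \<in> obs B" "a \<in> ones B" "src B a = T0 X" "tgt B a = X"
    "a \<cdot> T1 a = a \<cdot> mult M X" "a \<cdot> munit M X = id1 B X"
  using assms by (auto simp: algebra_def hom_def)

lemma lax_morphism_iff:
  "lax_morphism B M (AlgMor (X, a) (Y, b) f s) \<longleftrightarrow>
     algebra B M (X, a) \<and> algebra B M (Y, b) \<and> f \<in> ones B \<and> src B f = X \<and> tgt B f = Y
   \<and> s \<in> twos B \<and> dm B s = b \<cdot> T1 f \<and> cd B s = f \<cdot> a
   \<and> s \<lhd> mult M X = (s \<lhd> T1 a) \<bullet> (b \<rhd> T2 s)
   \<and> s \<lhd> munit M X = id2 B f"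
  by (auto simp: lax_morphism_def hom_def cells_def)

text \<open>
  Doctrinal adjunction for a strict morphism \<open>p\<close> with right adjoint \<open>r\<close> and identity counit,
  followed by a strict morphism \<open>q\<close>.  The mate of the identity \<open>p \<cdot> c = x \<cdot> T p\<close> is \<open>\<eta> \<lhd> (c \<cdot> T r)\<close>,
  and whiskering it with \<open>q\<close> gives \<open>s\<close>.  The second claim recovers the whole cell \<open>(q \<rhd> \<eta>) \<lhd> c\<close> from \<open>s\<close>;
  the multiplication law for \<open>s\<close> is that equation whiskered with \<open>T c \<cdot> T (T r)\<close>.
\<close>
lemma right_adjoint_lax:
  assumes alg: "algebra B M (C, c)" "algebra B M (X, x)" "algebra B M (Y, y)"
    and p: "p \<in> ones B" "src B p = C" "tgt B p = X" "p \<cdot> c = x \<cdot> T1 p"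
    and q: "q \<in> ones B" "src B q = C" "tgt B q = Y" "q \<cdot> c = y \<cdot> T1 q"
    and r: "r \<in> ones B" "src B r = X" "tgt B r = C" "p \<cdot> r = id1 B X"
    and \<eta>: "\<eta> \<in> twos B" "dm B \<eta> = id1 B C" "cd B \<eta> = r \<cdot> p" "p \<rhd> \<eta> = id2 B p" "\<eta> \<lhd> r = id2 B r"
  defines "s \<equiv> (q \<rhd> \<eta>) \<lhd> (c \<cdot> T1 r)"
  shows "lax_morphism B M (AlgMor (X, x) (Y, y) (q \<cdot> r) s)"
    and "(q \<rhd> \<eta>) \<lhd> c = (s \<lhd> T1 p) \<bullet> (y \<rhd> T2 (q \<rhd> \<eta>))"
proof -
  note C = algebraD[OF alg(1)] and X = algebraD[OF alg(2)] and Y = algebraD[OF alg(3)]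
  note [simp] = C(1-4) X(1-4) Y(1-4) p q r \<eta>
  note [simp] = comp1_square[OF p(4)] comp1_square[OF q(4)]
  have [simp]: "T1 p \<cdot> T1 r = id1 B (T0 X)" using T.on1_comp'[of r p] by simp
  have [simp]: "T1 p \<rhd> T2 \<eta> = id2 B (T1 p)" using T.on2_whisker(1)[of p \<eta>] by simp
  have [simp]: "T1 p \<cdot> (T1 r \<cdot> z) = z" if "z \<in> ones B" "tgt B z = T0 X" for z
    using comp1_assoc'[of z "T1 r" "T1 p"] that by (simp del: comp1_assoc')
  have [simp]: "p \<cdot> (r \<cdot> z) = z" if "z \<in> ones B" "tgt B z = X" for z
    using comp1_assoc'[of z r p] that by (simp del: comp1_assoc')
  have sdef: "s = q \<rhd> (\<eta> \<lhd> (c \<cdot> T1 r))" by (simp add: s_def)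
  have s [simp]: "s \<in> twos B" "dm B s = y \<cdot> (T1 q \<cdot> T1 r)" "cd B s = q \<cdot> (r \<cdot> x)"
    by (auto simp: sdef)
  \<comment> \<open>Exchange \<open>\<eta>\<close> with \<open>c \<rhd> T \<eta>\<close>; one of the factors is \<open>r \<cdot> x\<close> whiskered with \<open>T (p \<rhd> \<eta>) = 1\<close>.\<close>
  have ex: "(r \<rhd> (x \<rhd> (T1 p \<rhd> T2 \<eta>))) \<bullet> (\<eta> \<lhd> c) = (\<eta> \<lhd> (c \<cdot> (T1 r \<cdot> T1 p))) \<bullet> (c \<rhd> T2 \<eta>)"
    using whisker_exchange[of "c \<rhd> T2 \<eta>" \<eta>] by simp
  hence ex: "\<eta> \<lhd> c = (\<eta> \<lhd> (c \<cdot> (T1 r \<cdot> T1 p))) \<bullet> (c \<rhd> T2 \<eta>)"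
    by simp
  have yq: "y \<rhd> (T1 q \<rhd> T2 \<eta>) = q \<rhd> (c \<rhd> T2 \<eta>)" by simp
  have "q \<rhd> (\<eta> \<lhd> c) = (q \<rhd> (\<eta> \<lhd> (c \<cdot> (T1 r \<cdot> T1 p)))) \<bullet> (q \<rhd> (c \<rhd> T2 \<eta>))"
    by (subst ex) simp
  thus main: "(q \<rhd> \<eta>) \<lhd> c = (s \<lhd> T1 p) \<bullet> (y \<rhd> T2 (q \<rhd> \<eta>))"
    by (simp add: sdef)
  have sc: "q \<rhd> (\<eta> \<lhd> (c \<cdot> z)) = (s \<lhd> (T1 p \<cdot> z)) \<bullet> (y \<rhd> (T1 q \<rhd> (T2 \<eta> \<lhd> z)))"
    if "z \<in> ones B" "tgt B z = T0 C" for z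
    using arg_cong[OF main, of "\<lambda>u. u \<lhd> z"] that by simp
  show "lax_morphism B M (AlgMor (X, x) (Y, y) (q \<cdot> r) s)"
    unfolding lax_morphism_iff
  proof (intro conjI)
    have "s \<lhd> mult M X = q \<rhd> (\<eta> \<lhd> (c \<cdot> (T1 r \<cdot> mult M X)))" by (simp add: sdef)
    also have "\<dots> = q \<rhd> (\<eta> \<lhd> (c \<cdot> (T1 c \<cdot> T1 (T1 r))))"
      using mult_natural(1)[of r] comp1_square(1)[OF C(5)] by simp
    also have "\<dots> = (s \<lhd> T1 x) \<bullet> (y \<rhd> T2 s)"
      by (subst sc) (auto simp: sdef T.on1_comp'[symmetric] simp del: T.on1_comp')
    finally show "s \<lhd> mult M X = (s \<lhd> T1 x) \<bullet> (y \<rhd> T2 s)" .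
    have "s \<lhd> munit M X = q \<rhd> (\<eta> \<lhd> (c \<cdot> (munit M C \<cdot> r)))"
      using munit_natural(1)[of r] by (simp add: sdef)
    also have "c \<cdot> (munit M C \<cdot> r) = r"
      using comp1_assoc'[of r "munit M C" c] C(6) by (simp del: comp1_assoc')
    finally show "s \<lhd> munit M X = id2 B (q \<cdot> r)" by simp
  qed (use alg in auto)
qed

end

section \<open>Reflections from limits of loose morphisms\<close>
context f_category begin

abbreviation L where "L \<equiv> lam A"

sublocale incl: two_functor "tau A" L "incl A" by (rule incl_functor)

lemma tight_one [simp]: "tight A f \<Longrightarrow> f \<in> ones L"
  by (auto simp: tight_def)

lemma tight_id1 [simp]:
  assumes "X \<in> obs L" shows "tight A (id1 L X)"
  using incl.on1_id[of X] incl_ob[of X] incl.S.id1_one(1)[of X] assms obs_eq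
  by (auto simp: tight_def image_iff intro!: bexI[of _ "id1 (tau A) X"])

lemma tight_comp [simp]:
  assumes "tight A f" "tight A g" "tgt L f = src L g"
  shows "tight A (g \<cdot>\<^bsub>L\<^esub> f)"
proof -
  from assms obtain f' g' where f: "f' \<in> ones (tau A)" "f = on1 (incl A) f'"
    and g: "g' \<in> ones (tau A)" "g = on1 (incl A) g'" by (auto simp: tight_def)
  have "tgt (tau A) f' = src (tau A) g'"
    using assms(3) f g incl_ob by auto
  thus ?thesis using incl.on1_comp'[of f' g'] f g unfolding tight_def
    by (auto simp: image_iff intro!: bexI[of _ "g' \<cdot>\<^bsub>tau A\<^esub> f'"])
qed

lemma reflection_iff:
  "reflection ps A p r \<eta> \<longleftrightarrow> tight A p \<and> r \<in> ones L \<and> src L r = tgt L p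
    \<and> tgt L r = src L p \<and> \<eta> \<in> twos L \<and> dm L \<eta> = id1 L (src L p)
    \<and> cd L \<eta> = r \<cdot>\<^bsub>L\<^esub> p \<and> p \<cdot>\<^bsub>L\<^esub> r = id1 L (tgt L p)
    \<and> p \<rhd>\<^bsub>L\<^esub> \<eta> = id2 L p \<and> \<eta> \<lhd>\<^bsub>L\<^esub> r = id2 L r
    \<and> (ps \<longrightarrow> invertible L \<eta>)" (is "?L \<longleftrightarrow> ?R")
proof
  assume L: ?L
  hence [simp]: "tight A p" "r \<in> ones L" "src L r = tgt L p"
    "tgt L r = src L p" "\<eta> \<in> twos L" "dm L \<eta> = id1 L (src L p)"
    "cd L \<eta> = r \<cdot>\<^bsub>L\<^esub> p"
    by (auto simp: reflection_def adjunction_def hom_def cells_def)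
  have [simp]: "p \<cdot>\<^bsub>L\<^esub> r = id1 L (tgt L p)"
    using L by (auto simp: reflection_def adjunction_def cells_def)
  have [simp]: "p \<cdot>\<^bsub>L\<^esub> (r \<cdot>\<^bsub>L\<^esub> p) = p"
    using incl.T.comp1_assoc'[of p r p] by (simp del: incl.T.comp1_assoc')
  show ?R using L by (auto simp: reflection_def adjunction_def)
next
  assume R: ?R
  hence "p \<in> ones L" by simp
  with R show ?L by (auto simp: reflection_def adjunction_def hom_def cells_def)
qed

context
  fixes ps f K p q l
  assumes lim: "colax_limit ps A f K p q l" and f: "f \<in> ones L"
begin

lemma colax_limitD:
  "tight A p" "tight A q" "src L p = K" "tgt L p = src L f"
  "src L q = K" "tgt L q = tgt L f" "l \<in> twos L" "dm L l = q"
  "cd L l = f \<cdot>\<^bsub>L\<^esub> p" "ps \<Longrightarrow> invertible L l"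
  using lim by (auto simp: colax_limit_def colax_cone_def hom_def cells_def)

lemma colax_limit_exists:
  assumes "r \<in> ones L" "tgt L r = src L f" "\<alpha> \<in> twos L"
    "cd L \<alpha> = f \<cdot>\<^bsub>L\<^esub> r" "ps \<Longrightarrow> invertible L \<alpha>"
  shows "\<exists>t. t \<in> ones L \<and> src L t = src L r \<and> tgt L t = K
    \<and> p \<cdot>\<^bsub>L\<^esub> t = r \<and> q \<cdot>\<^bsub>L\<^esub> t = dm L \<alpha> \<and> l \<lhd>\<^bsub>L\<^esub> t = \<alpha>"
proof -
  have "src L (dm L \<alpha>) = src L r"
    using incl.T.src_cd[OF assms(3)] assms f by simp
  moreover have "tgt L (dm L \<alpha>) = tgt L f"
    using incl.T.tgt_cd[OF assms(3)] assms f by simp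
  ultimately have "colax_cone ps A f (src L r) r \<alpha> (dm L \<alpha>)"
    using assms f by (auto simp: colax_cone_def hom_def cells_def)
  hence "\<exists>t. induces A K p q l (src L r) r \<alpha> (dm L \<alpha>) t"
    using lim unfolding colax_limit_def by blast
  thus ?thesis by (auto simp: induces_def hom_def)
qed

lemma colax_cone_precomp:
  assumes "t \<in> ones L" "tgt L t = K"
  shows "colax_cone ps A f (src L t) (p \<cdot>\<^bsub>L\<^esub> t) (l \<lhd>\<^bsub>L\<^esub> t) (q \<cdot>\<^bsub>L\<^esub> t)"
  using colax_limitD assms f incl.T.invertible_rwhisker[of l t] by (auto simp: colax_cone_def hom_def cells_def)

lemma colax_limit_eq:
  assumes "t \<in> ones L" "tgt L t = K" "t' \<in> ones L" "tgt L t' = K"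
    "p \<cdot>\<^bsub>L\<^esub> t = p \<cdot>\<^bsub>L\<^esub> t'" "l \<lhd>\<^bsub>L\<^esub> t = l \<lhd>\<^bsub>L\<^esub> t'"
  shows "t = t'"
proof -
  have s: "src L t = src L t'"
    using arg_cong[OF assms(5), of "src L"] assms(1-4) colax_limitD by simp
  have q: "q \<cdot>\<^bsub>L\<^esub> t = q \<cdot>\<^bsub>L\<^esub> t'"
    using arg_cong[OF assms(6), of "dm L"] assms(1-4) colax_limitD by simp
  have "\<exists>!u. induces A K p q l (src L t) (p \<cdot>\<^bsub>L\<^esub> t) (l \<lhd>\<^bsub>L\<^esub> t) (q \<cdot>\<^bsub>L\<^esub> t) u"
    using lim colax_cone_precomp[OF assms(1,2)] unfolding colax_limit_def by blast
  moreover have "induces A K p q l (src L t) (p \<cdot>\<^bsub>L\<^esub> t) (l \<lhd>\<^bsub>L\<^esub> t) (q \<cdot>\<^bsub>L\<^esub> t) t"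
    using assms by (auto simp: induces_def hom_def)
  moreover have "induces A K p q l (src L t) (p \<cdot>\<^bsub>L\<^esub> t) (l \<lhd>\<^bsub>L\<^esub> t) (q \<cdot>\<^bsub>L\<^esub> t) t'"
    using assms s q by (auto simp: induces_def hom_def)
  ultimately show ?thesis by blast
qed

lemma colax_limit_tight:
  "\<lbrakk>t \<in> ones L; tgt L t = K; tight A (p \<cdot>\<^bsub>L\<^esub> t); tight A (q \<cdot>\<^bsub>L\<^esub> t)\<rbrakk> \<Longrightarrow> tight A t"
  using lim unfolding colax_limit_def hom_def by blast

lemma colax_limit_cell:
  assumes "t \<in> ones L" "tgt L t = K" "t' \<in> ones L" "tgt L t' = K"
    "src L t = src L t'"
    "\<theta>r \<in> cells L (p \<cdot>\<^bsub>L\<^esub> t) (p \<cdot>\<^bsub>L\<^esub> t')"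
    "\<theta>s \<in> cells L (q \<cdot>\<^bsub>L\<^esub> t) (q \<cdot>\<^bsub>L\<^esub> t')"
    "(l \<lhd>\<^bsub>L\<^esub> t') \<bullet>\<^bsub>L\<^esub> \<theta>s = (f \<rhd>\<^bsub>L\<^esub> \<theta>r) \<bullet>\<^bsub>L\<^esub> (l \<lhd>\<^bsub>L\<^esub> t)"
  shows "\<exists>!\<phi>. \<phi> \<in> cells L t t' \<and> p \<rhd>\<^bsub>L\<^esub> \<phi> = \<theta>r \<and> q \<rhd>\<^bsub>L\<^esub> \<phi> = \<theta>s"
proof -
  have "induces A K p q l (src L t) (p \<cdot>\<^bsub>L\<^esub> t) (l \<lhd>\<^bsub>L\<^esub> t) (q \<cdot>\<^bsub>L\<^esub> t) t"
    using assms by (auto simp: induces_def hom_def)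
  moreover have "induces A K p q l (src L t) (p \<cdot>\<^bsub>L\<^esub> t') (l \<lhd>\<^bsub>L\<^esub> t') (q \<cdot>\<^bsub>L\<^esub> t') t'"
    using assms by (auto simp: induces_def hom_def)
  moreover have "colax_cone ps A f (src L t) (p \<cdot>\<^bsub>L\<^esub> t') (l \<lhd>\<^bsub>L\<^esub> t') (q \<cdot>\<^bsub>L\<^esub> t')"
    using colax_cone_precomp[OF assms(3,4)] assms(5) by simp
  ultimately show ?thesis
    using lim colax_cone_precomp[OF assms(1,2)] assms(6-8) unfolding colax_limit_def by blast
qed

lemma colax_limit_cell_eq:
  assumes "\<phi> \<in> twos L" "\<psi> \<in> twos L" "dm L \<phi> = dm L \<psi>" "cd L \<phi> = cd L \<psi>"
    "tgt L (dm L \<phi>) = K"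
    "p \<rhd>\<^bsub>L\<^esub> \<phi> = p \<rhd>\<^bsub>L\<^esub> \<psi>" "q \<rhd>\<^bsub>L\<^esub> \<phi> = q \<rhd>\<^bsub>L\<^esub> \<psi>"
  shows "\<phi> = \<psi>"
proof -
  note [simp] = colax_limitD f
  have "tgt L (cd L \<phi>) = K" using assms(1,5) incl.T.tgt_cd by simp
  hence "\<exists>!\<chi>. \<chi> \<in> cells L (dm L \<phi>) (cd L \<phi>) \<and> p \<rhd>\<^bsub>L\<^esub> \<chi> = p \<rhd>\<^bsub>L\<^esub> \<phi> \<and> q \<rhd>\<^bsub>L\<^esub> \<chi> = q \<rhd>\<^bsub>L\<^esub> \<phi>"
    using assms incl.T.whisker_exchange[of \<phi> l]
    by (intro colax_limit_cell) (auto simp: cells_def)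
  thus ?thesis using assms by (auto simp: cells_def)
qed

text \<open>
  The section \<open>r\<close> is induced by the identity cone on \<open>f\<close>, and \<open>\<eta>\<close> by the pair \<open>(id, l)\<close>, which is a map
  of cones from the cone of the identity to the cone of \<open>r \<cdot> p\<close>.  Both triangle identities hold
  because they hold after \<open>p\<close> and \<open>q\<close>.
\<close>
lemma limit_reflection:
  "\<exists>r \<eta>. reflection ps A p r \<eta> \<and> q \<cdot>\<^bsub>L\<^esub> r = f \<and> q \<rhd>\<^bsub>L\<^esub> \<eta> = l \<and> l \<lhd>\<^bsub>L\<^esub> r = id2 L f"
proof -
  note D [simp] = colax_limitD(1-9) f
  define X where "X = src L f"
  have [simp]: "X \<in> obs L" "src L f = X" by (auto simp: X_def)
  have K [simp]: "K \<in> obs L" using D(3) incl.T.src_ob[of p] by auto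
  obtain r where r [simp]: "r \<in> ones L" "src L r = X" "tgt L r = K"
    "p \<cdot>\<^bsub>L\<^esub> r = id1 L X" "q \<cdot>\<^bsub>L\<^esub> r = f" "l \<lhd>\<^bsub>L\<^esub> r = id2 L f"
    using colax_limit_exists[of "id1 L X" "id2 L f"] by auto
  have sq [simp]: "p \<cdot>\<^bsub>L\<^esub> (r \<cdot>\<^bsub>L\<^esub> z) = z" "q \<cdot>\<^bsub>L\<^esub> (r \<cdot>\<^bsub>L\<^esub> z) = f \<cdot>\<^bsub>L\<^esub> z"
    "l \<lhd>\<^bsub>L\<^esub> (r \<cdot>\<^bsub>L\<^esub> z) = id2 L (f \<cdot>\<^bsub>L\<^esub> z)"
    if "z \<in> ones L" "tgt L z = X" for z
    using incl.T.comp1_assoc'[of z r p] incl.T.comp1_assoc'[of z r q]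
      incl.T.rwhisker_rwhisker[of z r l] that
    by (simp_all del: incl.T.comp1_assoc' incl.T.rwhisker_rwhisker)
  have "\<exists>!\<eta>. \<eta> \<in> cells L (id1 L K) (r \<cdot>\<^bsub>L\<^esub> p) \<and> p \<rhd>\<^bsub>L\<^esub> \<eta> = id2 L p \<and> q \<rhd>\<^bsub>L\<^esub> \<eta> = l"
    by (rule colax_limit_cell) (auto simp: cells_def)
  then obtain \<eta> where \<eta> [simp]: "\<eta> \<in> twos L" "dm L \<eta> = id1 L K" "cd L \<eta> = r \<cdot>\<^bsub>L\<^esub> p"
    "p \<rhd>\<^bsub>L\<^esub> \<eta> = id2 L p" "q \<rhd>\<^bsub>L\<^esub> \<eta> = l" by (auto simp: cells_def)
  have \<eta>' [simp]: "p \<rhd>\<^bsub>L\<^esub> (\<eta> \<lhd>\<^bsub>L\<^esub> z) = id2 L (p \<cdot>\<^bsub>L\<^esub> z)" "q \<rhd>\<^bsub>L\<^esub> (\<eta> \<lhd>\<^bsub>L\<^esub> z) = l \<lhd>\<^bsub>L\<^esub> z"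
    if "z \<in> ones L" "tgt L z = K" for z
    using incl.T.lwhisker_rwhisker[of z p \<eta>] incl.T.lwhisker_rwhisker[of z q \<eta>] that
    by (simp_all del: incl.T.lwhisker_rwhisker)
  have tri: "\<eta> \<lhd>\<^bsub>L\<^esub> r = id2 L r"
    by (rule colax_limit_cell_eq) auto
  have inv: "invertible L \<eta>" if ps
  proof -
    from colax_limitD(10)[OF that] obtain m where m [simp]: "m \<in> twos L" "dm L m = f \<cdot>\<^bsub>L\<^esub> p"
      "cd L m = q" "m \<bullet>\<^bsub>L\<^esub> l = id2 L q" "l \<bullet>\<^bsub>L\<^esub> m = id2 L (f \<cdot>\<^bsub>L\<^esub> p)"
      by (rule incl.T.invertibleE) auto
    have "\<exists>!\<zeta>. \<zeta> \<in> cells L (r \<cdot>\<^bsub>L\<^esub> p) (id1 L K) \<and> p \<rhd>\<^bsub>L\<^esub> \<zeta> = id2 L p \<and> q \<rhd>\<^bsub>L\<^esub> \<zeta> = m"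
      by (rule colax_limit_cell) (auto simp: cells_def)
    then obtain \<zeta> where \<zeta> [simp]: "\<zeta> \<in> twos L" "cd L \<zeta> = id1 L K" "dm L \<zeta> = r \<cdot>\<^bsub>L\<^esub> p"
      "p \<rhd>\<^bsub>L\<^esub> \<zeta> = id2 L p" "q \<rhd>\<^bsub>L\<^esub> \<zeta> = m" by (auto simp: cells_def)
    show ?thesis
    proof (rule incl.T.invertibleI[of _ \<zeta>])
      show "\<zeta> \<bullet>\<^bsub>L\<^esub> \<eta> = id2 L (dm L \<eta>)"
        by (rule colax_limit_cell_eq) auto
      show "\<eta> \<bullet>\<^bsub>L\<^esub> \<zeta> = id2 L (cd L \<eta>)"
        by (rule colax_limit_cell_eq) auto
    qed auto
  qed
  have "reflection ps A p r \<eta>" using tri inv by (auto simp: reflection_iff)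
  thus ?thesis by (intro exI[of _ r] exI[of _ \<eta>]) simp
qed

end
end

section \<open>The co-dual\<close>
lemma co_simps [simp]:
  "obs (co C) = obs C" "ones (co C) = ones C" "twos (co C) = twos C" "src (co C) = src C" "tgt (co C) = tgt C"
  "dm (co C) = cd C" "cd (co C) = dm C" "id1 (co C) = id1 C" "comp1 (co C) = comp1 C" "id2 (co C) = id2 C"
  "vcomp (co C) = (\<lambda>\<beta> \<alpha>. \<alpha> \<bullet>\<^bsub>C\<^esub> \<beta>)" "hcomp (co C) = hcomp C"
  by (simp_all add: co_def)

lemma co_derived [simp]:
  "hom (co C) = hom C" "cells (co C) f g = cells C g f" "lwhisker (co C) = lwhisker C" "rwhisker (co C) = rwhisker C"
  "is_identity (co C) = is_identity C"
  by (auto simp: hom_def cells_def lwhisker_def rwhisker_def is_identity_def fun_eq_iff)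

lemma co_invertible [simp]: "invertible (co C) \<alpha> \<longleftrightarrow> invertible C \<alpha>"
  by (auto simp: invertible_def)

lemma two_category_co:
  assumes "two_category C" shows "two_category (co C)"
proof -
  interpret two_category C by fact
  have ic: "\<lbrakk>\<alpha>' \<in> twos C; \<alpha> \<in> twos C; \<beta>' \<in> twos C; \<beta> \<in> twos C; cd C \<alpha>' = dm C \<alpha>; cd C \<beta>' = dm C \<beta>;
     tgt C (dm C \<alpha>) = src C (dm C \<beta>)\<rbrakk> \<Longrightarrow> (\<beta> \<bullet>\<^bsub>C\<^esub> \<beta>') \<star>\<^bsub>C\<^esub> (\<alpha> \<bullet>\<^bsub>C\<^esub> \<alpha>') = (\<beta> \<star>\<^bsub>C\<^esub> \<alpha>) \<bullet>\<^bsub>C\<^esub> (\<beta>' \<star>\<^bsub>C\<^esub> \<alpha>')" for \<alpha> \<alpha>' \<beta> \<beta>'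
    using interchange'[of \<alpha>' \<alpha> \<beta>' \<beta>] tgt_cd[of \<alpha>'] src_cd[of \<beta>'] by simp
  show ?thesis
    by unfold_locales
      (auto simp: hom_def cells_def hcomp_assoc' ic rwhisker_id1[unfolded rwhisker_def] lwhisker_id1[unfolded lwhisker_def])
qed

lemma two_functor_co:
  assumes "two_functor C D F" shows "two_functor (co C) (co D) F"
proof -
  interpret two_functor C D F by fact
  interpret cC: two_category "co C" by (rule two_category_co) (rule S.two_category_axioms)
  interpret cD: two_category "co D" by (rule two_category_co) (rule T.two_category_axioms)
  show ?thesis by unfold_locales (auto simp: hom_def cells_def)
qed

lemma two_natural_co:
  assumes "two_category C" "two_natural C D F G \<tau>" shows "two_natural (co C) (co D) F G \<tau>"
proof -
  interpret two_category C by fact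
  show ?thesis using assms(2) by (simp add: two_natural_def)
qed

context monad_on begin

lemma monad_on_co: "monad_on (co B) M"
proof -
  interpret cB: two_category "co B" by (rule two_category_co) (rule two_category_axioms)
  show ?thesis
    by unfold_locales
      (use two_monad two_functor_co two_natural_co[OF two_category_axioms] in \<open>auto simp: two_monad_def\<close>)
qed

end

lemma algebra_co [simp]: "algebra (co B) M = algebra B M"
  by (auto simp: algebra_def fun_eq_iff)

lemma lax_morphism_co: "lax_morphism (co B) M = colax_morphism B M"
  by (auto simp: lax_morphism_def colax_morphism_def fun_eq_iff split: alg_mor.splits prod.splits)

lemma w_morphism_co: "w_morphism Lax (co B) M = w_morphism Colax B M"
  by (simp add: w_morphism_def lax_morphism_co)

lemma alg_comp1_co: "alg_comp1 Lax (co B) M = alg_comp1 Colax B M"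
  by (simp add: alg_comp1_def fun_eq_iff)

lemma alg_id1_co [simp]: "alg_id1 (co B) = alg_id1 B"
  by (simp add: alg_id1_def fun_eq_iff)

text \<open>The equations agree, but the recorded domain and codomain are exchanged: algebra 2-cells of
  the co-dual are not literally those of the original 2-category.\<close>
lemma w_compatible_co:
  assumes "asrc F = asrc G" "atgt F = atgt G"
  shows "w_compatible Lax (co B) M (AlgCell F G \<alpha>) \<longleftrightarrow> w_compatible Colax B M (AlgCell G F \<alpha>)"
  using assms by (auto simp: w_compatible_def Let_def)

section \<open>The F-category of algebras\<close>
context monad_on begin

lemma algebra_fst_snd:
  assumes "algebra B M X"
  shows "fst X \<in> obs B" "snd X \<in> ones B" "src B (snd X) = T0 (fst X)" "tgt B (snd X) = fst X"
    "snd X \<cdot> T1 (snd X) = snd X \<cdot> mult M (fst X)" "snd X \<cdot> munit M (fst X) = id1 B (fst X)"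
  using algebraD[of "fst X" "snd X"] assms by auto

lemma lax_morphism_sel:
  "lax_morphism B M F \<longleftrightarrow>
     algebra B M (asrc F) \<and> algebra B M (atgt F) \<and> und1 F \<in> ones B \<and> src B (und1 F) = fst (asrc F)
   \<and> tgt B (und1 F) = fst (atgt F) \<and> struct F \<in> twos B \<and> dm B (struct F) = snd (atgt F) \<cdot> T1 (und1 F)
   \<and> cd B (struct F) = und1 F \<cdot> snd (asrc F)
   \<and> struct F \<lhd> mult M (fst (asrc F)) = (struct F \<lhd> T1 (snd (asrc F))) \<bullet> (snd (atgt F) \<rhd> T2 (struct F))
   \<and> struct F \<lhd> munit M (fst (asrc F)) = id2 B (und1 F)"
  using lax_morphism_iff[of "fst (asrc F)" "snd (asrc F)" "fst (atgt F)" "snd (atgt F)" "und1 F" "struct F"]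
  by (cases F) auto

lemma w_morphism_lax: "w \<noteq> Colax \<Longrightarrow> w_morphism w B M F \<longleftrightarrow> lax_morphism B M F \<and> (w = Pseudo \<longrightarrow> invertible B (struct F))"
  by (cases w) (auto simp: w_morphism_def pseudo_morphism_def)

lemma w_morphism_typing:
  assumes "w_morphism w B M F"
  shows "algebra B M (asrc F)" "algebra B M (atgt F)" "und1 F \<in> ones B" "src B (und1 F) = fst (asrc F)"
    "tgt B (und1 F) = fst (atgt F)" "struct F \<in> twos B"
proof -
  interpret c: monad_on "co B" M by (rule monad_on_co)
  show "algebra B M (asrc F)" "algebra B M (atgt F)" "und1 F \<in> ones B" "src B (und1 F) = fst (asrc F)"
    "tgt B (und1 F) = fst (atgt F)" "struct F \<in> twos B"
    using assms w_morphism_lax[of w F] lax_morphism_sel[of F]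
      c.w_morphism_lax[of Lax F] c.lax_morphism_sel[of F] w_morphism_co[of B M]
    by (cases "w = Colax"; auto)+
qed

text \<open>
  Facts about \<open>w\<close>-morphisms and their 2-cells are proved for lax and pseudo morphisms and then
  carried over to colax ones as statements about lax morphisms in the co-dual.  Here the
  multiplication law needs one use of the exchange law, for the two middle cells.
\<close>
lemma w_morphism_comp_lax:
  assumes "w \<noteq> Colax" "w_morphism w B M F" "w_morphism w B M G" "atgt F = asrc G"
  shows "w_morphism w B M (alg_comp1 w B M G F)"
proof -
  define X a Y b Z c f s g u where d: "X = fst (asrc F)" "a = snd (asrc F)" "Y = fst (atgt F)" "b = snd (atgt F)"
    "Z = fst (atgt G)" "c = snd (atgt G)" "f = und1 F" "s = struct F" "g = und1 G" "u = struct G"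
  have d': "fst (asrc G) = Y" "snd (asrc G) = b" using assms(4) d by auto
  have F: "lax_morphism B M F" and G: "lax_morphism B M G"
    and inv: "w = Pseudo \<Longrightarrow> invertible B s" "w = Pseudo \<Longrightarrow> invertible B u"
    using assms(2,3) w_morphism_lax[OF assms(1)] d by auto
  note F' = F[unfolded lax_morphism_sel, folded d] and G' = G[unfolded lax_morphism_sel, folded d, unfolded d']
  have al: "algebra B M (X,a)" "algebra B M (Y,b)" "algebra B M (Z,c)" using F' G' d by auto
  note aX = algebraD[OF al(1)] and aY = algebraD[OF al(2)] and aZ = algebraD[OF al(3)]
  have f [simp]: "f \<in> ones B" "src B f = X" "tgt B f = Y" "s \<in> twos B" "dm B s = b \<cdot> T1 f" "cd B s = f \<cdot> a"
    and fm: "s \<lhd> mult M X = (s \<lhd> T1 a) \<bullet> (b \<rhd> T2 s)" and fu: "s \<lhd> munit M X = id2 B f"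
    using F' by auto
  have g [simp]: "g \<in> ones B" "src B g = Y" "tgt B g = Z" "u \<in> twos B" "dm B u = c \<cdot> T1 g" "cd B u = g \<cdot> b"
    and gm: "u \<lhd> mult M Y = (u \<lhd> T1 b) \<bullet> (c \<rhd> T2 u)" and gu: "u \<lhd> munit M Y = id2 B g"
    using G' by auto
  note [simp] = aX(1-4) aY(1-4) aZ(1-4)
  have "lax_morphism B M (AlgMor (X, a) (Z, c) (g \<cdot> f) ((g \<rhd> s) \<bullet> (u \<lhd> T1 f)))"
    unfolding lax_morphism_iff
  proof (intro conjI)
    have "((g \<rhd> s) \<bullet> (u \<lhd> T1 f)) \<lhd> mult M X = (g \<rhd> (s \<lhd> mult M X)) \<bullet> (u \<lhd> (mult M Y \<cdot> T1 (T1 f)))"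
      using mult_natural(1)[of f] by simp
    also have "\<dots> = (g \<rhd> (s \<lhd> mult M X)) \<bullet> ((u \<lhd> mult M Y) \<lhd> T1 (T1 f))" by simp
    also have "\<dots> = (g \<rhd> ((s \<lhd> T1 a) \<bullet> (b \<rhd> T2 s))) \<bullet> (((u \<lhd> T1 b) \<bullet> (c \<rhd> T2 u)) \<lhd> T1 (T1 f))"
      by (simp only: fm gm)
    also have "\<dots> = (g \<rhd> (s \<lhd> T1 a)) \<bullet> (((g \<rhd> (b \<rhd> T2 s)) \<bullet> (u \<lhd> (T1 b \<cdot> T1 (T1 f)))) \<bullet> (c \<rhd> (T2 u \<lhd> T1 (T1 f))))"
      by simp
    also have "(g \<rhd> (b \<rhd> T2 s)) \<bullet> (u \<lhd> (T1 b \<cdot> T1 (T1 f))) = (u \<lhd> (T1 f \<cdot> T1 a)) \<bullet> (c \<rhd> (T1 g \<rhd> T2 s))"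
      using whisker_exchange[of "T2 s" u] by simp
    also have "(g \<rhd> (s \<lhd> T1 a)) \<bullet> (((u \<lhd> (T1 f \<cdot> T1 a)) \<bullet> (c \<rhd> (T1 g \<rhd> T2 s))) \<bullet> (c \<rhd> (T2 u \<lhd> T1 (T1 f))))
      = (((g \<rhd> s) \<bullet> (u \<lhd> T1 f)) \<lhd> T1 a) \<bullet> (c \<rhd> T2 ((g \<rhd> s) \<bullet> (u \<lhd> T1 f)))"
      by simp
    finally show "((g \<rhd> s) \<bullet> (u \<lhd> T1 f)) \<lhd> mult M X = (((g \<rhd> s) \<bullet> (u \<lhd> T1 f)) \<lhd> T1 a) \<bullet> (c \<rhd> T2 ((g \<rhd> s) \<bullet> (u \<lhd> T1 f)))" .
    have "((g \<rhd> s) \<bullet> (u \<lhd> T1 f)) \<lhd> munit M X = (g \<rhd> (s \<lhd> munit M X)) \<bullet> (u \<lhd> (munit M Y \<cdot> f))"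
      using munit_natural(1)[of f] by simp
    also have "\<dots> = (g \<rhd> (s \<lhd> munit M X)) \<bullet> ((u \<lhd> munit M Y) \<lhd> f)" by simp
    also have "\<dots> = id2 B (g \<cdot> f)" by (simp only: fu gu) simp
    finally show "((g \<rhd> s) \<bullet> (u \<lhd> T1 f)) \<lhd> munit M X = id2 B (g \<cdot> f)" .
  qed (use al in simp_all)
  moreover have "alg_comp1 w B M G F = AlgMor (X, a) (Z, c) (g \<cdot> f) ((g \<rhd> s) \<bullet> (u \<lhd> T1 f))"
    using assms(1) by (simp add: alg_comp1_def d)
  moreover have "invertible B ((g \<rhd> s) \<bullet> (u \<lhd> T1 f))" if "w = Pseudo"
    by (intro invertible_vcomp invertible_lwhisker invertible_rwhisker inv that) simp_all
  ultimately show ?thesis using w_morphism_lax[OF assms(1)] by simp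
qed

lemma w_morphism_comp:
  assumes "w_morphism w B M F" "w_morphism w B M G" "atgt F = asrc G"
  shows "w_morphism w B M (alg_comp1 w B M G F)"
proof (cases "w = Colax")
  case True
  interpret c: monad_on "co B" M by (rule monad_on_co)
  show ?thesis using c.w_morphism_comp_lax[of Lax F G] assms True
    by (simp add: w_morphism_co alg_comp1_co)
qed (use w_morphism_comp_lax assms in blast)

lemma alg_comp1_assoc_lax:
  assumes "w \<noteq> Colax" "w_morphism w B M F" "w_morphism w B M G" "w_morphism w B M K" "atgt F = asrc G" "atgt G = asrc K"
  shows "alg_comp1 w B M K (alg_comp1 w B M G F) = alg_comp1 w B M (alg_comp1 w B M K G) F"
proof -
  note L = assms(2-4)[unfolded w_morphism_lax[OF assms(1)] lax_morphism_sel]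
  note [simp] = algebra_fst_snd(1-4)
  show ?thesis
    using L assms(1,5,6) by (simp add: alg_comp1_def)
qed

lemma alg_comp1_assoc:
  assumes "w_morphism w B M F" "w_morphism w B M G" "w_morphism w B M K" "atgt F = asrc G" "atgt G = asrc K"
  shows "alg_comp1 w B M K (alg_comp1 w B M G F) = alg_comp1 w B M (alg_comp1 w B M K G) F"
proof (cases "w = Colax")
  case True
  interpret c: monad_on "co B" M by (rule monad_on_co)
  show ?thesis using c.alg_comp1_assoc_lax[of Lax F G K] assms True
    by (simp add: w_morphism_co alg_comp1_co)
qed (use alg_comp1_assoc_lax assms in blast)

text \<open>For strict morphisms the two coherence laws follow from the naturality of the multiplication
  and the unit, so only the equation between 1-cells remains.\<close>
lemma strict_morphism_sel:
  "strict_morphism B M F \<longleftrightarrow>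
     algebra B M (asrc F) \<and> algebra B M (atgt F) \<and> und1 F \<in> ones B \<and> src B (und1 F) = fst (asrc F)
   \<and> tgt B (und1 F) = fst (atgt F) \<and> und1 F \<cdot> snd (asrc F) = snd (atgt F) \<cdot> T1 (und1 F)
   \<and> struct F = id2 B (und1 F \<cdot> snd (asrc F))" (is "?L \<longleftrightarrow> ?R")
proof
  assume ?L
  hence L: "lax_morphism B M F" and "is_identity B (struct F)" by (auto simp: strict_morphism_def)
  then obtain h where "h \<in> ones B" "struct F = id2 B h" by (auto simp: is_identity_def)
  thus ?R using L unfolding lax_morphism_sel by auto
next
  assume R: ?R
  note [simp] = algebra_fst_snd(1-4)
  have al: "algebra B M (asrc F)" "algebra B M (atgt F)" using R by auto
  note X = algebra_fst_snd[OF al(1)] and Y = algebra_fst_snd[OF al(2)]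
  have f [simp]: "und1 F \<in> ones B" "src B (und1 F) = fst (asrc F)" "tgt B (und1 F) = fst (atgt F)"
    "und1 F \<cdot> snd (asrc F) = snd (atgt F) \<cdot> T1 (und1 F)" using R by auto
  note [simp] = X(1-4) Y(1-4) comp1_square[OF f(4)]
  have Tf [simp]: "T1 (und1 F) \<cdot> T1 (snd (asrc F)) = T1 (snd (atgt F)) \<cdot> T1 (T1 (und1 F))"
    using T.on1_comp'[of "snd (asrc F)" "und1 F"] by simp
  have "snd (atgt F) \<cdot> (T1 (und1 F) \<cdot> munit M (fst (asrc F))) = und1 F"
    using munit_natural(1)[of "und1 F"] comp1_reduce(1)[OF Y(6), of "und1 F"] by simp
  moreover have "snd (atgt F) \<cdot> (T1 (und1 F) \<cdot> mult M (fst (asrc F))) = snd (atgt F) \<cdot> (T1 (snd (atgt F)) \<cdot> T1 (T1 (und1 F)))"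
    using mult_natural(1)[of "und1 F"] comp1_square(1)[OF Y(5), of "T1 (T1 (und1 F))"] by simp
  ultimately have "lax_morphism B M F"
    unfolding lax_morphism_sel using R by simp
  moreover have "is_identity B (struct F)" using R by (auto simp: is_identity_def)
  ultimately show ?L by (simp add: strict_morphism_def)
qed

lemma strict_morphism_co: "strict_morphism (co B) M F \<longleftrightarrow> strict_morphism B M F"
proof -
  interpret c: monad_on "co B" M by (rule monad_on_co)
  show ?thesis unfolding strict_morphism_sel c.strict_morphism_sel by simp
qed

lemma strict_w_morphism:
  assumes "strict_morphism B M F" shows "w_morphism w B M F"
proof (cases "w = Colax")
  case True
  thus ?thesis using assms strict_morphism_co[of F]
    by (simp add: w_morphism_co[symmetric]) (simp add: strict_morphism_def w_morphism_def)
next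
  case False
  have "invertible B (struct F)" using assms by (auto simp: strict_morphism_def is_identity_def)
  thus ?thesis using assms False by (simp add: w_morphism_lax strict_morphism_def)
qed

lemma strict_alg_id1: "algebra B M X \<Longrightarrow> strict_morphism B M (alg_id1 B X)"
  unfolding strict_morphism_sel using algebra_fst_snd[of X] by (simp add: alg_id1_def)

lemma strict_alg_comp1:
  assumes "strict_morphism B M F" "strict_morphism B M G" "atgt F = asrc G"
  shows "alg_comp1 w B M G F = AlgMor (asrc F) (atgt G) (und1 G \<cdot> und1 F) (id2 B ((und1 G \<cdot> und1 F) \<cdot> snd (asrc F)))"
    and "strict_morphism B M (alg_comp1 w B M G F)"
proof -
  note F = assms(1)[unfolded strict_morphism_sel] and G = assms(2)[unfolded strict_morphism_sel]
  have al: "algebra B M (asrc F)" "algebra B M (asrc G)" "algebra B M (atgt G)" using F G by auto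
  note [simp] = algebra_fst_snd(1-4)[OF al(1)] algebra_fst_snd(1-4)[OF al(2)] algebra_fst_snd(1-4)[OF al(3)]
  have f [simp]: "und1 F \<in> ones B" "src B (und1 F) = fst (asrc F)" "tgt B (und1 F) = fst (asrc G)"
    "und1 F \<cdot> snd (asrc F) = snd (asrc G) \<cdot> T1 (und1 F)" using F assms(3) by auto
  have g [simp]: "und1 G \<in> ones B" "src B (und1 G) = fst (asrc G)" "tgt B (und1 G) = fst (atgt G)"
    "und1 G \<cdot> snd (asrc G) = snd (atgt G) \<cdot> T1 (und1 G)" using G by auto
  note [simp] = comp1_square[OF f(4)] comp1_square[OF g(4)] assms(3)
  show 1: "alg_comp1 w B M G F = AlgMor (asrc F) (atgt G) (und1 G \<cdot> und1 F) (id2 B ((und1 G \<cdot> und1 F) \<cdot> snd (asrc F)))"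
    using F G by (simp add: alg_comp1_def)
  show "strict_morphism B M (alg_comp1 w B M G F)"
    unfolding 1 strict_morphism_sel using al by simp
qed

lemma alg_id1_unit_lax:
  assumes "w \<noteq> Colax" "w_morphism w B M F"
  shows "alg_comp1 w B M (alg_id1 B (atgt F)) F = F" "alg_comp1 w B M F (alg_id1 B (asrc F)) = F"
proof -
  note L = assms(2)[unfolded w_morphism_lax[OF assms(1)] lax_morphism_sel]
  note [simp] = algebra_fst_snd(1-4)
  show "alg_comp1 w B M (alg_id1 B (atgt F)) F = F" "alg_comp1 w B M F (alg_id1 B (asrc F)) = F"
    using L assms(1) by (cases F; simp add: alg_comp1_def alg_id1_def)+
qed

lemma alg_id1_unit:
  assumes "w_morphism w B M F"
  shows "alg_comp1 w B M (alg_id1 B (atgt F)) F = F" "alg_comp1 w B M F (alg_id1 B (asrc F)) = F"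
proof -
  interpret c: monad_on "co B" M by (rule monad_on_co)
  show "alg_comp1 w B M (alg_id1 B (atgt F)) F = F" "alg_comp1 w B M F (alg_id1 B (asrc F)) = F"
    using alg_id1_unit_lax[of w F] c.alg_id1_unit_lax[of Lax F] assms
    by (cases "w = Colax"; simp add: w_morphism_co alg_comp1_co)+
qed

text \<open>Separating the boundary from the underlying 2-cell lets the boundary be exchanged under
  duality.\<close>
definition algebra_cell where
  "algebra_cell w F G \<alpha> \<longleftrightarrow> w_morphism w B M F \<and> w_morphism w B M G \<and> asrc F = asrc G \<and> atgt F = atgt G
     \<and> \<alpha> \<in> cells B (und1 F) (und1 G) \<and> w_compatible w B M (AlgCell F G \<alpha>)"

lemma w_alg_cell_iff: "w_alg_cell w B M \<Theta> \<longleftrightarrow> algebra_cell w (adm \<Theta>) (acd \<Theta>) (und2 \<Theta>)"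
  by (cases \<Theta>) (auto simp: w_alg_cell_def algebra_cell_def)

lemma algebra_cell_co: "monad_on.algebra_cell (co B) M Lax F G \<alpha> \<longleftrightarrow> algebra_cell Colax G F \<alpha>"
proof -
  interpret c: monad_on "co B" M by (rule monad_on_co)
  show ?thesis unfolding algebra_cell_def c.algebra_cell_def w_morphism_co
    using w_compatible_co[of F G B M \<alpha>] by auto
qed

lemma algebra_cellD_lax:
  assumes "w \<noteq> Colax" "algebra_cell w F G \<alpha>"
  shows "(\<alpha> \<lhd> snd (asrc G)) \<bullet> struct F = struct G \<bullet> (snd (atgt G) \<rhd> T2 \<alpha>)"
  using assms by (auto simp: algebra_cell_def w_compatible_def Let_def)

lemma algebra_cellD:
  assumes "algebra_cell w F G \<alpha>"
  shows "w_morphism w B M F" "w_morphism w B M G" "asrc F = asrc G" "atgt F = atgt G"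
    "\<alpha> \<in> twos B" "dm B \<alpha> = und1 F" "cd B \<alpha> = und1 G"
  using assms by (auto simp: algebra_cell_def cells_def)

lemma algebra_cell_id_lax:
  assumes "w \<noteq> Colax" "w_morphism w B M F" shows "algebra_cell w F F (id2 B (und1 F))"
proof -
  note L = assms(2)[unfolded w_morphism_lax[OF assms(1)] lax_morphism_sel]
  note [simp] = algebra_fst_snd(1-4)
  show ?thesis using assms L by (simp add: algebra_cell_def cells_def w_compatible_def Let_def)
qed

lemma algebra_cell_id:
  assumes "w_morphism w B M F" shows "algebra_cell w F F (id2 B (und1 F))"
proof (cases "w = Colax")
  case True
  interpret c: monad_on "co B" M by (rule monad_on_co)
  show ?thesis using c.algebra_cell_id_lax[of Lax F] assms True by (simp add: w_morphism_co algebra_cell_co)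
qed (use algebra_cell_id_lax assms in blast)

lemma algebra_cell_vcomp_lax:
  assumes "w \<noteq> Colax" "algebra_cell w F G \<alpha>" "algebra_cell w G K \<beta>"
  shows "algebra_cell w F K (\<beta> \<bullet> \<alpha>)"
proof -
  note d = algebra_cellD[OF assms(2)] and e = algebra_cellD[OF assms(3)]
  note L = d(1)[unfolded w_morphism_lax[OF assms(1)] lax_morphism_sel]
    d(2)[unfolded w_morphism_lax[OF assms(1)] lax_morphism_sel]
    e(2)[unfolded w_morphism_lax[OF assms(1)] lax_morphism_sel]
  have al: "algebra B M (asrc K)" "algebra B M (atgt K)" using L by auto
  note [simp] = algebra_fst_snd(1-4)[OF al(1)] algebra_fst_snd(1-4)[OF al(2)] d(3-7) e(3-7)
  have t [simp]: "struct F \<in> twos B" "dm B (struct F) = snd (atgt K) \<cdot> T1 (und1 F)" "cd B (struct F) = und1 F \<cdot> snd (asrc K)"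
    "struct G \<in> twos B" "dm B (struct G) = snd (atgt K) \<cdot> T1 (und1 G)" "cd B (struct G) = und1 G \<cdot> snd (asrc K)"
    "struct K \<in> twos B" "dm B (struct K) = snd (atgt K) \<cdot> T1 (und1 K)" "cd B (struct K) = und1 K \<cdot> snd (asrc K)"
    "und1 F \<in> ones B" "und1 G \<in> ones B" "und1 K \<in> ones B" "src B (und1 F) = fst (asrc K)" "tgt B (und1 F) = fst (atgt K)"
    "src B (und1 G) = fst (asrc K)" "tgt B (und1 G) = fst (atgt K)" "src B (und1 K) = fst (asrc K)" "tgt B (und1 K) = fst (atgt K)"
    using L by auto
  have c1: "(\<alpha> \<lhd> snd (asrc K)) \<bullet> struct F = struct G \<bullet> (snd (atgt K) \<rhd> T2 \<alpha>)"
    and c2: "(\<beta> \<lhd> snd (asrc K)) \<bullet> struct G = struct K \<bullet> (snd (atgt K) \<rhd> T2 \<beta>)"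
    using algebra_cellD_lax[OF assms(1,2)] algebra_cellD_lax[OF assms(1,3)] by simp_all
  have "((\<beta> \<bullet> \<alpha>) \<lhd> snd (asrc K)) \<bullet> struct F = (\<beta> \<lhd> snd (asrc K)) \<bullet> ((\<alpha> \<lhd> snd (asrc K)) \<bullet> struct F)" by simp
  also have "\<dots> = ((\<beta> \<lhd> snd (asrc K)) \<bullet> struct G) \<bullet> (snd (atgt K) \<rhd> T2 \<alpha>)" unfolding c1 by simp
  also have "\<dots> = struct K \<bullet> (snd (atgt K) \<rhd> T2 (\<beta> \<bullet> \<alpha>))" unfolding c2 by simp
  finally show ?thesis using assms(1) d(1) e(2) by (simp add: algebra_cell_def cells_def w_compatible_def Let_def)
qed

lemma algebra_cell_vcomp:
  assumes "algebra_cell w F G \<alpha>" "algebra_cell w G K \<beta>"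
  shows "algebra_cell w F K (\<beta> \<bullet> \<alpha>)"
proof (cases "w = Colax")
  case True
  interpret c: monad_on "co B" M by (rule monad_on_co)
  show ?thesis using c.algebra_cell_vcomp_lax[of Lax K G \<beta> F \<alpha>] assms True by (simp add: algebra_cell_co)
qed (use algebra_cell_vcomp_lax assms in blast)

lemma algebra_cell_hcomp_lax:
  assumes "w \<noteq> Colax" "algebra_cell w F F' \<alpha>" "algebra_cell w G G' \<beta>" "atgt F = asrc G"
  shows "algebra_cell w (alg_comp1 w B M G F) (alg_comp1 w B M G' F') (\<beta> \<star> \<alpha>)"
proof -
  note d = algebra_cellD[OF assms(2)] and e = algebra_cellD[OF assms(3)]
  note L = d(1)[unfolded w_morphism_lax[OF assms(1)] lax_morphism_sel]
    d(2)[unfolded w_morphism_lax[OF assms(1)] lax_morphism_sel]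
    e(1)[unfolded w_morphism_lax[OF assms(1)] lax_morphism_sel]
    e(2)[unfolded w_morphism_lax[OF assms(1)] lax_morphism_sel]
  define X a Y b Z c where v: "X = fst (asrc F')" "a = snd (asrc F')" "Y = fst (asrc G')" "b = snd (asrc G')"
    "Z = fst (atgt G')" "c = snd (atgt G')"
  define f s f' s' g u g' u' where v': "f = und1 F" "s = struct F" "f' = und1 F'" "s' = struct F'"
    "g = und1 G" "u = struct G" "g' = und1 G'" "u' = struct G'"
  have v2: "asrc F' = (X, a)" "asrc F = (X, a)" "atgt F = (Y, b)" "atgt F' = (Y, b)" "asrc G = (Y, b)" "asrc G' = (Y, b)"
    "atgt G = (Z, c)" "atgt G' = (Z, c)" using d(3,4) e(3,4) assms(4) by (simp_all add: v prod_eq_iff)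
  note L' = L[folded v', unfolded v2, simplified]
  have al: "algebra B M (X,a)" "algebra B M (Y,b)" "algebra B M (Z,c)" using L' by auto
  note [simp] = algebraD(1-4)[OF al(1)] algebraD(1-4)[OF al(2)] algebraD(1-4)[OF al(3)] d(5-7)[folded v'] e(5-7)[folded v']
  have t [simp]: "f \<in> ones B" "src B f = X" "tgt B f = Y" "s \<in> twos B" "dm B s = b \<cdot> T1 f" "cd B s = f \<cdot> a"
    "f' \<in> ones B" "src B f' = X" "tgt B f' = Y" "s' \<in> twos B" "dm B s' = b \<cdot> T1 f'" "cd B s' = f' \<cdot> a"
    "g \<in> ones B" "src B g = Y" "tgt B g = Z" "u \<in> twos B" "dm B u = c \<cdot> T1 g" "cd B u = g \<cdot> b"
    "g' \<in> ones B" "src B g' = Y" "tgt B g' = Z" "u' \<in> twos B" "dm B u' = c \<cdot> T1 g'" "cd B u' = g' \<cdot> b"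
    using L' by auto
  have c1: "(\<alpha> \<lhd> a) \<bullet> s = s' \<bullet> (b \<rhd> T2 \<alpha>)" and c2: "(\<beta> \<lhd> b) \<bullet> u = u' \<bullet> (c \<rhd> T2 \<beta>)"
    using algebra_cellD_lax[OF assms(1,2)] algebra_cellD_lax[OF assms(1,3)] by (simp_all add: v2 v')
  have h: "\<beta> \<star> \<alpha> = (\<beta> \<lhd> f') \<bullet> (g \<rhd> \<alpha>)" using hcomp_whisker(1)[of \<alpha> \<beta>] by simp
  have "((\<beta> \<star> \<alpha>) \<lhd> a) \<bullet> ((g \<rhd> s) \<bullet> (u \<lhd> T1 f)) = (\<beta> \<lhd> (f' \<cdot> a)) \<bullet> ((g \<rhd> ((\<alpha> \<lhd> a) \<bullet> s)) \<bullet> (u \<lhd> T1 f))"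
    unfolding h by simp
  also have "\<dots> = ((\<beta> \<lhd> (f' \<cdot> a)) \<bullet> (g \<rhd> s')) \<bullet> ((g \<rhd> (b \<rhd> T2 \<alpha>)) \<bullet> (u \<lhd> T1 f))"
    unfolding c1 by simp
  also have "(\<beta> \<lhd> (f' \<cdot> a)) \<bullet> (g \<rhd> s') = (g' \<rhd> s') \<bullet> (\<beta> \<lhd> (b \<cdot> T1 f'))"
    using whisker_exchange[of s' \<beta>] by simp
  also have "(g \<rhd> (b \<rhd> T2 \<alpha>)) \<bullet> (u \<lhd> T1 f) = (u \<lhd> T1 f') \<bullet> (c \<rhd> (T1 g \<rhd> T2 \<alpha>))"
    using whisker_exchange[of "T2 \<alpha>" u] by simp
  also have "((g' \<rhd> s') \<bullet> (\<beta> \<lhd> (b \<cdot> T1 f'))) \<bullet> ((u \<lhd> T1 f') \<bullet> (c \<rhd> (T1 g \<rhd> T2 \<alpha>)))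
     = (g' \<rhd> s') \<bullet> ((((\<beta> \<lhd> b) \<bullet> u) \<lhd> T1 f') \<bullet> (c \<rhd> (T1 g \<rhd> T2 \<alpha>)))" by simp
  also have "\<dots> = ((g' \<rhd> s') \<bullet> (u' \<lhd> T1 f')) \<bullet> (c \<rhd> T2 (\<beta> \<star> \<alpha>))"
    unfolding c2 h by simp
  finally have "((\<beta> \<star> \<alpha>) \<lhd> a) \<bullet> ((g \<rhd> s) \<bullet> (u \<lhd> T1 f)) = ((g' \<rhd> s') \<bullet> (u' \<lhd> T1 f')) \<bullet> (c \<rhd> T2 (\<beta> \<star> \<alpha>))" .
  moreover have "w_morphism w B M (alg_comp1 w B M G F)" "w_morphism w B M (alg_comp1 w B M G' F')"
    using w_morphism_comp[OF d(1) e(1)] w_morphism_comp[OF d(2) e(2)] by (simp_all add: v2)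
  ultimately show ?thesis using assms(1)
    by (simp add: algebra_cell_def cells_def w_compatible_def Let_def alg_comp1_def v2 v'[symmetric])
qed

lemma algebra_cell_hcomp:
  assumes "algebra_cell w F F' \<alpha>" "algebra_cell w G G' \<beta>" "atgt F = asrc G"
  shows "algebra_cell w (alg_comp1 w B M G F) (alg_comp1 w B M G' F') (\<beta> \<star> \<alpha>)"
proof (cases "w = Colax")
  case True
  interpret c: monad_on "co B" M by (rule monad_on_co)
  show ?thesis using c.algebra_cell_hcomp_lax[of Lax F' F \<alpha> G' G \<beta>] assms algebra_cellD(3,4)[OF assms(1)] algebra_cellD(3,4)[OF assms(2)] True
    by (simp add: algebra_cell_co alg_comp1_co)
qed (use algebra_cell_hcomp_lax assms in blast)

lemma TAlg_simps [simp]: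
  "obs (TAlg w B M) = {X. algebra B M X}" "ones (TAlg w B M) = {F. w_morphism w B M F}"
  "twos (TAlg w B M) = {\<Theta>. algebra_cell w (adm \<Theta>) (acd \<Theta>) (und2 \<Theta>)}"
  "src (TAlg w B M) = asrc" "tgt (TAlg w B M) = atgt" "dm (TAlg w B M) = adm" "cd (TAlg w B M) = acd"
  "id1 (TAlg w B M) = alg_id1 B" "comp1 (TAlg w B M) = alg_comp1 w B M"
  "id2 (TAlg w B M) = (\<lambda>F. AlgCell F F (id2 B (und1 F)))"
  "vcomp (TAlg w B M) = (\<lambda>\<Psi> \<Theta>. AlgCell (adm \<Theta>) (acd \<Psi>) (und2 \<Psi> \<bullet> und2 \<Theta>))"
  "hcomp (TAlg w B M) = (\<lambda>\<Psi> \<Theta>. AlgCell (alg_comp1 w B M (adm \<Psi>) (adm \<Theta>))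
                 (alg_comp1 w B M (acd \<Psi>) (acd \<Theta>)) (und2 \<Psi> \<star> und2 \<Theta>))"
  by (simp_all add: TAlg_def w_alg_cell_iff)

lemma alg_comp1_sel [simp]:
  "asrc (alg_comp1 w B M G F) = asrc F" "atgt (alg_comp1 w B M G F) = atgt G" "und1 (alg_comp1 w B M G F) = und1 G \<cdot> und1 F"
  "asrc (alg_id1 B X) = X" "atgt (alg_id1 B X) = X" "und1 (alg_id1 B X) = id1 B (fst X)"
  by (simp_all add: alg_comp1_def alg_id1_def)

theorem two_category_TAlg: "two_category (TAlg w B M)"
proof (unfold_locales, goal_cases)
  case (1 f) thus ?case by (simp add: w_morphism_typing)
next
  case (2 f) thus ?case by (simp add: w_morphism_typing)
next
  case (3 X) thus ?case by (simp add: hom_def strict_w_morphism strict_alg_id1)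
next
  case (4 f X Y g Z) thus ?case by (auto simp: hom_def w_morphism_comp)
next
  case (5 f W X g Y h Z) thus ?case by (auto simp: hom_def alg_comp1_assoc)
next
  case (6 f X Y) thus ?case by (auto simp: hom_def alg_id1_unit)
next
  case (7 f X Y) thus ?case by (auto simp: hom_def alg_id1_unit)
next
  case (8 \<alpha>) thus ?case by (auto dest: algebra_cellD)
next
  case (9 \<alpha>) thus ?case by (auto dest: algebra_cellD)
next
  case (10 \<alpha>) thus ?case by (auto dest: algebra_cellD)
next
  case (11 \<alpha>) thus ?case by (auto dest: algebra_cellD)
next
  case (12 f) thus ?case by (auto simp: cells_def algebra_cell_id)
next
  case (13 \<alpha> f g \<beta> h) thus ?case by (auto simp: cells_def algebra_cell_vcomp)
next
  case (14 \<alpha> f g \<beta> h \<gamma> k)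
  hence c: "algebra_cell w f g (und2 \<alpha>)" "algebra_cell w g h (und2 \<beta>)" "algebra_cell w h k (und2 \<gamma>)" by (auto simp: cells_def)
  show ?case using 14 algebra_cellD(5-7)[OF c(1)] algebra_cellD(5-7)[OF c(2)] algebra_cellD(5-7)[OF c(3)] by (auto simp: cells_def)
next
  case (15 \<alpha> f g)
  hence c: "algebra_cell w f g (und2 \<alpha>)" by (auto simp: cells_def)
  show ?case using 15 algebra_cellD(5-7)[OF c] by (cases \<alpha>) (auto simp: cells_def)
next
  case (16 \<alpha> f g)
  hence c: "algebra_cell w f g (und2 \<alpha>)" by (auto simp: cells_def)
  show ?case using 16 algebra_cellD(5-7)[OF c] by (cases \<alpha>) (auto simp: cells_def)
next
  case (17 \<alpha> f f' \<beta> g g') thus ?case by (auto simp: cells_def algebra_cell_hcomp)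
next
  case (18 \<alpha> f f' \<beta> g g' \<gamma> h h')
  hence c: "algebra_cell w f f' (und2 \<alpha>)" "algebra_cell w g g' (und2 \<beta>)" "algebra_cell w h h' (und2 \<gamma>)"
    "atgt f = asrc g" "atgt g = asrc h" by (auto simp: cells_def)
  note d = algebra_cellD[OF c(1)] algebra_cellD[OF c(2)] algebra_cellD[OF c(3)]
  show ?case using 18 d alg_comp1_assoc[of w f g h] alg_comp1_assoc[of w f' g' h']
     w_morphism_typing(3-5)[OF d(1)] w_morphism_typing(3-5)[OF d(8)] w_morphism_typing(3-5)[OF d(15)]
    by (auto simp: cells_def hcomp_assoc')
next
  case (19 \<alpha> f f')
  hence c: "algebra_cell w f f' (und2 \<alpha>)" by (auto simp: cells_def)
  note d = algebra_cellD[OF c]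
  show ?case using 19 d alg_id1_unit[OF d(1)] alg_id1_unit[OF d(2)] w_morphism_typing(3-5)[OF d(1)]
      lwhisker_id1[of "und2 \<alpha>"]
    by (cases \<alpha>) (auto simp: cells_def lwhisker_def)
next
  case (20 \<alpha> f f')
  hence c: "algebra_cell w f f' (und2 \<alpha>)" by (auto simp: cells_def)
  note d = algebra_cellD[OF c]
  show ?case using 20 d alg_id1_unit[OF d(1)] alg_id1_unit[OF d(2)] w_morphism_typing(3-5)[OF d(1)]
      rwhisker_id1[of "und2 \<alpha>"]
    by (cases \<alpha>) (auto simp: cells_def rwhisker_def)
next
  case (21 f X Y g Z)
  hence c: "w_morphism w B M f" "w_morphism w B M g" "atgt f = asrc g" by (auto simp: hom_def)
  show ?case using c w_morphism_typing[OF c(1)] w_morphism_typing[OF c(2)] by simp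
next
  case (22 \<alpha> f f' \<alpha>' f'' \<beta> g g' \<beta>' g'')
  hence c: "algebra_cell w f f' (und2 \<alpha>)" "algebra_cell w f' f'' (und2 \<alpha>')" "algebra_cell w g g' (und2 \<beta>)" "algebra_cell w g' g'' (und2 \<beta>')"
    "atgt f = asrc g" by (auto simp: cells_def)
  note d = algebra_cellD[OF c(1)] algebra_cellD[OF c(2)] algebra_cellD[OF c(3)] algebra_cellD[OF c(4)]
  show ?case using 22 c(5) d w_morphism_typing(3-5)[OF d(1)] w_morphism_typing(3-5)[OF d(15)]
    interchange'[of "und2 \<alpha>" "und2 \<alpha>'" "und2 \<beta>" "und2 \<beta>'"]
    by (auto simp: cells_def)
qed

lemma TAlg_s_simps [simp]:
  "obs (TAlg_s B M) = {X. algebra B M X}" "ones (TAlg_s B M) = {F. strict_morphism B M F}"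
  "twos (TAlg_s B M) = {\<Theta>. algebra_cell Lax (adm \<Theta>) (acd \<Theta>) (und2 \<Theta>) \<and> strict_morphism B M (adm \<Theta>) \<and> strict_morphism B M (acd \<Theta>)}"
  "src (TAlg_s B M) = asrc" "tgt (TAlg_s B M) = atgt" "dm (TAlg_s B M) = adm" "cd (TAlg_s B M) = acd"
  "id1 (TAlg_s B M) = alg_id1 B" "comp1 (TAlg_s B M) = alg_comp1 Lax B M"
  "id2 (TAlg_s B M) = (\<lambda>F. AlgCell F F (id2 B (und1 F)))"
  "vcomp (TAlg_s B M) = (\<lambda>\<Psi> \<Theta>. AlgCell (adm \<Theta>) (acd \<Psi>) (und2 \<Psi> \<bullet> und2 \<Theta>))"
  "hcomp (TAlg_s B M) = (\<lambda>\<Psi> \<Theta>. AlgCell (alg_comp1 Lax B M (adm \<Psi>) (adm \<Theta>))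
                 (alg_comp1 Lax B M (acd \<Psi>) (acd \<Theta>)) (und2 \<Psi> \<star> und2 \<Theta>))"
  by (auto simp: TAlg_s_def TAlg_def w_alg_cell_iff)

lemma algebra_cell_strict:
  assumes "strict_morphism B M F" "strict_morphism B M G"
  shows "algebra_cell w F G \<alpha> \<longleftrightarrow> asrc F = asrc G \<and> atgt F = atgt G \<and> \<alpha> \<in> cells B (und1 F) (und1 G)
     \<and> \<alpha> \<lhd> snd (asrc F) = snd (atgt F) \<rhd> T2 \<alpha>"
proof -
  note L = assms[unfolded strict_morphism_sel]
  have al: "algebra B M (asrc G)" "algebra B M (atgt G)" using L by auto
  note [simp] = algebra_fst_snd(1-4)[OF al(1)] algebra_fst_snd(1-4)[OF al(2)]
  show ?thesis
    unfolding algebra_cell_def using L assms[THEN strict_w_morphism, of w]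
    by (auto simp: w_compatible_def Let_def cells_def)
qed

end

text \<open>Strict algebra morphisms form a sub-2-category that is full on 2-cells, so the laws are
  inherited.\<close>
lemma two_category_full_on_2cells:
  assumes C: "two_category C" and sub: "S \<subseteq> ones C" "\<And>X. X \<in> obs C \<Longrightarrow> id1 C X \<in> S"
    "\<And>f g. \<lbrakk>f \<in> S; g \<in> S; tgt C f = src C g\<rbrakk> \<Longrightarrow> g \<cdot>\<^bsub>C\<^esub> f \<in> S"
  shows "two_category (C\<lparr>ones := S, twos := {\<alpha> \<in> twos C. dm C \<alpha> \<in> S \<and> cd C \<alpha> \<in> S}\<rparr>)" (is "two_category ?D")
proof -
  interpret two_category C by fact
  have S: "f \<in> S \<Longrightarrow> f \<in> ones C" for f using sub(1) by auto
  show ?thesis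
    by unfold_locales
      (auto simp: hom_def cells_def S sub hcomp_assoc' interchange' rwhisker_id1[unfolded rwhisker_def] lwhisker_id1[unfolded lwhisker_def])
qed

context monad_on begin

lemma two_category_TAlg_s: "two_category (TAlg_s B M)"
proof -
  have *: "TAlg_s B M = (TAlg Lax B M)\<lparr>ones := {F. strict_morphism B M F},
     twos := {\<alpha> \<in> twos (TAlg Lax B M). dm (TAlg Lax B M) \<alpha> \<in> {F. strict_morphism B M F} \<and> cd (TAlg Lax B M) \<alpha> \<in> {F. strict_morphism B M F}}\<rparr>"
    by (simp add: TAlg_s_def w_alg_cell_iff)
  show ?thesis unfolding *
    by (rule two_category_full_on_2cells[OF two_category_TAlg])
      (auto simp: strict_w_morphism strict_alg_id1 strict_alg_comp1(2))
qed

lemma TAlg_F_simps [simp]: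
  "tau (TAlg_F w B M) = TAlg_s B M" "lam (TAlg_F w B M) = TAlg w B M" "incl (TAlg_F w B M) = id_map2"
  by (simp_all add: TAlg_F_def)

lemma id_map2_simps [simp]: "on0 id_map2 = (\<lambda>X. X)" "on1 id_map2 = (\<lambda>f. f)" "on2 id_map2 = (\<lambda>f. f)"
  by (simp_all add: id_map2_def)

lemma algebra_cell_strict_change: "\<lbrakk>strict_morphism B M F; strict_morphism B M G\<rbrakk> \<Longrightarrow> algebra_cell w F G \<alpha> \<longleftrightarrow> algebra_cell Lax F G \<alpha>"
  by (simp add: algebra_cell_strict)

theorem f_category_TAlg_F: "f_category (TAlg_F w B M)"
proof -
  interpret s: two_category "TAlg_s B M" by (rule two_category_TAlg_s)
  interpret w: two_category "TAlg w B M" by (rule two_category_TAlg)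
  have comp: "alg_comp1 Lax B M G' F' = alg_comp1 w B M G' F'"
    if "algebra_cell Lax F F' \<alpha>" "algebra_cell Lax G G' \<beta>" "strict_morphism B M F'" "strict_morphism B M G'" "atgt F = asrc G" for F F' G G' \<alpha> \<beta>
    using algebra_cellD(4)[OF that(1)] algebra_cellD(3)[OF that(2)] that(3-5) by (simp add: strict_alg_comp1(1))
  have F: "two_functor (TAlg_s B M) (TAlg w B M) id_map2"
    by unfold_locales
     (auto simp: hom_def cells_def strict_w_morphism strict_alg_comp1(1) algebra_cell_strict_change[where w = w]
       intro: comp)
  show ?thesis
    by (rule f_category.intro)
      (auto simp: F hom_def cells_def bij_betw_def algebra_cell_strict_change[where w = w])
qed

lemma tight_TAlg_F [simp]: "tight (TAlg_F w B M) F \<longleftrightarrow> strict_morphism B M F"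
  by (auto simp: tight_def)

end

section \<open>The structure cell of a loose morphism\<close>
lemma chordate_simps [simp]: "lam (chordate B) = B" "tau (chordate B) = B" "incl (chordate B) = id_map2"
  "tight (chordate B) f \<longleftrightarrow> f \<in> ones B"
  by (auto simp: chordate_def tight_def id_map2_def)

text \<open>
  What monadicity of the tight part says about \<open>H\<close>, in terms of \<open>B\<close> alone: \<open>a X\<close> is an algebra
  structure on \<open>H X\<close>; tight morphisms and their 2-cells are exactly the strict algebra morphisms and
  their 2-cells, except that injectivity on 2-cells is left to local faithfulness; and each algebra
  is isomorphic to one of the form \<open>H X\<close>.
  Unlike an equivalence with a 2-category of algebras, these conditions are literally self-dual.
\<close>
locale strict_comparison = f_category A + monad_on B M
  for A :: "('a, 'm, 'c, 'n, 'd) f_cat" and B :: "('b, 'k, 'e) two_cat" (structure)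
    and M :: "('b, 'k, 'e) monad2" +
  fixes H :: "('a, 'n, 'd, 'b, 'k, 'e) map2" and a :: "'a \<Rightarrow> 'k"
  assumes H: "two_functor L B H"
    and alg: "X \<in> obs L \<Longrightarrow> algebra B M (on0 H X, a X)"
    and strict: "tight A f \<Longrightarrow> on1 H f \<cdot> a (src L f) = a (tgt L f) \<cdot> on1 (endo M) (on1 H f)"
    and strict_cell: "\<lbrakk>\<alpha> \<in> twos L; tight A (dm L \<alpha>); tight A (cd L \<alpha>)\<rbrakk>
      \<Longrightarrow> on2 H \<alpha> \<lhd> a (src L (dm L \<alpha>)) = a (tgt L (dm L \<alpha>)) \<rhd> on2 (endo M) (on2 H \<alpha>)"
    and strict_full: "\<lbrakk>X \<in> obs L; Y \<in> obs L; h \<in> hom B (on0 H X) (on0 H Y);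
        h \<cdot> a X = a Y \<cdot> on1 (endo M) h\<rbrakk> \<Longrightarrow> \<exists>f. tight A f \<and> f \<in> hom L X Y \<and> on1 H f = h"
    and strict_faithful: "\<lbrakk>tight A f; tight A g; src L f = src L g; tgt L f = tgt L g;
        on1 H f = on1 H g\<rbrakk> \<Longrightarrow> f = g"
    and strict_cell_full: "\<lbrakk>tight A f; tight A g; src L f = src L g; tgt L f = tgt L g;
        \<gamma> \<in> cells B (on1 H f) (on1 H g);
        \<gamma> \<lhd> a (src L f) = a (tgt L f) \<rhd> on2 (endo M) \<gamma>\<rbrakk>
        \<Longrightarrow> \<exists>\<delta> \<in> cells L f g. on2 H \<delta> = \<gamma>"
    and ess_surj: "algebra B M (K, k) \<Longrightarrow> \<exists>X \<in> obs L. \<exists>u \<in> hom B (on0 H X) K. \<exists>v \<in> hom B K (on0 H X).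
        v \<cdot> u = id1 B (on0 H X) \<and> u \<cdot> v = id1 B K \<and> u \<cdot> a X = k \<cdot> on1 (endo M) u"
begin

abbreviation H0 where "H0 \<equiv> on0 H"
abbreviation H1 where "H1 \<equiv> on1 H"
abbreviation H2 where "H2 \<equiv> on2 H"

sublocale H: two_functor L B H by (rule H)

lemma structure_map [simp]:
  assumes "X \<in> obs L"
  shows "a X \<in> ones B" "src B (a X) = T0 (H0 X)" "tgt B (a X) = H0 X"
  using algebraD[OF alg[OF assms]] by auto

end

text \<open>For \<open>ps = False\<close> this is the lax case and for \<open>ps = True\<close> the pseudo case.\<close>
locale doctrinal = strict_comparison A B M H a
  for A :: "('a, 'm, 'c, 'n, 'd) f_cat" and B :: "('b, 'k, 'e) two_cat" (structure)
    and M :: "('b, 'k, 'e) monad2" and H :: "('a, 'n, 'd, 'b, 'k, 'e) map2" and a :: "'a \<Rightarrow> 'k" +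
  fixes ps :: bool
  assumes chordate: "f_category (chordate B)"
    and limits: "f \<in> ones (lam A) \<Longrightarrow> \<exists>K p q l. colax_limit ps A f K p q l"
    and limits_arrows: "h \<in> ones B \<Longrightarrow> \<exists>K p q l. colax_limit ps (chordate B) h K p q l"
    and lifts: "lifts_reflections ps A (chordate B) H"
    and detects: "detects_reflection_morphisms ps A (chordate B) H"
    and loc_faithful: "locally_faithful A H"
begin

text \<open>Oriented so that algebra structures move to the left, past the images of tight morphisms.\<close>
lemma strict_slide [simp]:
  assumes "tight A f" "src L f = X"
  shows "H1 f \<cdot> a X = a (tgt L f) \<cdot> T1 (H1 f)"
    and "\<lbrakk>z \<in> ones B; tgt B z = T0 (H0 X)\<rbrakk> \<Longrightarrow> H1 f \<cdot> (a X \<cdot> z) = a (tgt L f) \<cdot> (T1 (H1 f) \<cdot> z)"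
    and "\<lbrakk>\<alpha> \<in> twos B; tgt B (dm B \<alpha>) = T0 (H0 X)\<rbrakk> \<Longrightarrow> H1 f \<rhd> (a X \<rhd> \<alpha>) = a (tgt L f) \<rhd> (T1 (H1 f) \<rhd> \<alpha>)"
proof -
  have [simp]: "f \<in> ones L" "X \<in> obs L" "src L f = X" using assms by auto
  show *: "H1 f \<cdot> a X = a (tgt L f) \<cdot> T1 (H1 f)" using strict[OF assms(1)] assms(2) by simp
  show "\<lbrakk>z \<in> ones B; tgt B z = T0 (H0 X)\<rbrakk> \<Longrightarrow> H1 f \<cdot> (a X \<cdot> z) = a (tgt L f) \<cdot> (T1 (H1 f) \<cdot> z)"
    using comp1_square(1)[OF *] by simp
  show "\<lbrakk>\<alpha> \<in> twos B; tgt B (dm B \<alpha>) = T0 (H0 X)\<rbrakk> \<Longrightarrow> H1 f \<rhd> (a X \<rhd> \<alpha>) = a (tgt L f) \<rhd> (T1 (H1 f) \<rhd> \<alpha>)"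
    using comp1_square(2)[OF *] by simp
qed

text \<open>Equations in \<open>A\<close> are used in \<open>B\<close> both as they stand and under \<open>T\<close>, alone or inside a longer
  composite.\<close>
lemma H_comp:
  assumes "g \<cdot>\<^bsub>L\<^esub> f = h" "f \<in> ones L" "g \<in> ones L" "tgt L f = src L g"
  shows "H1 g \<cdot> H1 f = H1 h" "T1 (H1 g) \<cdot> T1 (H1 f) = T1 (H1 h)"
    "\<lbrakk>z \<in> ones B; tgt B z = H0 (src L f)\<rbrakk> \<Longrightarrow> H1 g \<cdot> (H1 f \<cdot> z) = H1 h \<cdot> z"
    "\<lbrakk>\<alpha> \<in> twos B; tgt B (dm B \<alpha>) = H0 (src L f)\<rbrakk> \<Longrightarrow> H1 g \<rhd> (H1 f \<rhd> \<alpha>) = H1 h \<rhd> \<alpha>"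
    "\<lbrakk>z \<in> ones B; tgt B z = T0 (H0 (src L f))\<rbrakk> \<Longrightarrow> T1 (H1 g) \<cdot> (T1 (H1 f) \<cdot> z) = T1 (H1 h) \<cdot> z"
    "\<lbrakk>\<alpha> \<in> twos B; tgt B (dm B \<alpha>) = T0 (H0 (src L f))\<rbrakk> \<Longrightarrow> T1 (H1 g) \<rhd> (T1 (H1 f) \<rhd> \<alpha>) = T1 (H1 h) \<rhd> \<alpha>"
proof -
  note [simp] = assms(2-4)
  show 1: "H1 g \<cdot> H1 f = H1 h" using assms(1) H.on1_comp'[of f g] by simp
  show 2: "T1 (H1 g) \<cdot> T1 (H1 f) = T1 (H1 h)"
    using 1 T.on1_comp'[of "H1 f" "H1 g"] by simp
  show "\<lbrakk>z \<in> ones B; tgt B z = H0 (src L f)\<rbrakk> \<Longrightarrow> H1 g \<cdot> (H1 f \<cdot> z) = H1 h \<cdot> z"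
    "\<lbrakk>\<alpha> \<in> twos B; tgt B (dm B \<alpha>) = H0 (src L f)\<rbrakk> \<Longrightarrow> H1 g \<rhd> (H1 f \<rhd> \<alpha>) = H1 h \<rhd> \<alpha>"
    using comp1_reduce[OF 1] by simp_all
  show "\<lbrakk>z \<in> ones B; tgt B z = T0 (H0 (src L f))\<rbrakk> \<Longrightarrow> T1 (H1 g) \<cdot> (T1 (H1 f) \<cdot> z) = T1 (H1 h) \<cdot> z"
    "\<lbrakk>\<alpha> \<in> twos B; tgt B (dm B \<alpha>) = T0 (H0 (src L f))\<rbrakk> \<Longrightarrow> T1 (H1 g) \<rhd> (T1 (H1 f) \<rhd> \<alpha>) = T1 (H1 h) \<rhd> \<alpha>"
    using comp1_reduce[OF 2] by simp_all
qed

lemma H_lwhisker: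
  assumes "g \<rhd>\<^bsub>L\<^esub> \<alpha> = \<theta>" "g \<in> ones L" "\<alpha> \<in> twos L" "src L g = tgt L (dm L \<alpha>)"
  shows "H1 g \<rhd> H2 \<alpha> = H2 \<theta>" "T1 (H1 g) \<rhd> T2 (H2 \<alpha>) = T2 (H2 \<theta>)"
    "\<lbrakk>z \<in> ones B; tgt B z = H0 (src L (dm L \<alpha>))\<rbrakk> \<Longrightarrow> H1 g \<rhd> (H2 \<alpha> \<lhd> z) = H2 \<theta> \<lhd> z"
    "\<lbrakk>z \<in> ones B; tgt B z = T0 (H0 (src L (dm L \<alpha>)))\<rbrakk> \<Longrightarrow> T1 (H1 g) \<rhd> (T2 (H2 \<alpha>) \<lhd> z) = T2 (H2 \<theta>) \<lhd> z"
proof -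
  note [simp] = assms(2-4)
  show 1: "H1 g \<rhd> H2 \<alpha> = H2 \<theta>" using assms(1) H.on2_whisker(1)[of g \<alpha>] by simp
  show 2: "T1 (H1 g) \<rhd> T2 (H2 \<alpha>) = T2 (H2 \<theta>)"
    using 1 T.on2_whisker(1)[of "H1 g" "H2 \<alpha>"] by simp
  show "\<lbrakk>z \<in> ones B; tgt B z = H0 (src L (dm L \<alpha>))\<rbrakk> \<Longrightarrow> H1 g \<rhd> (H2 \<alpha> \<lhd> z) = H2 \<theta> \<lhd> z"
    using lwhisker_reduce[OF 1] by simp
  show "\<lbrakk>z \<in> ones B; tgt B z = T0 (H0 (src L (dm L \<alpha>)))\<rbrakk> \<Longrightarrow> T1 (H1 g) \<rhd> (T2 (H2 \<alpha>) \<lhd> z) = T2 (H2 \<theta>) \<lhd> z"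
    using lwhisker_reduce[OF 2] by simp
qed

lemma H_rwhisker:
  assumes "\<alpha> \<lhd>\<^bsub>L\<^esub> f = \<theta>" "f \<in> ones L" "\<alpha> \<in> twos L" "tgt L f = src L (dm L \<alpha>)"
  shows "H2 \<alpha> \<lhd> H1 f = H2 \<theta>" "T2 (H2 \<alpha>) \<lhd> T1 (H1 f) = T2 (H2 \<theta>)"
    "\<lbrakk>z \<in> ones B; tgt B z = H0 (src L f)\<rbrakk> \<Longrightarrow> H2 \<alpha> \<lhd> (H1 f \<cdot> z) = H2 \<theta> \<lhd> z"
    "\<lbrakk>z \<in> ones B; tgt B z = T0 (H0 (src L f))\<rbrakk> \<Longrightarrow> T2 (H2 \<alpha>) \<lhd> (T1 (H1 f) \<cdot> z) = T2 (H2 \<theta>) \<lhd> z"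
proof -
  note [simp] = assms(2-4)
  show 1: "H2 \<alpha> \<lhd> H1 f = H2 \<theta>" using assms(1) H.on2_whisker(2)[of f \<alpha>] by simp
  show 2: "T2 (H2 \<alpha>) \<lhd> T1 (H1 f) = T2 (H2 \<theta>)"
    using 1 T.on2_whisker(2)[of "H1 f" "H2 \<alpha>"] by simp
  show "\<lbrakk>z \<in> ones B; tgt B z = H0 (src L f)\<rbrakk> \<Longrightarrow> H2 \<alpha> \<lhd> (H1 f \<cdot> z) = H2 \<theta> \<lhd> z"
    using rwhisker_reduce[OF 1] by simp
  show "\<lbrakk>z \<in> ones B; tgt B z = T0 (H0 (src L f))\<rbrakk> \<Longrightarrow> T2 (H2 \<alpha>) \<lhd> (T1 (H1 f) \<cdot> z) = T2 (H2 \<theta>) \<lhd> z"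
    using rwhisker_reduce[OF 2] by simp
qed

text \<open>A presentation \<open>f = q \<cdot> r\<close> of a loose morphism by a tight span \<open>(p, q)\<close> whose first leg has the
  reflection \<open>p \<stileturn> r\<close>.\<close>
definition presents where
  "presents f p q r \<eta> \<longleftrightarrow> reflection ps A p r \<eta> \<and> tight A q \<and> src L q = src L p \<and> q \<cdot>\<^bsub>L\<^esub> r = f"

text \<open>The lax structure that doctrinal adjunction puts on \<open>H (q \<cdot> r)\<close>.\<close>
definition span_cell where
  "span_cell p q r \<eta> = H2 (q \<rhd>\<^bsub>L\<^esub> \<eta>) \<lhd> (a (src L p) \<cdot> T1 (H1 r))"

text \<open>The choice is immaterial by \<open>str_cell_eq_span_cell\<close> below.\<close>
definition str_cell where
  "str_cell f = (SOME s. \<exists>p q r \<eta>. presents f p q r \<eta> \<and> s = span_cell p q r \<eta>)"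

lemma reflectionD:
  assumes "reflection ps A p r \<eta>"
  shows "tight A p" "r \<in> ones L" "src L r = tgt L p" "tgt L r = src L p" "\<eta> \<in> twos L"
    "dm L \<eta> = id1 L (src L p)" "cd L \<eta> = r \<cdot>\<^bsub>L\<^esub> p" "p \<cdot>\<^bsub>L\<^esub> r = id1 L (tgt L p)"
    "p \<rhd>\<^bsub>L\<^esub> \<eta> = id2 L p" "\<eta> \<lhd>\<^bsub>L\<^esub> r = id2 L r"
  using assms by (auto simp: reflection_iff)

lemma presentsD:
  assumes "presents f p q r \<eta>"
  shows "tight A p" "r \<in> ones L" "src L r = src L f" "tgt L r = src L p" "\<eta> \<in> twos L"
    "dm L \<eta> = id1 L (src L p)" "cd L \<eta> = r \<cdot>\<^bsub>L\<^esub> p" "p \<cdot>\<^bsub>L\<^esub> r = id1 L (src L f)"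
    "p \<rhd>\<^bsub>L\<^esub> \<eta> = id2 L p" "\<eta> \<lhd>\<^bsub>L\<^esub> r = id2 L r"
    "tight A q" "src L q = src L p" "q \<cdot>\<^bsub>L\<^esub> r = f" "tgt L p = src L f" "tgt L q = tgt L f"
    "f \<in> ones L"
  using assms by (auto simp: presents_def reflection_iff)

lemma presents_reflection: "presents f p q r \<eta> \<Longrightarrow> reflection ps A p r \<eta>"
  by (simp add: presents_def)

lemma reflection_invertible: "reflection ps A p r \<eta> \<Longrightarrow> ps \<Longrightarrow> invertible L \<eta>"
  by (simp add: reflection_def)

text \<open>The cell \<open>q \<rhd> \<eta>\<close> behaves like the universal cone of a limit; naming it keeps the simplifier from
  taking it apart.\<close>
lemma presents_cell:
  assumes "presents f p q r \<eta>" "l = q \<rhd>\<^bsub>L\<^esub> \<eta>"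
  shows "l \<in> twos L" "dm L l = q" "cd L l = f \<cdot>\<^bsub>L\<^esub> p" "q \<rhd>\<^bsub>L\<^esub> \<eta> = l" "l \<lhd>\<^bsub>L\<^esub> r = id2 L f"
    "ps \<Longrightarrow> invertible L l" "span_cell p q r \<eta> = H2 l \<lhd> (a (src L p) \<cdot> T1 (H1 r))"
proof -
  note [simp] = presentsD[OF assms(1)] and [simp] = incl.T.comp1_reduce(1)[OF presentsD(13)[OF assms(1)]]
  show "l \<in> twos L" "dm L l = q" "cd L l = f \<cdot>\<^bsub>L\<^esub> p" "q \<rhd>\<^bsub>L\<^esub> \<eta> = l" "l \<lhd>\<^bsub>L\<^esub> r = id2 L f"
    by (simp_all add: assms(2))
  show "invertible L l" if ps
    using incl.T.invertible_lwhisker[of \<eta> q] reflection_invertible[OF presents_reflection[OF assms(1)] that]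
    by (simp add: assms(2))
  show "span_cell p q r \<eta> = H2 l \<lhd> (a (src L p) \<cdot> T1 (H1 r))" by (simp only: span_cell_def assms(2))
qed

lemma limit_presents:
  assumes "f \<in> ones L"
  obtains p q r \<eta> where "presents f p q r \<eta>" "colax_limit ps A f (src L p) p q (q \<rhd>\<^bsub>L\<^esub> \<eta>)"
proof -
  obtain K p q l where lim: "colax_limit ps A f K p q l" using limits[OF assms] by blast
  note D = colax_limitD[OF lim assms]
  obtain r \<eta> where "reflection ps A p r \<eta>" "q \<cdot>\<^bsub>L\<^esub> r = f" "q \<rhd>\<^bsub>L\<^esub> \<eta> = l"
    using limit_reflection[OF lim assms] by blast
  thus ?thesis using that[of p q r \<eta>] D lim by (simp add: presents_def)
qed

lemma presentation_exists:
  assumes "f \<in> ones L"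
  shows "\<exists>p q r \<eta>. presents f p q r \<eta>"
  by (rule limit_presents[OF assms]) (intro exI)

text \<open>
  The presentation is in particular a cone, so it induces \<open>t\<close> into the limit of \<open>f\<close>.  Since \<open>p\<close> and
  \<open>q\<close> are tight, so is \<open>t\<close>, and it carries \<open>r\<close> to the right adjoint \<open>r0\<close> of the limit.  Sliding the
  algebra structure along \<open>t\<close> identifies the two cells.
\<close>
lemma str_cell_eq_span_cell:
  assumes "presents f p q r \<eta>"
  shows "str_cell f = span_cell p q r \<eta>"
proof -
  have f: "f \<in> ones L" using presentsD[OF assms] by simp
  obtain p0 q0 r0 \<eta>0 where rep0: "presents f p0 q0 r0 \<eta>0"
    and lim: "colax_limit ps A f (src L p0) p0 q0 (q0 \<rhd>\<^bsub>L\<^esub> \<eta>0)" using limit_presents[OF f] .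
  define l0 where "l0 = q0 \<rhd>\<^bsub>L\<^esub> \<eta>0"
  note D0 = presentsD[OF rep0] presents_cell(1-3,5)[OF rep0 l0_def]
  note lim = lim[folded l0_def]
  have *: "span_cell p q r \<eta> = span_cell p0 q0 r0 \<eta>0" if presents: "presents f p q r \<eta>" for p q r \<eta>
  proof -
    define l where "l = q \<rhd>\<^bsub>L\<^esub> \<eta>"
    note D = presentsD[OF presents] presents_cell(1-3,5)[OF presents l_def]
    note [simp] = D D0
    obtain t where t [simp]: "t \<in> ones L" "src L t = src L p" "tgt L t = src L p0"
      "p0 \<cdot>\<^bsub>L\<^esub> t = p" "q0 \<cdot>\<^bsub>L\<^esub> t = q" "l0 \<lhd>\<^bsub>L\<^esub> t = l"
      using colax_limit_exists[OF lim f, of p l] presents_cell(6)[OF presents l_def] by auto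
    have [simp]: "tight A t" using colax_limit_tight[OF lim f, of t] by simp
    have tr [simp]: "t \<cdot>\<^bsub>L\<^esub> r = r0"
      by (rule colax_limit_eq[OF lim f])
        (simp_all add: incl.T.comp1_reduce(1)[OF t(4)] incl.T.rwhisker_reduce[OF t(6)])
    have "H2 l \<lhd> (a (src L p) \<cdot> T1 (H1 r)) = (H2 l0 \<lhd> H1 t) \<lhd> (a (src L p) \<cdot> T1 (H1 r))"
      using H_rwhisker(1)[OF t(6)] by simp
    also have "\<dots> = H2 l0 \<lhd> (a (src L p0) \<cdot> T1 (H1 r0))"
      by (simp add: H_comp(2)[OF tr])
    finally show ?thesis unfolding presents_cell(7)[OF presents l_def] presents_cell(7)[OF rep0 l0_def] .
  qed
  have "\<exists>p q r \<eta>. presents f p q r \<eta> \<and> str_cell f = span_cell p q r \<eta>"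
    unfolding str_cell_def by (rule someI_ex) (use rep0 in blast)
  thus ?thesis using * assms by metis
qed

text \<open>The second claim expresses the cone through the structure cell, so that conditions on
  structure cells can be tested on cones.\<close>
lemma presents_str_cell:
  assumes "presents f p q r \<eta>" "l = q \<rhd>\<^bsub>L\<^esub> \<eta>"
  shows "lax_morphism B M (AlgMor (H0 (src L f), a (src L f)) (H0 (tgt L f), a (tgt L f)) (H1 f) (str_cell f))"
    and "H2 l \<lhd> a (src L p) = (str_cell f \<lhd> T1 (H1 p)) \<bullet> (a (tgt L f) \<rhd> T2 (H2 l))"
    and "ps \<Longrightarrow> invertible B (str_cell f)"
proof -
  note [simp] = presentsD[OF assms(1)]
  have str_cell: "str_cell f = (H1 q \<rhd> H2 \<eta>) \<lhd> (a (src L p) \<cdot> T1 (H1 r))"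
    unfolding str_cell_eq_span_cell[OF assms(1)] span_cell_def by simp
  note [simp] = presents_cell(1-5)[OF assms]
  have *: "H1 q \<rhd> H2 \<eta> = H2 l" using H_lwhisker(1)[OF presents_cell(4)[OF assms]] by simp
  note R = right_adjoint_lax[OF alg alg alg, of "src L p" "src L f" "tgt L f" "H1 p" "H1 q" "H1 r" "H2 \<eta>"]
  have "lax_morphism B M (AlgMor (H0 (src L f), a (src L f)) (H0 (tgt L f), a (tgt L f)) (H1 q \<cdot> H1 r)
     ((H1 q \<rhd> H2 \<eta>) \<lhd> (a (src L p) \<cdot> T1 (H1 r))))"
    by (rule R(1)) (simp_all add: H_comp[OF presentsD(8)[OF assms(1)]] H_lwhisker[OF presentsD(9)[OF assms(1)]] H_rwhisker[OF presentsD(10)[OF assms(1)]])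
  thus "lax_morphism B M (AlgMor (H0 (src L f), a (src L f)) (H0 (tgt L f), a (tgt L f)) (H1 f) (str_cell f))"
    by (simp only: str_cell[symmetric]) (simp add: H_comp[OF presentsD(13)[OF assms(1)]])
  have "(H1 q \<rhd> H2 \<eta>) \<lhd> a (src L p) = (((H1 q \<rhd> H2 \<eta>) \<lhd> (a (src L p) \<cdot> T1 (H1 r))) \<lhd> T1 (H1 p)) \<bullet> (a (tgt L f) \<rhd> T2 (H1 q \<rhd> H2 \<eta>))"
    by (rule R(2)) (simp_all add: H_comp[OF presentsD(8)[OF assms(1)]] H_lwhisker[OF presentsD(9)[OF assms(1)]] H_rwhisker[OF presentsD(10)[OF assms(1)]])
  thus "H2 l \<lhd> a (src L p) = (str_cell f \<lhd> T1 (H1 p)) \<bullet> (a (tgt L f) \<rhd> T2 (H2 l))"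
    unfolding str_cell * .
  show "invertible B (str_cell f)" if ps
    unfolding str_cell_eq_span_cell[OF assms(1)] presents_cell(7)[OF assms]
    by (rule invertible_rwhisker) (use that presents_cell(6)[OF assms] H.on2_invertible[of l] in auto)
qed

lemma str_cell_two [simp]:
  assumes "f \<in> ones L"
  shows "str_cell f \<in> twos B" "dm B (str_cell f) = a (tgt L f) \<cdot> T1 (H1 f)" "cd B (str_cell f) = H1 f \<cdot> a (src L f)"
proof -
  obtain p q r \<eta> where presents: "presents f p q r \<eta>" using presentation_exists[OF assms] by auto
  show "str_cell f \<in> twos B" "dm B (str_cell f) = a (tgt L f) \<cdot> T1 (H1 f)" "cd B (str_cell f) = H1 f \<cdot> a (src L f)"
    using presents_str_cell(1)[OF presents refl] unfolding lax_morphism_iff by auto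
qed

lemma str_cell_tight:
  assumes "tight A f" shows "str_cell f = id2 B (H1 f \<cdot> a (src L f))"
proof -
  have [simp]: "f \<in> ones L" "tight A f" using assms by auto
  have presents: "presents f (id1 L (src L f)) f (id1 L (src L f)) (id2 L (id1 L (src L f)))"
    by (simp add: presents_def reflection_iff)
  show ?thesis unfolding str_cell_eq_span_cell[OF presents] span_cell_def by simp
qed

text \<open>The limit cone of \<open>g \<cdot> q\<close>, with its first leg prolonged by \<open>q\<close>, is a cone for \<open>g\<close>; the induced
  tight arrow plays the same part as in \<open>str_cell_eq_span_cell\<close>.\<close>
lemma str_cell_comp_tight:
  assumes "tight A q" "g \<in> ones L" "tgt L q = src L g"
  shows "str_cell (g \<cdot>\<^bsub>L\<^esub> q) = str_cell g \<lhd> T1 (H1 q)"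
proof -
  obtain p0 q0 r0 \<eta>0 where rep0: "presents g p0 q0 r0 \<eta>0"
    and lim: "colax_limit ps A g (src L p0) p0 q0 (q0 \<rhd>\<^bsub>L\<^esub> \<eta>0)" using limit_presents[OF assms(2)] .
  define l0 where "l0 = q0 \<rhd>\<^bsub>L\<^esub> \<eta>0"
  note lim = lim[folded l0_def]
  have gq: "g \<cdot>\<^bsub>L\<^esub> q \<in> ones L" using assms by simp
  obtain p1 q1 r1 \<eta>1 where rep1: "presents (g \<cdot>\<^bsub>L\<^esub> q) p1 q1 r1 \<eta>1" using presentation_exists[OF gq] by auto
  define l1 where "l1 = q1 \<rhd>\<^bsub>L\<^esub> \<eta>1"
  note [simp] = assms presentsD[OF rep0] presents_cell(1-3,5)[OF rep0 l0_def] presentsD[OF rep1] presents_cell(1-3,5)[OF rep1 l1_def]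
  obtain t where t [simp]: "t \<in> ones L" "src L t = src L p1" "tgt L t = src L p0"
    "p0 \<cdot>\<^bsub>L\<^esub> t = q \<cdot>\<^bsub>L\<^esub> p1" "q0 \<cdot>\<^bsub>L\<^esub> t = q1" "l0 \<lhd>\<^bsub>L\<^esub> t = l1"
    using colax_limit_exists[OF lim assms(2), of "q \<cdot>\<^bsub>L\<^esub> p1" l1] presents_cell(6)[OF rep1 l1_def] by auto
  have [simp]: "tight A t" using colax_limit_tight[OF lim assms(2), of t] by simp
  have tr [simp]: "t \<cdot>\<^bsub>L\<^esub> r1 = r0 \<cdot>\<^bsub>L\<^esub> q"
    by (rule colax_limit_eq[OF lim assms(2)])
      (simp_all add: incl.T.comp1_reduce(1)[OF t(4)] incl.T.rwhisker_reduce[OF t(6)]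
        incl.T.comp1_reduce(1)[OF presentsD(8)[OF rep0]] incl.T.rwhisker_reduce[OF presents_cell(5)[OF rep0 l0_def]])
  have "str_cell (g \<cdot>\<^bsub>L\<^esub> q) = (H2 l0 \<lhd> H1 t) \<lhd> (a (src L p1) \<cdot> T1 (H1 r1))"
    unfolding str_cell_eq_span_cell[OF rep1] presents_cell(7)[OF rep1 l1_def] using H_rwhisker(1)[OF t(6)] by simp
  also have "\<dots> = H2 l0 \<lhd> (a (src L p0) \<cdot> (T1 (H1 r0) \<cdot> T1 (H1 q)))"
    by (simp add: H_comp(2)[OF tr])
  also have "\<dots> = str_cell g \<lhd> T1 (H1 q)"
    unfolding str_cell_eq_span_cell[OF rep0] presents_cell(7)[OF rep0 l0_def] by simp
  finally show ?thesis .
qed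

text \<open>Reflections compose, whereas the composite span need not be a limit of \<open>h \<cdot> r\<close>; hence
  presentations by arbitrary reflections.\<close>
lemma presents_comp_reflection:
  assumes h: "presents h p2 q2 r2 \<eta>2" and R: "reflection ps A p r \<eta>" and "src L h = src L p"
  shows "presents (h \<cdot>\<^bsub>L\<^esub> r) (p \<cdot>\<^bsub>L\<^esub> p2) q2 (r2 \<cdot>\<^bsub>L\<^esub> r) ((r2 \<rhd>\<^bsub>L\<^esub> (\<eta> \<lhd>\<^bsub>L\<^esub> p2)) \<bullet>\<^bsub>L\<^esub> \<eta>2)"
proof -
  note [simp] = assms(3) presentsD[OF h] reflectionD[OF R]
    incl.T.comp1_reduce[OF presentsD(8)[OF h]] incl.T.comp1_reduce[OF presentsD(13)[OF h]]
    incl.T.comp1_reduce[OF reflectionD(8)[OF R]] incl.T.lwhisker_reduce[OF reflectionD(9)[OF R]]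
    incl.T.rwhisker_reduce[OF presentsD(10)[OF h]]
  have "invertible L ((r2 \<rhd>\<^bsub>L\<^esub> (\<eta> \<lhd>\<^bsub>L\<^esub> p2)) \<bullet>\<^bsub>L\<^esub> \<eta>2)" if ps
  proof -
    have "invertible L (r2 \<rhd>\<^bsub>L\<^esub> (\<eta> \<lhd>\<^bsub>L\<^esub> p2))"
      by (intro incl.T.invertible_lwhisker incl.T.invertible_rwhisker reflection_invertible[OF R that]) simp_all
    thus ?thesis
      by (rule incl.T.invertible_vcomp[OF reflection_invertible[OF presents_reflection[OF h] that]]) simp
  qed
  thus ?thesis by (auto simp: presents_def reflection_iff)
qed

lemma str_cell_comp_reflection:
  assumes R: "reflection ps A p r \<eta>" and h: "h \<in> ones L" "src L h = src L p"
  shows "str_cell (h \<cdot>\<^bsub>L\<^esub> r) = (H1 h \<rhd> (H2 \<eta> \<lhd> (a (src L p) \<cdot> T1 (H1 r)))) \<bullet> (str_cell h \<lhd> T1 (H1 r))"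
proof -
  obtain p2 q2 r2 \<eta>2 where presents: "presents h p2 q2 r2 \<eta>2" using presentation_exists[OF h(1)] by auto
  define l2 where "l2 = q2 \<rhd>\<^bsub>L\<^esub> \<eta>2"
  note C = presents_comp_reflection[OF presents R h(2)]
  note [simp] = h presentsD[OF presents] reflectionD[OF R] presents_cell(1-5)[OF presents l2_def]
    H_comp[OF presentsD(13)[OF presents]] H_comp[OF presentsD(8)[OF presents]] H_lwhisker[OF presents_cell(4)[OF presents l2_def]]
    incl.T.comp1_reduce[OF presentsD(13)[OF presents]]
  have "str_cell (h \<cdot>\<^bsub>L\<^esub> r) = H2 (q2 \<rhd>\<^bsub>L\<^esub> ((r2 \<rhd>\<^bsub>L\<^esub> (\<eta> \<lhd>\<^bsub>L\<^esub> p2)) \<bullet>\<^bsub>L\<^esub> \<eta>2)) \<lhd> (a (src L p2) \<cdot> T1 (H1 (r2 \<cdot>\<^bsub>L\<^esub> r)))"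
    unfolding str_cell_eq_span_cell[OF C] span_cell_def by simp
  also have "\<dots> = (H1 h \<rhd> (H2 \<eta> \<lhd> (a (src L p) \<cdot> T1 (H1 r)))) \<bullet> (str_cell h \<lhd> T1 (H1 r))"
    unfolding str_cell_eq_span_cell[OF presents] presents_cell(7)[OF presents l2_def]
    by simp
  finally show ?thesis .
qed

text \<open>With \<open>f = q \<cdot> r\<close>, bracket \<open>g \<cdot> f\<close> as \<open>(g \<cdot> q) \<cdot> r\<close>: the inner composite has a tight right factor,
  and the outer one composes with the right adjoint of a reflection.\<close>
theorem str_cell_comp:
  assumes "f \<in> ones L" "g \<in> ones L" "tgt L f = src L g"
  shows "str_cell (g \<cdot>\<^bsub>L\<^esub> f) = (H1 g \<rhd> str_cell f) \<bullet> (str_cell g \<lhd> T1 (H1 f))"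
proof -
  obtain p q r \<eta> where presents: "presents f p q r \<eta>" using presentation_exists[OF assms(1)] by auto
  define l where "l = q \<rhd>\<^bsub>L\<^esub> \<eta>"
  note [simp] = assms presentsD[OF presents] presents_cell(1-5)[OF presents l_def]
    H_comp[OF presentsD(13)[OF presents]] H_comp[OF presentsD(8)[OF presents]] H_lwhisker[OF presents_cell(4)[OF presents l_def]]
  have R: "reflection ps A p r \<eta>" using presents by (simp add: presents_def)
  have "str_cell (g \<cdot>\<^bsub>L\<^esub> f) = str_cell ((g \<cdot>\<^bsub>L\<^esub> q) \<cdot>\<^bsub>L\<^esub> r)" by simp
  also have "\<dots> = (H1 g \<rhd> (H2 l \<lhd> (a (src L p) \<cdot> T1 (H1 r)))) \<bullet> (str_cell g \<lhd> T1 (H1 f))"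
    by (subst str_cell_comp_reflection[OF R]) (simp_all add: str_cell_comp_tight)
  finally show ?thesis unfolding str_cell_eq_span_cell[OF presents] presents_cell(7)[OF presents l_def] .
qed

end

section \<open>Compatibility with 2-cells and uniqueness\<close>
context doctrinal begin

text \<open>
  Present the loose comparison \<open>rg \<cdot> pf\<close> between the apexes of presentations of \<open>f\<close> and \<open>g\<close> by a
  span with legs \<open>d\<close>, \<open>e\<close>.  The reflection of \<open>pf \<cdot> d\<close> then serves \<open>f\<close> through \<open>d\<close> and \<open>g\<close> through \<open>e\<close>.
\<close>
lemma common_presentation:
  assumes "f \<in> ones L" "g \<in> ones L" "src L f = src L g" "tgt L f = tgt L g"
  shows "\<exists>p q1 q2 r \<eta>. presents f p q1 r \<eta> \<and> presents g p q2 r \<eta>"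
proof -
  obtain pf qf rf \<eta>f where f: "presents f pf qf rf \<eta>f" using presentation_exists[OF assms(1)] by auto
  obtain pg qg rg \<eta>g where g: "presents g pg qg rg \<eta>g" using presentation_exists[OF assms(2)] by auto
  note [simp] = assms presentsD[OF f] presentsD[OF g]
  have h: "rg \<cdot>\<^bsub>L\<^esub> pf \<in> ones L" by simp
  obtain d e rd \<eta>d where h: "presents (rg \<cdot>\<^bsub>L\<^esub> pf) d e rd \<eta>d" using presentation_exists[OF h] by auto
  note [simp] = presentsD[OF h]
    incl.T.comp1_reduce[OF presentsD(8)[OF h]] incl.T.comp1_reduce[OF presentsD(13)[OF h]]
    incl.T.comp1_reduce[OF presentsD(13)[OF g]]
  have R: "reflection ps A (pf \<cdot>\<^bsub>L\<^esub> d) (rd \<cdot>\<^bsub>L\<^esub> rf) ((rd \<rhd>\<^bsub>L\<^esub> (\<eta>f \<lhd>\<^bsub>L\<^esub> d)) \<bullet>\<^bsub>L\<^esub> \<eta>d)"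
    using presents_reflection[OF presents_comp_reflection[OF h presents_reflection[OF f]]] by simp
  have "presents f (pf \<cdot>\<^bsub>L\<^esub> d) (qf \<cdot>\<^bsub>L\<^esub> d) (rd \<cdot>\<^bsub>L\<^esub> rf) ((rd \<rhd>\<^bsub>L\<^esub> (\<eta>f \<lhd>\<^bsub>L\<^esub> d)) \<bullet>\<^bsub>L\<^esub> \<eta>d)"
    using R by (simp add: presents_def)
  moreover have "presents g (pf \<cdot>\<^bsub>L\<^esub> d) (qg \<cdot>\<^bsub>L\<^esub> e) (rd \<cdot>\<^bsub>L\<^esub> rf) ((rd \<rhd>\<^bsub>L\<^esub> (\<eta>f \<lhd>\<^bsub>L\<^esub> d)) \<bullet>\<^bsub>L\<^esub> \<eta>d)"
    using R by (simp add: presents_def)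
  ultimately show ?thesis by blast
qed

text \<open>
  Pasting \<open>\<alpha>\<close> onto the cone of \<open>f\<close> gives a cone for \<open>g\<close>, hence a tight \<open>t\<close> between the apexes, and
  \<open>m : t \<cdot> r \<Rightarrow> r0\<close> is the mate of the equation \<open>p0 \<cdot> t = p\<close>.  As \<open>p0 \<rhd> m\<close> is an identity and
  \<open>q0 \<rhd> m = \<alpha>\<close>, exchanging \<open>m\<close> with the cone of \<open>g\<close> is the claim.
\<close>
lemma str_cell_natural_lax:
  assumes "\<not> ps" "\<alpha> \<in> twos L" "dm L \<alpha> = f" "cd L \<alpha> = g"
  shows "(H2 \<alpha> \<lhd> a (src L f)) \<bullet> str_cell f = str_cell g \<bullet> (a (tgt L f) \<rhd> T2 (H2 \<alpha>))"
proof -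
  have fg: "f \<in> ones L" "g \<in> ones L" "src L g = src L f" "tgt L g = tgt L f"
    using assms(2-4) by auto
  obtain p q r \<eta> where f: "presents f p q r \<eta>" using presentation_exists[OF fg(1)] by auto
  obtain p0 q0 r0 \<eta>0 where g: "presents g p0 q0 r0 \<eta>0"
    and lim: "colax_limit ps A g (src L p0) p0 q0 (q0 \<rhd>\<^bsub>L\<^esub> \<eta>0)" using limit_presents[OF fg(2)] .
  define l where "l = q \<rhd>\<^bsub>L\<^esub> \<eta>"
  define l0 where "l0 = q0 \<rhd>\<^bsub>L\<^esub> \<eta>0"
  note lim = lim[folded l0_def]
  note [simp] = assms(2-4) fg presentsD[OF f] presents_cell(1-5)[OF f l_def] presentsD[OF g] presents_cell(1-5)[OF g l0_def]
  obtain t where t [simp]: "t \<in> ones L" "src L t = src L p" "tgt L t = src L p0"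
      "p0 \<cdot>\<^bsub>L\<^esub> t = p" "q0 \<cdot>\<^bsub>L\<^esub> t = q" "l0 \<lhd>\<^bsub>L\<^esub> t = (\<alpha> \<lhd>\<^bsub>L\<^esub> p) \<bullet>\<^bsub>L\<^esub> l"
    using colax_limit_exists[OF lim fg(2), of p "(\<alpha> \<lhd>\<^bsub>L\<^esub> p) \<bullet>\<^bsub>L\<^esub> l"] assms(1) by auto
  have [simp]: "tight A t" using colax_limit_tight[OF lim fg(2), of t] by simp
  define m where "m = \<eta>0 \<lhd>\<^bsub>L\<^esub> (t \<cdot>\<^bsub>L\<^esub> r)"
  note [simp] = incl.T.comp1_reduce[OF t(4)] incl.T.rwhisker_reduce[OF t(6)] incl.T.comp1_reduce[OF t(5)]
    incl.T.lwhisker_reduce[OF presents_cell(4)[OF g l0_def]] incl.T.lwhisker_reduce[OF presentsD(9)[OF g]]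
  have m [simp]: "m \<in> twos L" "dm L m = t \<cdot>\<^bsub>L\<^esub> r" "cd L m = r0"
    and p0m: "p0 \<rhd>\<^bsub>L\<^esub> m = id2 L (id1 L (src L f))" and q0m: "q0 \<rhd>\<^bsub>L\<^esub> m = \<alpha>"
    by (simp_all add: m_def)
  note [simp] = H_comp[OF presentsD(8)[OF f]] H_lwhisker[OF p0m] H_lwhisker[OF q0m]
  have "(H2 \<alpha> \<lhd> a (src L f)) \<bullet> str_cell f = H2 ((\<alpha> \<lhd>\<^bsub>L\<^esub> p) \<bullet>\<^bsub>L\<^esub> l) \<lhd> (a (src L p) \<cdot> T1 (H1 r))"
    unfolding str_cell_eq_span_cell[OF f] presents_cell(7)[OF f l_def] by simp
  also have "\<dots> = H2 l0 \<lhd> (H1 t \<cdot> (a (src L p) \<cdot> T1 (H1 r)))"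
    by (subst H_rwhisker(3)[OF t(6)]) simp_all
  also have "\<dots> = H2 l0 \<lhd> (a (src L p0) \<cdot> (T1 (H1 t) \<cdot> T1 (H1 r)))" by simp
  also have "\<dots> = str_cell g \<bullet> (H1 q0 \<rhd> (a (src L p0) \<rhd> T2 (H2 m)))"
    using whisker_exchange[of "a (src L p0) \<rhd> T2 (H2 m)" "H2 l0"]
    unfolding str_cell_eq_span_cell[OF g] presents_cell(7)[OF g l0_def] by (simp add: H_comp[OF t(4)])
  also have "\<dots> = str_cell g \<bullet> (a (tgt L f) \<rhd> T2 (H2 \<alpha>))" by simp
  finally show ?thesis .
qed

text \<open>
  Over a common reflection with invertible cones \<open>l\<close> and \<open>l0\<close>, the 2-cell \<open>\<alpha>\<close> is \<open>\<beta> \<lhd> r\<close> for the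
  2-cell \<open>\<beta> = l0\<^sup>-\<^sup>1 \<bullet> (\<alpha> \<lhd> p) \<bullet> l\<close> between tight morphisms, which is compatible with the algebra
  structures by monadicity.
\<close>
lemma str_cell_natural_pseudo:
  assumes "ps" "\<alpha> \<in> twos L" "dm L \<alpha> = f" "cd L \<alpha> = g"
  shows "(H2 \<alpha> \<lhd> a (src L f)) \<bullet> str_cell f = str_cell g \<bullet> (a (tgt L f) \<rhd> T2 (H2 \<alpha>))"
proof -
  have fg: "f \<in> ones L" "g \<in> ones L" "src L g = src L f" "tgt L g = tgt L f"
    using assms(2-4) by auto
  obtain p q q0 r \<eta> where f: "presents f p q r \<eta>" and g: "presents g p q0 r \<eta>"
    using common_presentation[of f g] fg by auto
  define l where "l = q \<rhd>\<^bsub>L\<^esub> \<eta>"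
  define l0 where "l0 = q0 \<rhd>\<^bsub>L\<^esub> \<eta>"
  note [simp] = assms(2-4) fg presentsD[OF f] presents_cell(1-5)[OF f l_def] presentsD[OF g] presents_cell(1-5)[OF g l0_def]
  obtain m where m [simp]: "m \<in> twos L" "dm L m = g \<cdot>\<^bsub>L\<^esub> p" "cd L m = q0"
    and ml: "m \<bullet>\<^bsub>L\<^esub> l0 = id2 L q0" "l0 \<bullet>\<^bsub>L\<^esub> m = id2 L (g \<cdot>\<^bsub>L\<^esub> p)"
    using presents_cell(6)[OF g l0_def assms(1)] by (rule incl.T.invertibleE) auto
  \<comment> \<open>The tight 2-cell of which \<open>\<alpha>\<close> is the whiskering by \<open>r\<close>.\<close>
  define \<beta> where "\<beta> = m \<bullet>\<^bsub>L\<^esub> ((\<alpha> \<lhd>\<^bsub>L\<^esub> p) \<bullet>\<^bsub>L\<^esub> l)"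
  have [simp]: "\<beta> \<in> twos L" "dm L \<beta> = q" "cd L \<beta> = q0" by (simp_all add: \<beta>_def)
  have "l0 \<bullet>\<^bsub>L\<^esub> \<beta> = (l0 \<bullet>\<^bsub>L\<^esub> m) \<bullet>\<^bsub>L\<^esub> ((\<alpha> \<lhd>\<^bsub>L\<^esub> p) \<bullet>\<^bsub>L\<^esub> l)"
    by (simp add: \<beta>_def)
  also have "\<dots> = (\<alpha> \<lhd>\<^bsub>L\<^esub> p) \<bullet>\<^bsub>L\<^esub> l" unfolding ml by simp
  finally have l\<beta>: "l0 \<bullet>\<^bsub>L\<^esub> \<beta> = (\<alpha> \<lhd>\<^bsub>L\<^esub> p) \<bullet>\<^bsub>L\<^esub> l" .
  have \<beta>r: "\<beta> \<lhd>\<^bsub>L\<^esub> r = \<alpha>" using arg_cong[OF l\<beta>, of "\<lambda>u. u \<lhd>\<^bsub>L\<^esub> r"] by simp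
  have \<beta>c: "H2 \<beta> \<lhd> a (src L p) = a (tgt L f) \<rhd> T2 (H2 \<beta>)" using strict_cell[of \<beta>] by simp
  note [simp] = H_comp[OF presentsD(8)[OF f]] H_rwhisker[OF \<beta>r] rwhisker_reduce[OF \<beta>c]
  have "(H2 \<alpha> \<lhd> a (src L f)) \<bullet> str_cell f = H2 ((\<alpha> \<lhd>\<^bsub>L\<^esub> p) \<bullet>\<^bsub>L\<^esub> l) \<lhd> (a (src L p) \<cdot> T1 (H1 r))"
    unfolding str_cell_eq_span_cell[OF f] presents_cell(7)[OF f l_def] by simp
  also have "\<dots> = str_cell g \<bullet> (a (tgt L f) \<rhd> T2 (H2 \<alpha>))"
    unfolding str_cell_eq_span_cell[OF g] presents_cell(7)[OF g l0_def] l\<beta>[symmetric] by simp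
  finally show ?thesis .
qed

theorem str_cell_natural:
  assumes "\<alpha> \<in> twos L" "dm L \<alpha> = f" "cd L \<alpha> = g"
  shows "(H2 \<alpha> \<lhd> a (src L f)) \<bullet> str_cell f = str_cell g \<bullet> (a (tgt L f) \<rhd> T2 (H2 \<alpha>))"
  using str_cell_natural_lax str_cell_natural_pseudo assms by blast

text \<open>
  Compatibility with the unit \<open>\<eta> : 1 \<Rightarrow> r \<cdot> p\<close> reads \<open>H \<eta> \<lhd> a = (s r \<lhd> T H p) \<bullet> (a \<rhd> T H \<eta>)\<close>, and
  whiskering with \<open>T H r\<close> turns the last factor into an identity.
\<close>
theorem str_cell_unique:
  assumes ty: "\<And>f. f \<in> ones L \<Longrightarrow> s f \<in> cells B (a (tgt L f) \<cdot> T1 (H1 f)) (H1 f \<cdot> a (src L f))"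
    and tight: "\<And>f. tight A f \<Longrightarrow> s f = id2 B (H1 f \<cdot> a (src L f))"
    and comp: "\<And>f g. \<lbrakk>f \<in> ones L; g \<in> ones L; tgt L f = src L g\<rbrakk>
        \<Longrightarrow> s (g \<cdot>\<^bsub>L\<^esub> f) = (H1 g \<rhd> s f) \<bullet> (s g \<lhd> T1 (H1 f))"
    and nat: "\<And>\<alpha>. \<alpha> \<in> twos L \<Longrightarrow> (H2 \<alpha> \<lhd> a (src L (dm L \<alpha>))) \<bullet> s (dm L \<alpha>)
        = s (cd L \<alpha>) \<bullet> (a (tgt L (dm L \<alpha>)) \<rhd> T2 (H2 \<alpha>))"
    and f: "f \<in> ones L"
  shows "s f = str_cell f"
proof -
  obtain p q r \<eta> where presents: "presents f p q r \<eta>" using presentation_exists[OF f] by auto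
  define l where "l = q \<rhd>\<^bsub>L\<^esub> \<eta>"
  have [simp]: "s f \<in> twos B" "dm B (s f) = a (tgt L f) \<cdot> T1 (H1 f)" "cd B (s f) = H1 f \<cdot> a (src L f)"
    if "f \<in> ones L" for f using ty[OF that] by (auto simp: cells_def)
  note [simp] = f presentsD[OF presents] presents_cell(1-5)[OF presents l_def] H_comp[OF presentsD(8)[OF presents]]
    H_rwhisker[OF presentsD(10)[OF presents]] H_lwhisker[OF presents_cell(4)[OF presents l_def]]
  have "H2 \<eta> \<lhd> a (src L p) = s (r \<cdot>\<^bsub>L\<^esub> p) \<bullet> (a (src L p) \<rhd> T2 (H2 \<eta>))"
    using nat[of \<eta>] tight[of "id1 L (src L p)"] by simp
  also have "s (r \<cdot>\<^bsub>L\<^esub> p) = s r \<lhd> T1 (H1 p)"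
    using comp[of p r] tight[of p] by simp
  finally have *: "H2 \<eta> \<lhd> a (src L p) = (s r \<lhd> T1 (H1 p)) \<bullet> (a (src L p) \<rhd> T2 (H2 \<eta>))" .
  have "H2 \<eta> \<lhd> (a (src L p) \<cdot> T1 (H1 r)) = (H2 \<eta> \<lhd> a (src L p)) \<lhd> T1 (H1 r)" by simp
  also have "\<dots> = s r" unfolding * by simp
  finally have sr: "s r = H2 \<eta> \<lhd> (a (src L p) \<cdot> T1 (H1 r))" ..
  have "s f = s (q \<cdot>\<^bsub>L\<^esub> r)" by simp
  also have "\<dots> = H1 q \<rhd> s r"
    by (subst comp) (simp_all add: tight H_comp[OF presentsD(13)[OF presents]])
  also have "\<dots> = str_cell f" unfolding sr str_cell_eq_span_cell[OF presents] presents_cell(7)[OF presents l_def] by simp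
  finally show ?thesis .
qed

section \<open>Fullness and faithfulness\<close>
lemmas arrow_limit_exists = f_category.colax_limit_exists[OF chordate, unfolded chordate_simps]
lemmas arrow_limit_eq = f_category.colax_limit_eq[OF chordate, unfolded chordate_simps]
lemmas arrow_limit_cell_eq = f_category.colax_limit_cell_eq[OF chordate, unfolded chordate_simps]
lemmas arrow_limitD = f_category.colax_limitD[OF chordate, unfolded chordate_simps]
lemmas arrow_limit_reflection = f_category.limit_reflection[OF chordate, unfolded chordate_simps]
lemmas arrow_reflection_iff = f_category.reflection_iff[OF chordate, unfolded chordate_simps]

text \<open>Stated in \<open>B\<close> itself, so that the property transports along an isomorphism of apexes without
  reference to the F-category in which all 1-cells are tight.\<close>
definition universal where
  "universal k K p q l \<longleftrightarrow>
     (\<forall>\<rho> \<alpha>. \<rho> \<in> ones B \<and> tgt B \<rho> = src B k \<and> \<alpha> \<in> twos B \<and> cd B \<alpha> = k \<cdot> \<rho> \<and> (ps \<longrightarrow> invertible B \<alpha>)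
        \<longrightarrow> (\<exists>t \<in> hom B (src B \<rho>) K. p \<cdot> t = \<rho> \<and> q \<cdot> t = dm B \<alpha> \<and> l \<lhd> t = \<alpha>))
   \<and> (\<forall>t t'. t \<in> ones B \<and> tgt B t = K \<and> t' \<in> ones B \<and> tgt B t' = K \<and> p \<cdot> t = p \<cdot> t' \<and> l \<lhd> t = l \<lhd> t'
        \<longrightarrow> t = t')
   \<and> (\<forall>\<phi> \<psi>. \<phi> \<in> twos B \<and> \<psi> \<in> twos B \<and> dm B \<phi> = dm B \<psi> \<and> cd B \<phi> = cd B \<psi> \<and> tgt B (dm B \<phi>) = K
        \<and> p \<rhd> \<phi> = p \<rhd> \<psi> \<and> q \<rhd> \<phi> = q \<rhd> \<psi> \<longrightarrow> \<phi> = \<psi>)"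

lemma universal_exists:
  "\<lbrakk>universal k K p q l; \<rho> \<in> ones B; tgt B \<rho> = src B k; \<alpha> \<in> twos B; cd B \<alpha> = k \<cdot> \<rho>; ps \<Longrightarrow> invertible B \<alpha>\<rbrakk>
    \<Longrightarrow> \<exists>t \<in> hom B (src B \<rho>) K. p \<cdot> t = \<rho> \<and> q \<cdot> t = dm B \<alpha> \<and> l \<lhd> t = \<alpha>"
  unfolding universal_def by blast

lemma universal_eq:
  "\<lbrakk>universal k K p q l; t \<in> ones B; tgt B t = K; t' \<in> ones B; tgt B t' = K; p \<cdot> t = p \<cdot> t'; l \<lhd> t = l \<lhd> t'\<rbrakk>
    \<Longrightarrow> t = t'"
  unfolding universal_def by blast

lemma universal_cell_eq:
  "\<lbrakk>universal k K p q l; \<phi> \<in> twos B; \<psi> \<in> twos B; dm B \<phi> = dm B \<psi>; cd B \<phi> = cd B \<psi>; tgt B (dm B \<phi>) = K;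
    p \<rhd> \<phi> = p \<rhd> \<psi>; q \<rhd> \<phi> = q \<rhd> \<psi>\<rbrakk> \<Longrightarrow> \<phi> = \<psi>"
  unfolding universal_def by blast

text \<open>
  The structure map \<open>c\<close> is induced by the cone \<open>(x \<cdot> T p, (s \<lhd> T p) \<bullet> (y \<rhd> T l), y \<cdot> T q)\<close>.  The algebra
  laws for \<open>c\<close> are equations between arrows into a limit; on the universal 2-cell they become
  the two coherence laws of \<open>s\<close>.
\<close>
lemma limit_algebra:
  assumes lax: "lax_morphism B M (AlgMor (X, x) (Y, y) k s)" "ps \<Longrightarrow> invertible B s"
    and lim: "colax_limit ps (chordate B) k K p q l"
  shows "\<exists>c. algebra B M (K, c) \<and> p \<cdot> c = x \<cdot> T1 p \<and> q \<cdot> c = y \<cdot> T1 q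
    \<and> l \<lhd> c = (s \<lhd> T1 p) \<bullet> (y \<rhd> T2 l)"
proof -
  have k: "k \<in> ones B" using lax by (simp add: lax_morphism_iff)
  note D = arrow_limitD[OF lim k]
  have ax: "algebra B M (X, x)" and ay: "algebra B M (Y, y)" using lax by (auto simp: lax_morphism_iff)
  note X = algebraD[OF ax] and Y = algebraD[OF ay]
  have K: "K \<in> obs B" using D(1,3) by auto
  note [simp] = k D(1-9) X(1-4) Y(1-4) K
  have s [simp]: "src B k = X" "tgt B k = Y" "s \<in> twos B" "dm B s = y \<cdot> T1 k" "cd B s = k \<cdot> x"
    and mu: "s \<lhd> mult M X = (s \<lhd> T1 x) \<bullet> (y \<rhd> T2 s)" and un: "s \<lhd> munit M X = id2 B k"
    using lax by (auto simp: lax_morphism_iff)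
  have inv: "invertible B ((s \<lhd> T1 p) \<bullet> (y \<rhd> T2 l))" if ps
    by (intro invertible_vcomp invertible_lwhisker invertible_rwhisker T.on2_invertible lax(2) D(10) that) simp_all
  obtain c where c [simp]: "c \<in> ones B" "src B c = T0 K" "tgt B c = K"
    "p \<cdot> c = x \<cdot> T1 p" "q \<cdot> c = y \<cdot> T1 q" "l \<lhd> c = (s \<lhd> T1 p) \<bullet> (y \<rhd> T2 l)"
    using arrow_limit_exists[OF lim k, of "x \<cdot> T1 p" "(s \<lhd> T1 p) \<bullet> (y \<rhd> T2 l)"] inv by auto
  note [simp] = comp1_square[OF c(4)] comp1_square[OF c(5)] rwhisker_reduce[OF c(6)]
  have T [simp]: "T1 p \<cdot> T1 c = T1 x \<cdot> T1 (T1 p)" "T1 q \<cdot> T1 c = T1 y \<cdot> T1 (T1 q)"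
    using T.on1_comp'[of c p] T.on1_comp'[of c q] by simp_all
  have T2 [simp]: "T2 l \<lhd> T1 c = (T2 s \<lhd> T1 (T1 p)) \<bullet> (T1 y \<rhd> T2 (T2 l))"
    using T.on2_whisker(2)[of c l] by simp
  have c1: "c \<cdot> T1 c = c \<cdot> mult M K"
  proof (rule arrow_limit_eq[OF lim k])
    show "p \<cdot> (c \<cdot> T1 c) = p \<cdot> (c \<cdot> mult M K)"
      using mult_natural(1)[of p] comp1_square(1)[OF X(5), of "T1 (T1 p)"] by simp
    have "l \<lhd> (c \<cdot> T1 c) = ((s \<lhd> T1 x) \<bullet> (y \<rhd> T2 s)) \<lhd> T1 (T1 p) \<bullet> ((y \<cdot> T1 y) \<rhd> T2 (T2 l))"
      by simp
    also have "\<dots> = ((s \<lhd> mult M X) \<lhd> T1 (T1 p)) \<bullet> ((y \<cdot> mult M Y) \<rhd> T2 (T2 l))"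
      by (simp only: mu Y(5))
    also have "\<dots> = l \<lhd> (c \<cdot> mult M K)"
      using mult_natural(1)[of p] mult_natural(2)[of l] by simp
    finally show "l \<lhd> (c \<cdot> T1 c) = l \<lhd> (c \<cdot> mult M K)" .
  qed simp_all
  have c2: "c \<cdot> munit M K = id1 B K"
  proof (rule arrow_limit_eq[OF lim k])
    show "p \<cdot> (c \<cdot> munit M K) = p \<cdot> id1 B K"
      using munit_natural(1)[of p] comp1_reduce(1)[OF X(6), of p] by simp
    show "l \<lhd> (c \<cdot> munit M K) = l \<lhd> id1 B K"
      using munit_natural(1)[of p] munit_natural(2)[of l] rwhisker_reduce[OF un, of p] comp1_reduce(2)[OF Y(6), of l] by simp
  qed simp_all
  have "algebra B M (K, c)" using c1 c2 by (simp add: algebra_def hom_def)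
  thus ?thesis by (intro exI[of _ c]) simp
qed

text \<open>
  Transport the limit of \<open>k\<close>, with the structure from \<open>limit_algebra\<close>, along an isomorphism
  \<open>u : H C \<rightarrow> K\<close> of algebras.  The legs \<open>p \<cdot> u\<close> and \<open>q \<cdot> u\<close> are strict, so they come from
  tight morphisms, and the reflection in \<open>B\<close> lifts.
\<close>
lemma lift_morphism:
  assumes X: "X \<in> obs L" and Y: "Y \<in> obs L"
    and lax: "lax_morphism B M (AlgMor (H0 X, a X) (H0 Y, a Y) k s)" "ps \<Longrightarrow> invertible B s"
  shows "\<exists>f p q r \<eta>. f \<in> hom L X Y \<and> presents f p q r \<eta> \<and> H1 f = k \<and> str_cell f = s
    \<and> universal k (H0 (src L p)) (H1 p) (H1 q) (H2 (q \<rhd>\<^bsub>L\<^esub> \<eta>))"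
proof -
  have k: "k \<in> ones B" using lax by (simp add: lax_morphism_iff)
  obtain K p q l where lim: "colax_limit ps (chordate B) k K p q l" using limits_arrows[OF k] by auto
  note D = arrow_limitD[OF lim k]
  obtain c where c: "algebra B M (K, c)" "p \<cdot> c = a X \<cdot> T1 p" "q \<cdot> c = a Y \<cdot> T1 q"
    "l \<lhd> c = (s \<lhd> T1 p) \<bullet> (a Y \<rhd> T2 l)" using limit_algebra[OF lax lim] by auto
  obtain C u v where C [simp]: "C \<in> obs L" and u: "u \<in> hom B (H0 C) K" and v: "v \<in> hom B K (H0 C)"
    and uv: "v \<cdot> u = id1 B (H0 C)" "u \<cdot> v = id1 B K" and ua: "u \<cdot> a C = c \<cdot> T1 u"
    using ess_surj[OF c(1)] by auto
  note Ka = algebraD[OF c(1)]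
  note [simp] = X Y k D(1-9) Ka(1-4) c(2-4) homD[OF u] homD[OF v] uv ua
    comp1_reduce[OF uv(1)] comp1_reduce[OF uv(2)]
    comp1_square[OF c(2)] comp1_square[OF c(3)] comp1_square[OF ua] rwhisker_reduce[OF c(4)]
  have s [simp]: "src B k = H0 X" "tgt B k = H0 Y" "s \<in> twos B" "dm B s = a Y \<cdot> T1 k" "cd B s = k \<cdot> a X"
    using lax by (auto simp: lax_morphism_iff)
  have Tuv: "T1 u \<cdot> T1 v = id1 B (T0 K)" using T.on1_comp'[of v u] by simp
  obtain p1 where p1 [simp]: "tight A p1" "src L p1 = C" "tgt L p1 = X" "H1 p1 = p \<cdot> u"
    using strict_full[of C X "p \<cdot> u"] by (auto simp: hom_def)
  obtain q1 where q1 [simp]: "tight A q1" "src L q1 = C" "tgt L q1 = Y" "H1 q1 = q \<cdot> u"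
    using strict_full[of C Y "q \<cdot> u"] by (auto simp: hom_def)
  obtain r \<eta> where R: "reflection ps (chordate B) p r \<eta>" and r: "q \<cdot> r = k" "q \<rhd> \<eta> = l" "l \<lhd> r = id2 B k"
    using arrow_limit_reflection[OF lim k] by auto
  have R': "r \<in> ones B" "src B r = H0 X" "tgt B r = K" "\<eta> \<in> twos B" "dm B \<eta> = id1 B K"
    "cd B \<eta> = r \<cdot> p" "p \<cdot> r = id1 B (H0 X)" "p \<rhd> \<eta> = id2 B p" "\<eta> \<lhd> r = id2 B r"
    "ps \<Longrightarrow> invertible B \<eta>" using R D(3,4) by (auto simp: arrow_reflection_iff)
  note [simp] = R'(1-9) r comp1_reduce[OF R'(7)] lwhisker_reduce[OF R'(8)] rwhisker_reduce[OF R'(9)]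
    comp1_reduce[OF r(1)] lwhisker_reduce[OF r(2)] rwhisker_reduce[OF r(3)]
  have inv: "invertible B (v \<rhd> (\<eta> \<lhd> u))" if ps
    by (intro invertible_lwhisker invertible_rwhisker R'(10) that) simp_all
  have "reflection ps (chordate B) (H1 p1) (v \<cdot> r) (v \<rhd> (\<eta> \<lhd> u))"
    using inv by (simp add: arrow_reflection_iff)
  hence "\<exists>!(r', \<eta>'). reflection ps A p1 r' \<eta>' \<and> H1 r' = v \<cdot> r \<and> H2 \<eta>' = v \<rhd> (\<eta> \<lhd> u)"
    using lifts p1(1) unfolding lifts_reflections_def by blast
  then obtain r1 \<eta>1 where R1: "reflection ps A p1 r1 \<eta>1" and H: "H1 r1 = v \<cdot> r" "H2 \<eta>1 = v \<rhd> (\<eta> \<lhd> u)"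
    by auto
  define f where "f = q1 \<cdot>\<^bsub>L\<^esub> r1"
  note [simp] = H reflectionD[OF R1]
  have presents: "presents f p1 q1 r1 \<eta>1" using R1 by (simp add: presents_def f_def)
  have f: "f \<in> hom L X Y" by (simp add: f_def hom_def)
  have Hf: "H1 f = k" by (simp add: f_def)
  have Hl: "H2 (q1 \<rhd>\<^bsub>L\<^esub> \<eta>1) = l \<lhd> u" by simp
  have "str_cell f = l \<lhd> (u \<cdot> (a C \<cdot> T1 (v \<cdot> r)))"
    unfolding str_cell_eq_span_cell[OF presents] span_cell_def Hl by simp
  also have "\<dots> = (s \<lhd> (T1 p \<cdot> T1 r)) \<bullet> (a Y \<rhd> (T2 l \<lhd> T1 r))"
    by (simp add: comp1_reduce[OF Tuv])
  also have "T1 p \<cdot> T1 r = id1 B (T0 (H0 X))" using T.on1_comp'[of r p] by simp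
  also have "T2 l \<lhd> T1 r = id2 B (T1 k)" using T.on2_whisker(2)[of r l] by simp
  finally have str_cell: "str_cell f = s" by simp
  have "universal k (H0 (src L p1)) (H1 p1) (H1 q1) (H2 (q1 \<rhd>\<^bsub>L\<^esub> \<eta>1))"
    unfolding Hl universal_def p1 q1
  proof (intro conjI allI impI, goal_cases)
    case (1 \<rho> \<alpha>)
    hence [simp]: "\<rho> \<in> ones B" "tgt B \<rho> = H0 X" "\<alpha> \<in> twos B" "cd B \<alpha> = k \<cdot> \<rho>" by auto
    obtain t where [simp]: "t \<in> ones B" "src B t = src B \<rho>" "tgt B t = K" "p \<cdot> t = \<rho>" "q \<cdot> t = dm B \<alpha>" "l \<lhd> t = \<alpha>"
      using arrow_limit_exists[OF lim k, of \<rho> \<alpha>] 1 by auto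
    show ?case by (rule bexI[of _ "v \<cdot> t"]) (simp_all add: hom_def)
  next
    case (2 t t')
    hence [simp]: "t \<in> ones B" "tgt B t = H0 C" "t' \<in> ones B" "tgt B t' = H0 C" by auto
    have "u \<cdot> t = u \<cdot> t'" by (rule arrow_limit_eq[OF lim k]) (use 2 in simp_all)
    hence "(v \<cdot> u) \<cdot> t = (v \<cdot> u) \<cdot> t'" by (simp del: uv)
    thus ?case by simp
  next
    case (3 \<phi> \<psi>)
    hence [simp]: "\<phi> \<in> twos B" "\<psi> \<in> twos B" "tgt B (dm B \<psi>) = H0 C" "tgt B (dm B \<phi>) = H0 C"
      "dm B \<phi> = dm B \<psi>" "cd B \<phi> = cd B \<psi>" by auto
    have "u \<rhd> \<phi> = u \<rhd> \<psi>" by (rule arrow_limit_cell_eq[OF lim k]) (use 3 in simp_all)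
    hence "(v \<cdot> u) \<rhd> \<phi> = (v \<cdot> u) \<rhd> \<psi>" by (simp del: uv)
    thus ?case by simp
  qed
  with f presents Hf str_cell show ?thesis by blast
qed

text \<open>The cone obtained by pasting an algebra 2-cell onto the cone of \<open>f\<close> satisfies the equation
  of \<open>presents_str_cell\<close> with the structure cell of \<open>g\<close>.\<close>
lemma induced_cone_struct:
  assumes f: "presents f p q r \<eta>" "l = q \<rhd>\<^bsub>L\<^esub> \<eta>" and g: "g \<in> ones L" "src L g = src L f" "tgt L g = tgt L f"
    and \<beta>: "\<beta> \<in> cells B (H1 f) (H1 g)"
      "(\<beta> \<lhd> a (src L f)) \<bullet> str_cell f = str_cell g \<bullet> (a (tgt L f) \<rhd> T2 \<beta>)"
    and c: "c = (\<beta> \<lhd> H1 p) \<bullet> H2 l"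
  shows "c \<lhd> a (src L p) = (str_cell g \<lhd> T1 (H1 p)) \<bullet> (a (tgt L f) \<rhd> T2 c)"
proof -
  have b [simp]: "\<beta> \<in> twos B" "dm B \<beta> = H1 f" "cd B \<beta> = H1 g" using \<beta> by (auto simp: cells_def)
  note [simp] = presentsD[OF f(1)] presents_cell(1-5)[OF f] g
  have "c \<lhd> a (src L p) = (\<beta> \<lhd> (a (src L f) \<cdot> T1 (H1 p))) \<bullet> ((str_cell f \<lhd> T1 (H1 p)) \<bullet> (a (tgt L f) \<rhd> T2 (H2 l)))"
    by (simp add: c presents_str_cell(2)[OF f])
  also have "\<dots> = (((\<beta> \<lhd> a (src L f)) \<bullet> str_cell f) \<lhd> T1 (H1 p)) \<bullet> (a (tgt L f) \<rhd> T2 (H2 l))" by simp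
  also have "\<dots> = (str_cell g \<lhd> T1 (H1 p)) \<bullet> (a (tgt L f) \<rhd> T2 c)" unfolding \<beta>(2) c by simp
  finally show ?thesis .
qed

text \<open>
  The arrow \<open>t\<close> induced by pasting \<open>\<beta>\<close> onto the image of the cone of \<open>f\<close> commutes with the
  algebra structures, which can be tested on the universal cone: there it is
  \<open>induced_cone_struct\<close>.  So \<open>t\<close> comes from a tight morphism.
\<close>
lemma comparison_arrow:
  assumes f: "presents f p q r \<eta>" "l = q \<rhd>\<^bsub>L\<^esub> \<eta>" and g: "presents g p' q' r' \<eta>'" "l' = q' \<rhd>\<^bsub>L\<^esub> \<eta>'"
    and par: "src L g = src L f" "tgt L g = tgt L f"
    and univ: "universal (H1 g) (H0 (src L p')) (H1 p') (H1 q') (H2 l')"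
    and \<beta>: "\<beta> \<in> cells B (H1 f) (H1 g)" "ps \<Longrightarrow> invertible B \<beta>"
      "(\<beta> \<lhd> a (src L f)) \<bullet> str_cell f = str_cell g \<bullet> (a (tgt L f) \<rhd> T2 \<beta>)"
  obtains s where "tight A s" "src L s = src L p" "tgt L s = src L p'" "p' \<cdot>\<^bsub>L\<^esub> s = p" "q' \<cdot>\<^bsub>L\<^esub> s = q"
    "H2 l' \<lhd> H1 s = (\<beta> \<lhd> H1 p) \<bullet> H2 l"
proof -
  have b [simp]: "\<beta> \<in> twos B" "dm B \<beta> = H1 f" "cd B \<beta> = H1 g" using \<beta> by (auto simp: cells_def)
  note [simp] = par presentsD[OF f(1)] presents_cell(1-5)[OF f] presentsD[OF g(1)] presents_cell(1-5)[OF g]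
  define c where "c = (\<beta> \<lhd> H1 p) \<bullet> H2 l"
  have c [simp]: "c \<in> twos B" "dm B c = H1 q" "cd B c = H1 g \<cdot> H1 p" by (auto simp: c_def)
  have inv: "invertible B c" if ps
    unfolding c_def by (intro invertible_vcomp invertible_rwhisker H.on2_invertible presents_cell(6)[OF f] \<beta>(2) that) simp_all
  obtain t where "t \<in> hom B (H0 (src L p)) (H0 (src L p'))"
    and t: "H1 p' \<cdot> t = H1 p" "H1 q' \<cdot> t = H1 q" "H2 l' \<lhd> t = c"
    using universal_exists[OF univ, of "H1 p" c] inv by auto
  note th [simp] = homD[OF this(1)]
  note [simp] = t comp1_reduce[OF t(1)] comp1_reduce[OF t(2)] rwhisker_reduce[OF t(3)]
  have [simp]: "T1 (H1 p') \<cdot> T1 t = T1 (H1 p)" using T.on1_comp'[of t "H1 p'"] by simp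
  have [simp]: "T2 (H2 l') \<lhd> T1 t = T2 c" using T.on2_whisker(2)[of t "H2 l'"] by simp
  have "t \<cdot> a (src L p) = a (src L p') \<cdot> T1 t"
  proof -
    have 1: "H1 p' \<cdot> (t \<cdot> a (src L p)) = H1 p' \<cdot> (a (src L p') \<cdot> T1 t)" by simp
    have "H2 l' \<lhd> (t \<cdot> a (src L p)) = (str_cell g \<lhd> T1 (H1 p)) \<bullet> (a (tgt L f) \<rhd> T2 c)"
      using induced_cone_struct[OF f presentsD(16)[OF g(1)] par \<beta>(1,3) c_def] by simp
    also have "\<dots> = H2 l' \<lhd> (a (src L p') \<cdot> T1 t)"
      using rwhisker_reduce[OF presents_str_cell(2)[OF g], of "T1 t"] by simp
    finally show ?thesis by (rule universal_eq[OF univ _ _ _ _ 1, rotated 4]) simp_all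
  qed
  then obtain s where s: "tight A s" "src L s = src L p" "tgt L s = src L p'" "H1 s = t"
    using strict_full[of "src L p" "src L p'" t] by (auto simp: hom_def)
  have "p' \<cdot>\<^bsub>L\<^esub> s = p" by (rule strict_faithful) (use s in simp_all)
  moreover have "q' \<cdot>\<^bsub>L\<^esub> s = q" by (rule strict_faithful) (use s in simp_all)
  ultimately show ?thesis using that s t(3) c_def by blast
qed

text \<open>
  With \<open>\<beta>\<close> an identity the comparison arrow \<open>s\<close> maps one reflection to the other after applying \<open>H\<close>,
  and since \<open>H\<close> detects this, \<open>r' = s \<cdot> r\<close> holds already in \<open>A\<close>.
\<close>
lemma lift_unique:
  assumes f: "f \<in> ones L" and g: "presents g p' q' r' \<eta>'" and par: "src L g = src L f" "tgt L g = tgt L f"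
    and univ: "universal (H1 g) (H0 (src L p')) (H1 p') (H1 q') (H2 (q' \<rhd>\<^bsub>L\<^esub> \<eta>'))"
    and eq: "H1 f = H1 g" "str_cell f = str_cell g"
  shows "f = g"
proof -
  obtain p q r \<eta> where presents: "presents f p q r \<eta>" using presentation_exists[OF f] by auto
  define l where "l = q \<rhd>\<^bsub>L\<^esub> \<eta>"
  define l' where "l' = q' \<rhd>\<^bsub>L\<^esub> \<eta>'"
  note [simp] = par f presentsD[OF presents] presents_cell(1-5)[OF presents l_def] presentsD[OF g] presents_cell(1-5)[OF g l'_def] eq(1)
  have \<beta>: "id2 B (H1 f) \<in> cells B (H1 f) (H1 g)" "invertible B (id2 B (H1 f))"
      "(id2 B (H1 f) \<lhd> a (src L f)) \<bullet> str_cell f = str_cell g \<bullet> (a (tgt L f) \<rhd> T2 (id2 B (H1 f)))"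
    using eq(2) str_cell_two[OF f] by (simp_all add: cells_def)
  obtain s where s [simp]: "tight A s" "src L s = src L p" "tgt L s = src L p'" "p' \<cdot>\<^bsub>L\<^esub> s = p" "q' \<cdot>\<^bsub>L\<^esub> s = q"
    and "H2 l' \<lhd> H1 s = (id2 B (H1 f) \<lhd> H1 p) \<bullet> H2 l"
    using comparison_arrow[OF presents l_def g l'_def par univ[folded l'_def] \<beta>] .
  hence ls [simp]: "H2 l' \<lhd> H1 s = H2 l" by simp
  note [simp] = rwhisker_reduce[OF ls]
  have sr: "H1 s \<cdot> H1 r = H1 r'"
  proof -
    have 1: "H1 p' \<cdot> (H1 s \<cdot> H1 r) = H1 p' \<cdot> H1 r'"
      by (simp add: H_comp[OF s(4)] H_comp[OF presentsD(8)[OF presents]] H_comp[OF presentsD(8)[OF g]])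
    have 2: "H2 l' \<lhd> (H1 s \<cdot> H1 r) = H2 l' \<lhd> H1 r'"
      by (simp add: H_rwhisker[OF presents_cell(5)[OF presents l_def]] H_rwhisker[OF presents_cell(5)[OF g l'_def]])
    show ?thesis by (rule universal_eq[OF univ[folded l'_def] _ _ _ _ 1 2]) simp_all
  qed
  have s\<eta>: "H1 s \<rhd> H2 \<eta> = H2 \<eta>' \<lhd> H1 s"
  proof -
    have 1: "H1 p' \<rhd> (H1 s \<rhd> H2 \<eta>) = H1 p' \<rhd> (H2 \<eta>' \<lhd> H1 s)"
      by (simp add: H_comp[OF s(4)] H_lwhisker[OF presentsD(9)[OF presents]] H_lwhisker[OF presentsD(9)[OF g]])
    have 2: "H1 q' \<rhd> (H1 s \<rhd> H2 \<eta>) = H1 q' \<rhd> (H2 \<eta>' \<lhd> H1 s)"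
      by (simp add: H_comp[OF s(5)] H_lwhisker[OF presents_cell(4)[OF presents l_def]] H_lwhisker[OF presents_cell(4)[OF g l'_def]])
    show ?thesis
      by (rule universal_cell_eq[OF univ[folded l'_def] _ _ _ _ _ 1 2]) (simp_all add: H_comp[OF s(4)] comp1_reduce[OF sr])
  qed
  have "tight_square A p p' s (id1 L (src L f))"
    by (simp add: tight_square_def hom_def)
  moreover have "reflection_morphism (chordate B) (H1 r) (H2 \<eta>) (H1 r') (H2 \<eta>') (H1 s) (H1 (id1 L (src L f)))"
    using sr s\<eta> by (simp add: reflection_morphism_def)
  ultimately have "reflection_morphism A r \<eta> r' \<eta>' s (id1 L (src L f))"
    using detects presents_reflection[OF presents] presents_reflection[OF g]
    unfolding detects_reflection_morphisms_def by blast
  hence r': "s \<cdot>\<^bsub>L\<^esub> r = r'" by (simp add: reflection_morphism_def)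
  have "f = (q' \<cdot>\<^bsub>L\<^esub> s) \<cdot>\<^bsub>L\<^esub> r" by (simp del: incl.T.comp1_assoc')
  also have "\<dots> = q' \<cdot>\<^bsub>L\<^esub> (s \<cdot>\<^bsub>L\<^esub> r)" by (rule incl.T.comp1_assoc') simp_all
  also have "\<dots> = g" by (simp add: r')
  finally show ?thesis .
qed

theorem str_cell_surj:
  assumes "X \<in> obs L" "Y \<in> obs L" "lax_morphism B M (AlgMor (H0 X, a X) (H0 Y, a Y) k s)" "ps \<Longrightarrow> invertible B s"
  shows "\<exists>f \<in> hom L X Y. H1 f = k \<and> str_cell f = s"
  using lift_morphism[OF assms] by blast

lemma universal_presentation:
  assumes f: "f \<in> ones L"
  shows "\<exists>p q r \<eta>. presents f p q r \<eta> \<and> universal (H1 f) (H0 (src L p)) (H1 p) (H1 q) (H2 (q \<rhd>\<^bsub>L\<^esub> \<eta>))"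
proof -
  obtain p0 q0 r0 \<eta>0 where f0: "presents f p0 q0 r0 \<eta>0" using presentation_exists[OF f] by auto
  have ob: "src L f \<in> obs L" "tgt L f \<in> obs L" using f by auto
  obtain g p q r \<eta> where "g \<in> hom L (src L f) (tgt L f)" and g: "presents g p q r \<eta>" "H1 g = H1 f" "str_cell g = str_cell f"
    "universal (H1 f) (H0 (src L p)) (H1 p) (H1 q) (H2 (q \<rhd>\<^bsub>L\<^esub> \<eta>))"
    using lift_morphism[OF ob presents_str_cell(1,3)[OF f0 refl]] by auto
  moreover have "f = g"
    using lift_unique[OF f g(1), unfolded g(2), OF _ _ g(4)] calculation by (auto simp: hom_def)
  ultimately show ?thesis by blast
qed

theorem str_cell_inj:
  assumes "f \<in> ones L" "g \<in> ones L" "src L f = src L g" "tgt L f = tgt L g" "H1 f = H1 g" "str_cell f = str_cell g"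
  shows "f = g"
proof -
  obtain p q r \<eta> where g: "presents g p q r \<eta>" "universal (H1 g) (H0 (src L p)) (H1 p) (H1 q) (H2 (q \<rhd>\<^bsub>L\<^esub> \<eta>))"
    using universal_presentation[OF assms(2)] by auto
  show ?thesis using lift_unique[OF assms(1) g(1) _ _ g(2)] assms(3-6) by simp
qed

text \<open>The required 2-cell is the cone of \<open>g\<close> whiskered with \<open>s \<cdot> r\<close>, for the comparison arrow \<open>s\<close>
  of \<open>\<beta>\<close>.\<close>
lemma full_on_2cells_lax:
  assumes "\<not> ps" "f \<in> ones L" "g \<in> ones L" "src L g = src L f" "tgt L g = tgt L f"
    and \<beta>: "\<beta> \<in> cells B (H1 f) (H1 g)"
      "(\<beta> \<lhd> a (src L f)) \<bullet> str_cell f = str_cell g \<bullet> (a (tgt L f) \<rhd> T2 \<beta>)"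
  shows "\<exists>\<alpha> \<in> cells L f g. H2 \<alpha> = \<beta>"
proof -
  obtain p q r \<eta> where f: "presents f p q r \<eta>" using presentation_exists[OF assms(2)] by auto
  obtain p' q' r' \<eta>' where g: "presents g p' q' r' \<eta>'"
    and univ: "universal (H1 g) (H0 (src L p')) (H1 p') (H1 q') (H2 (q' \<rhd>\<^bsub>L\<^esub> \<eta>'))"
    using universal_presentation[OF assms(3)] by auto
  define l where "l = q \<rhd>\<^bsub>L\<^esub> \<eta>"
  define l' where "l' = q' \<rhd>\<^bsub>L\<^esub> \<eta>'"
  have b [simp]: "\<beta> \<in> twos B" "dm B \<beta> = H1 f" "cd B \<beta> = H1 g" using \<beta> by (auto simp: cells_def)
  note [simp] = assms(2-5) presentsD[OF f] presents_cell(1-5)[OF f l_def] presentsD[OF g] presents_cell(1-5)[OF g l'_def]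
  obtain s where s [simp]: "tight A s" "src L s = src L p" "tgt L s = src L p'" "p' \<cdot>\<^bsub>L\<^esub> s = p" "q' \<cdot>\<^bsub>L\<^esub> s = q"
    and ls: "H2 l' \<lhd> H1 s = (\<beta> \<lhd> H1 p) \<bullet> H2 l"
    using comparison_arrow[OF f l_def g l'_def assms(4,5) univ[folded l'_def] \<beta>(1) _ \<beta>(2)] assms(1) by auto
  note [simp] = incl.T.comp1_reduce[OF s(4)] incl.T.comp1_reduce[OF s(5)]
  have "l' \<lhd>\<^bsub>L\<^esub> (s \<cdot>\<^bsub>L\<^esub> r) \<in> cells L f g" by (simp add: cells_def)
  moreover have "H2 (l' \<lhd>\<^bsub>L\<^esub> (s \<cdot>\<^bsub>L\<^esub> r)) = \<beta>"
    by (simp add: rwhisker_reduce[OF ls] H_comp[OF presentsD(8)[OF f]] H_rwhisker[OF presents_cell(5)[OF f l_def]])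
  ultimately show ?thesis by blast
qed

text \<open>
  A non-invertible \<open>\<beta>\<close> induces no comparison arrow.  Over a common reflection it equals \<open>\<gamma> \<lhd> H r\<close> for a
  2-cell \<open>\<gamma>\<close> between images of tight morphisms, and \<open>\<gamma>\<close> is compatible with the algebra structures
  because an invertible cone can be cancelled; monadicity lifts \<open>\<gamma>\<close>.
\<close>
lemma full_on_2cells_pseudo:
  assumes "ps" "f \<in> ones L" "g \<in> ones L" "src L g = src L f" "tgt L g = tgt L f"
    and \<beta>: "\<beta> \<in> cells B (H1 f) (H1 g)"
      "(\<beta> \<lhd> a (src L f)) \<bullet> str_cell f = str_cell g \<bullet> (a (tgt L f) \<rhd> T2 \<beta>)"
  shows "\<exists>\<alpha> \<in> cells L f g. H2 \<alpha> = \<beta>"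
proof -
  obtain p q q0 r \<eta> where f: "presents f p q r \<eta>" and g: "presents g p q0 r \<eta>"
    using common_presentation[of f g] assms(2-5) by auto
  define l where "l = q \<rhd>\<^bsub>L\<^esub> \<eta>"
  define l0 where "l0 = q0 \<rhd>\<^bsub>L\<^esub> \<eta>"
  have b [simp]: "\<beta> \<in> twos B" "dm B \<beta> = H1 f" "cd B \<beta> = H1 g" using \<beta> by (auto simp: cells_def)
  note [simp] = assms(2-5) presentsD[OF f] presents_cell(1-5)[OF f l_def] presentsD[OF g] presents_cell(1-5)[OF g l0_def]
  obtain m where m [simp]: "m \<in> twos B" "dm B m = H1 g \<cdot> H1 p" "cd B m = H1 q0"
    and ml: "m \<bullet> H2 l0 = id2 B (H1 q0)" "H2 l0 \<bullet> m = id2 B (H1 g \<cdot> H1 p)"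
    using H.on2_invertible[OF presents_cell(6)[OF g l0_def assms(1)]] by (rule invertibleE) auto
  define c where "c = (\<beta> \<lhd> H1 p) \<bullet> H2 l"
  have c [simp]: "c \<in> twos B" "dm B c = H1 q" "cd B c = H1 g \<cdot> H1 p" by (auto simp: c_def)
  define \<gamma> where "\<gamma> = m \<bullet> c"
  have \<gamma> [simp]: "\<gamma> \<in> twos B" "dm B \<gamma> = H1 q" "cd B \<gamma> = H1 q0" by (simp_all add: \<gamma>_def)
  have "H2 l0 \<bullet> \<gamma> = (H2 l0 \<bullet> m) \<bullet> c" by (simp add: \<gamma>_def)
  also have "\<dots> = c" unfolding ml by simp
  finally have l\<gamma>: "H2 l0 \<bullet> \<gamma> = c" .
  \<comment> \<open>The image of \<open>l0\<close> is invertible, hence so are its whiskerings.\<close>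
  have cancel: "x = x'" if "(H2 l0 \<lhd> z) \<bullet> x = (H2 l0 \<lhd> z) \<bullet> x'" "x \<in> twos B" "x' \<in> twos B" "z \<in> ones B"
    "tgt B z = H0 (src L p)" "cd B x = H1 q0 \<cdot> z" "cd B x' = H1 q0 \<cdot> z" for x x' z
  proof -
    note [simp] = that(2-7)
    have "((m \<bullet> H2 l0) \<lhd> z) \<bullet> x = ((m \<bullet> H2 l0) \<lhd> z) \<bullet> x'"
      using arg_cong[OF that(1), of "\<lambda>u. (m \<lhd> z) \<bullet> u"] by simp
    thus ?thesis unfolding ml by simp
  qed
  have "\<gamma> \<lhd> a (src L p) = a (tgt L f) \<rhd> T2 \<gamma>"
  proof (rule cancel[of "a (src L p)"])
    have "(H2 l0 \<lhd> a (src L p)) \<bullet> (\<gamma> \<lhd> a (src L p)) = c \<lhd> a (src L p)"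
      unfolding l\<gamma>[symmetric] by simp
    also have "\<dots> = (str_cell g \<lhd> T1 (H1 p)) \<bullet> (a (tgt L f) \<rhd> T2 c)"
      by (rule induced_cone_struct[OF f l_def assms(3-5) \<beta> c_def])
    also have "\<dots> = (H2 l0 \<lhd> a (src L p)) \<bullet> (a (tgt L f) \<rhd> T2 \<gamma>)"
      unfolding l\<gamma>[symmetric] presents_str_cell(2)[OF g l0_def] by simp
    finally show "(H2 l0 \<lhd> a (src L p)) \<bullet> (\<gamma> \<lhd> a (src L p)) = (H2 l0 \<lhd> a (src L p)) \<bullet> (a (tgt L f) \<rhd> T2 \<gamma>)" .
  qed simp_all
  then obtain \<delta> where \<delta>: "\<delta> \<in> twos L" "dm L \<delta> = q" "cd L \<delta> = q0" "H2 \<delta> = \<gamma>"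
    using strict_cell_full[of q q0 \<gamma>] by (auto simp: cells_def)
  have "\<gamma> \<lhd> H1 r = (H2 l0 \<bullet> \<gamma>) \<lhd> H1 r"
    by (simp add: H_rwhisker[OF presents_cell(5)[OF g l0_def]] H_comp[OF presentsD(13)[OF g]])
  also have "\<dots> = \<beta>" unfolding l\<gamma> c_def
    by (simp add: H_rwhisker[OF presents_cell(5)[OF f l_def]] H_comp[OF presentsD(8)[OF f]])
  finally have "H2 (\<delta> \<lhd>\<^bsub>L\<^esub> r) = \<beta>" using \<delta> by simp
  moreover have "\<delta> \<lhd>\<^bsub>L\<^esub> r \<in> cells L f g" using \<delta> by (simp add: cells_def)
  ultimately show ?thesis by blast
qed

theorem full_on_2cells:
  assumes "f \<in> ones L" "g \<in> ones L" "src L g = src L f" "tgt L g = tgt L f"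
    "\<beta> \<in> cells B (H1 f) (H1 g)" "(\<beta> \<lhd> a (src L f)) \<bullet> str_cell f = str_cell g \<bullet> (a (tgt L f) \<rhd> T2 \<beta>)"
  shows "\<exists>\<alpha> \<in> cells L f g. H2 \<alpha> = \<beta>"
  using full_on_2cells_lax full_on_2cells_pseudo assms by blast

end

section \<open>The extension to loose morphisms\<close>
lemma f_co_simps [simp]: "lam (f_co A) = co (lam A)" "tau (f_co A) = co (tau A)" "incl (f_co A) = incl A"
  "tight (f_co A) = tight A" "f_co (chordate B) = chordate (co B)"
  by (auto simp: f_co_def tight_def chordate_def fun_eq_iff)

lemma f_category_co:
  assumes "f_category A" shows "f_category (f_co A)"
proof -
  interpret f_category A by fact
  show ?thesis
    by (rule f_category.intro) (auto simp: two_functor_co[OF incl_functor] obs_eq incl_ob incl_inj incl_locally_ff)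
qed

context strict_comparison begin

definition alg_of where "alg_of X = (H0 X, a X)"

definition alg_mor_of where "alg_mor_of s f = AlgMor (alg_of (src L f)) (alg_of (tgt L f)) (H1 f) (s f)"

text \<open>
  The assignments \<open>s\<close> for which \<open>X \<mapsto> alg_of X\<close>, \<open>f \<mapsto> alg_mor_of s f\<close> is an F-functor to the
  F-category of \<open>w\<close>-algebras over \<open>B\<close> that extends the comparison on tight morphisms.
\<close>
definition structure_cells where
  "structure_cells w s \<longleftrightarrow> (\<forall>f \<in> ones L. w_morphism w B M (alg_mor_of s f))
    \<and> (\<forall>f. tight A f \<longrightarrow> s f = id2 B (H1 f \<cdot> a (src L f)))
    \<and> (\<forall>f \<in> ones L. \<forall>g \<in> ones L. tgt L f = src L g \<longrightarrow> alg_mor_of s (g \<cdot>\<^bsub>L\<^esub> f) = alg_comp1 w B M (alg_mor_of s g) (alg_mor_of s f))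
    \<and> (\<forall>\<alpha> \<in> twos L. algebra_cell w (alg_mor_of s (dm L \<alpha>)) (alg_mor_of s (cd L \<alpha>)) (H2 \<alpha>))"

lemma structure_cellsD:
  assumes "structure_cells w s"
  shows "f \<in> ones L \<Longrightarrow> w_morphism w B M (alg_mor_of s f)"
    and "tight A f \<Longrightarrow> s f = id2 B (H1 f \<cdot> a (src L f))"
    and "\<lbrakk>f \<in> ones L; g \<in> ones L; tgt L f = src L g\<rbrakk> \<Longrightarrow> alg_mor_of s (g \<cdot>\<^bsub>L\<^esub> f) = alg_comp1 w B M (alg_mor_of s g) (alg_mor_of s f)"
    and "\<alpha> \<in> twos L \<Longrightarrow> algebra_cell w (alg_mor_of s (dm L \<alpha>)) (alg_mor_of s (cd L \<alpha>)) (H2 \<alpha>)"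
  using assms unfolding structure_cells_def by blast+

lemma alg_mor_of_sel [simp]:
  "asrc (alg_mor_of s f) = alg_of (src L f)" "atgt (alg_mor_of s f) = alg_of (tgt L f)" "und1 (alg_mor_of s f) = H1 f" "struct (alg_mor_of s f) = s f"
  by (simp_all add: alg_mor_of_def)

lemma alg_of_sel [simp]: "fst (alg_of X) = H0 X" "snd (alg_of X) = a X"
  by (simp_all add: alg_of_def)

lemma algebra_alg_of [simp]: "X \<in> obs L \<Longrightarrow> algebra B M (alg_of X)"
  using alg by (simp add: alg_of_def)

lemma strict_alg_mor_of:
  assumes "structure_cells w s" "tight A f" shows "strict_morphism B M (alg_mor_of s f)"
  using structure_cellsD(2)[OF assms] strict[OF assms(2)] tight_one[OF assms(2)]
  by (simp add: strict_morphism_sel)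

lemma strict_comparison_co: "strict_comparison (f_co A) (co B) M H a"
proof -
  interpret cA: f_category "f_co A" by (rule f_category_co) (rule f_category_axioms)
  interpret c: monad_on "co B" M by (rule monad_on_co)
  show ?thesis
  proof (intro strict_comparison.intro strict_comparison_axioms.intro cA.f_category_axioms c.monad_on_axioms, goal_cases)
    case 1 show ?case using two_functor_co[OF H] by simp
  next
    case (2 X) thus ?case using alg by simp
  next
    case (3 f) thus ?case using strict by simp
  next
    case (4 \<alpha>) thus ?case using strict_cell[of \<alpha>] by simp
  next
    case (5 X Y h) thus ?case using strict_full by simp
  next
    case (6 f g) thus ?case using strict_faithful by simp
  next
    case (7 f g \<gamma>) thus ?case using strict_cell_full[of g f \<gamma>] by simp
  next
    case (8 K k) thus ?case using ess_surj by simp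
  qed
qed

end

text \<open>
  The outcome of the preceding sections for one weakness \<open>w\<close>, in a form that dualises: all that
  the construction of the equivalence uses from here on.
\<close>
locale algebra_extension = strict_comparison A B M H a
  for A :: "('a, 'm, 'c, 'n, 'd) f_cat" and B :: "('b, 'k, 'e) two_cat" (structure)
    and M :: "('b, 'k, 'e) monad2" and H :: "('a, 'n, 'd, 'b, 'k, 'e) map2" and a :: "'a \<Rightarrow> 'k" +
  fixes w :: weakness and str_cell :: "'n \<Rightarrow> 'e"
  assumes ext_cells: "structure_cells w str_cell"
    and ext_unique: "\<lbrakk>structure_cells w s; f \<in> ones (lam A)\<rbrakk> \<Longrightarrow> s f = str_cell f"
    and ext_surj: "\<lbrakk>X \<in> obs (lam A); Y \<in> obs (lam A); w_morphism w B M (AlgMor (alg_of X) (alg_of Y) k s')\<rbrakk>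
      \<Longrightarrow> \<exists>f \<in> hom (lam A) X Y. on1 H f = k \<and> str_cell f = s'"
    and ext_inj: "\<lbrakk>f \<in> ones (lam A); g \<in> ones (lam A); src (lam A) f = src (lam A) g; tgt (lam A) f = tgt (lam A) g;
        on1 H f = on1 H g; str_cell f = str_cell g\<rbrakk> \<Longrightarrow> f = g"
    and ext_cell_full: "\<lbrakk>f \<in> ones (lam A); g \<in> ones (lam A); src (lam A) f = src (lam A) g; tgt (lam A) f = tgt (lam A) g;
        algebra_cell w (alg_mor_of str_cell f) (alg_mor_of str_cell g) \<beta>\<rbrakk> \<Longrightarrow> \<exists>\<alpha> \<in> cells (lam A) f g. on2 H \<alpha> = \<beta>"
    and ext_faithful: "locally_faithful A H"

lemma (in doctrinal) algebra_extension: "algebra_extension A B M H a (if ps then Pseudo else Lax) str_cell"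
proof -
  define w where "w = (if ps then Pseudo else Lax)"
  have w [simp]: "w \<noteq> Colax" "w = Pseudo \<longleftrightarrow> ps" by (auto simp: w_def)
  note wl = w_morphism_lax[OF w(1)]
  have m: "w_morphism w B M (alg_mor_of str_cell f)" if "f \<in> ones L" for f
    using presentation_exists[OF that] presents_str_cell(1,3)[OF _ refl] by (auto simp: wl alg_mor_of_def alg_of_def)
  have str_cell: "structure_cells w str_cell"
    unfolding structure_cells_def
  proof (intro conjI ballI allI impI)
    fix f g assume "f \<in> ones L" "g \<in> ones L" "tgt L f = src L g"
    thus "alg_mor_of str_cell (g \<cdot>\<^bsub>L\<^esub> f) = alg_comp1 w B M (alg_mor_of str_cell g) (alg_mor_of str_cell f)"
      by (simp add: alg_mor_of_def alg_comp1_def str_cell_comp)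
  next
    fix \<alpha> assume "\<alpha> \<in> twos L"
    thus "algebra_cell w (alg_mor_of str_cell (dm L \<alpha>)) (alg_mor_of str_cell (cd L \<alpha>)) (H2 \<alpha>)"
      using str_cell_natural[of \<alpha>] m by (simp add: algebra_cell_def cells_def w_compatible_def Let_def)
  qed (use m str_cell_tight in auto)
  have "algebra_extension A B M H a w str_cell"
  proof (unfold_locales, goal_cases)
    case 1 show ?case by (rule str_cell)
  next
    case (2 s f)
    note D = structure_cellsD[OF 2(1)]
    have ty: "s f \<in> cells B (a (tgt L f) \<cdot> T1 (H1 f)) (H1 f \<cdot> a (src L f))" if "f \<in> ones L" for f
      using D(1)[OF that] unfolding wl lax_morphism_sel by (simp add: cells_def)
    show ?case
    proof (rule str_cell_unique)
      fix f g assume "f \<in> ones L" "g \<in> ones L" "tgt L f = src L g"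
      thus "s (g \<cdot>\<^bsub>L\<^esub> f) = (H1 g \<rhd> s f) \<bullet> (s g \<lhd> T1 (H1 f))"
        using arg_cong[OF D(3)[of f g], of struct] by (simp add: alg_comp1_def)
    next
      fix \<alpha> assume "\<alpha> \<in> twos L"
      thus "(H2 \<alpha> \<lhd> a (src L (dm L \<alpha>))) \<bullet> s (dm L \<alpha>) = s (cd L \<alpha>) \<bullet> (a (tgt L (dm L \<alpha>)) \<rhd> T2 (H2 \<alpha>))"
        using algebra_cellD_lax[OF w(1) D(4)] by simp
    qed (use 2(2) ty D(2) in auto)
  next
    case (3 X Y k s')
    thus ?case using str_cell_surj[of X Y k s'] by (simp add: wl alg_of_def)
  next
    case (4 f g) thus ?case by (rule str_cell_inj)
  next
    case (5 f g \<beta>)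
    thus ?case using full_on_2cells[of f g \<beta>] algebra_cellD_lax[OF w(1) 5(5)] by (auto simp: algebra_cell_def)
  next
    case 6 show ?case by (rule loc_faithful)
  qed
  thus ?thesis by (simp add: w_def)
qed

lemma (in strict_comparison) algebra_extension_co:
  assumes "algebra_extension (f_co A) (co B) M H a Lax str_cell"
  shows "algebra_extension A B M H a Colax str_cell"
proof -
  interpret c: algebra_extension "f_co A" "co B" M H a Lax str_cell by (rule assms)
  have alg_mor_of: "c.alg_mor_of s f = alg_mor_of s f" for s f
    by (simp add: alg_mor_of_def c.alg_mor_of_def)
  have sc: "c.structure_cells Lax s \<longleftrightarrow> structure_cells Colax s" for s
    by (auto simp: structure_cells_def c.structure_cells_def alg_mor_of w_morphism_co alg_comp1_co algebra_cell_co)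
  show ?thesis
  proof (unfold_locales, goal_cases)
    case 1 show ?case using c.ext_cells sc by simp
  next
    case (2 s f) thus ?case using c.ext_unique[of s f] sc by simp
  next
    case (3 X Y k s') thus ?case using c.ext_surj[of X Y k s'] by (simp add: w_morphism_co)
  next
    case (4 f g) thus ?case using c.ext_inj[of f g] by simp
  next
    case (5 f g \<beta>) thus ?case using c.ext_cell_full[of g f \<beta>] by (simp add: alg_mor_of algebra_cell_co)
  next
    case 6 show ?case using c.ext_faithful by (auto simp: locally_faithful_def)
  qed
qed

lemma two_functor_cong:
  assumes "two_functor C D F" "eq_on C F G" shows "two_functor C D G"
proof -
  interpret two_functor C D F by fact
  have G: "X \<in> obs C \<Longrightarrow> on0 G X = on0 F X" "f \<in> ones C \<Longrightarrow> on1 G f = on1 F f" "\<alpha> \<in> twos C \<Longrightarrow> on2 G \<alpha> = on2 F \<alpha>" for X f \<alpha>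
    using assms(2) by (auto simp: eq_on_def)
  show ?thesis by unfold_locales (auto simp: G hom_def cells_def)
qed

lemma two_equivalence_cong:
  assumes "two_equivalence C D F" "eq_on C F G" shows "two_equivalence C D G"
proof -
  have F: "two_functor C D F" using assms(1) by (simp add: two_equivalence_def)
  interpret two_functor C D F by (rule F)
  have G: "X \<in> obs C \<Longrightarrow> on0 G X = on0 F X" "f \<in> ones C \<Longrightarrow> on1 G f = on1 F f" "\<alpha> \<in> twos C \<Longrightarrow> on2 G \<alpha> = on2 F \<alpha>" for X f \<alpha>
    using assms(2) by (auto simp: eq_on_def)
  have "bij_betw (on1 G) (hom C X Y) S \<longleftrightarrow> bij_betw (on1 F) (hom C X Y) S" for X Y S
    by (rule bij_betw_cong) (simp add: hom_def G)
  moreover have "bij_betw (on2 G) {\<alpha> \<in> twos C. dm C \<alpha> \<in> hom C X Y} S \<longleftrightarrow> bij_betw (on2 F) {\<alpha> \<in> twos C. dm C \<alpha> \<in> hom C X Y} S" for X Y S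
    by (rule bij_betw_cong) (simp add: G)
  ultimately show ?thesis
    using assms(1) two_functor_cong[OF F assms(2)] by (simp add: two_equivalence_def G)
qed

lemma two_isomorphism_cong:
  assumes "two_isomorphism C D F" "eq_on C F G" shows "two_isomorphism C D G"
proof -
  have G: "X \<in> obs C \<Longrightarrow> on0 G X = on0 F X" "f \<in> ones C \<Longrightarrow> on1 G f = on1 F f" "\<alpha> \<in> twos C \<Longrightarrow> on2 G \<alpha> = on2 F \<alpha>" for X f \<alpha>
    using assms(2) by (auto simp: eq_on_def)
  show ?thesis using assms(1) two_functor_cong[OF _ assms(2)]
    unfolding two_isomorphism_def
    by (simp add: G cong: bij_betw_cong)
qed

context algebra_extension begin

definition extension where
  "extension = \<lparr>on0 = alg_of, on1 = alg_mor_of str_cell, on2 = (\<lambda>\<alpha>. AlgCell (alg_mor_of str_cell (dm L \<alpha>)) (alg_mor_of str_cell (cd L \<alpha>)) (H2 \<alpha>))\<rparr>"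

lemma extension_simps [simp]: "on0 extension = alg_of" "on1 extension = alg_mor_of str_cell"
  "on2 extension = (\<lambda>\<alpha>. AlgCell (alg_mor_of str_cell (dm L \<alpha>)) (alg_mor_of str_cell (cd L \<alpha>)) (H2 \<alpha>))"
  by (simp_all add: extension_def)

lemma alg_mor_of_id1:
  assumes "X \<in> obs L" shows "alg_mor_of str_cell (id1 L X) = alg_id1 B (alg_of X)"
  using assms structure_cellsD(2)[OF ext_cells, of "id1 L X"] by (simp add: alg_mor_of_def alg_id1_def)

lemma two_functor_extension: "two_functor L (TAlg w B M) extension"
proof -
  interpret w: two_category "TAlg w B M" by (rule two_category_TAlg)
  note D = structure_cellsD[OF ext_cells]
  show ?thesis
    by unfold_locales (auto simp: hom_def cells_def D(1,4) alg_mor_of_id1 D(3))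
qed

lemma f_functor_extension: "f_functor A (TAlg_F w B M) extension"
  using two_functor_extension f_category_TAlg_F f_category_axioms strict_alg_mor_of[OF ext_cells]
  by (simp add: f_functor_def)

lemma alg_mor_of_inj:
  "\<lbrakk>f \<in> ones L; g \<in> ones L; src L f = src L g; tgt L f = tgt L g; alg_mor_of str_cell f = alg_mor_of str_cell g\<rbrakk> \<Longrightarrow> f = g"
  by (rule ext_inj) (auto simp: alg_mor_of_def)

lemma alg_mor_of_surj:
  assumes "w_morphism w B M F" "asrc F = alg_of X" "atgt F = alg_of Y" "X \<in> obs L" "Y \<in> obs L"
  shows "\<exists>f \<in> hom L X Y. alg_mor_of str_cell f = F"
  using ext_surj[of X Y "und1 F" "struct F"] assms by (cases F) (auto simp: alg_mor_of_def hom_def)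

lemma bij_loose:
  assumes "X \<in> obs L" "Y \<in> obs L"
  shows "bij_betw (alg_mor_of str_cell) (hom L X Y) (hom (TAlg w B M) (alg_of X) (alg_of Y))"
  unfolding bij_betw_def
proof (intro conjI inj_onI set_eqI iffI)
  fix f g assume "f \<in> hom L X Y" "g \<in> hom L X Y" "alg_mor_of str_cell f = alg_mor_of str_cell g"
  thus "f = g" using alg_mor_of_inj by (auto simp: hom_def)
next
  fix F assume "F \<in> alg_mor_of str_cell ` hom L X Y"
  thus "F \<in> hom (TAlg w B M) (alg_of X) (alg_of Y)"
    using structure_cellsD(1)[OF ext_cells] by (auto simp: hom_def)
next
  fix F assume "F \<in> hom (TAlg w B M) (alg_of X) (alg_of Y)"
  thus "F \<in> alg_mor_of str_cell ` hom L X Y" using alg_mor_of_surj[of F X Y] assms by (auto simp: hom_def)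
qed

lemma cell_inj:
  assumes "\<alpha> \<in> twos L" "\<beta> \<in> twos L" "dm L \<alpha> = dm L \<beta>" "cd L \<alpha> = cd L \<beta>" "H2 \<alpha> = H2 \<beta>"
  shows "\<alpha> = \<beta>"
  using ext_faithful assms unfolding locally_faithful_def inj_on_def cells_def by blast

lemma cell_surj:
  assumes "\<Theta> \<in> twos (TAlg w B M)" "asrc (adm \<Theta>) = alg_of X" "atgt (adm \<Theta>) = alg_of Y" "X \<in> obs L" "Y \<in> obs L"
  shows "\<exists>\<alpha> \<in> twos L. dm L \<alpha> \<in> hom L X Y \<and> AlgCell (alg_mor_of str_cell (dm L \<alpha>)) (alg_mor_of str_cell (cd L \<alpha>)) (H2 \<alpha>) = \<Theta>"
proof -
  have c: "algebra_cell w (adm \<Theta>) (acd \<Theta>) (und2 \<Theta>)" using assms(1) by simp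
  note d = algebra_cellD[OF c]
  obtain f where f: "f \<in> hom L X Y" "alg_mor_of str_cell f = adm \<Theta>" using alg_mor_of_surj[OF d(1)] assms by auto
  obtain g where g: "g \<in> hom L X Y" "alg_mor_of str_cell g = acd \<Theta>" using alg_mor_of_surj[OF d(2)] assms d(3,4) by auto
  obtain \<alpha> where "\<alpha> \<in> cells L f g" "H2 \<alpha> = und2 \<Theta>"
    using ext_cell_full[of f g "und2 \<Theta>"] c f g by (auto simp: hom_def)
  thus ?thesis using f g by (intro bexI[of _ \<alpha>]) (auto simp: cells_def)
qed

lemma bij_cells:
  assumes "X \<in> obs L" "Y \<in> obs L"
  shows "bij_betw (on2 extension) {\<alpha> \<in> twos L. dm L \<alpha> \<in> hom L X Y}
     {\<beta> \<in> twos (TAlg w B M). dm (TAlg w B M) \<beta> \<in> hom (TAlg w B M) (alg_of X) (alg_of Y)}"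
  unfolding bij_betw_def
proof (intro conjI inj_onI set_eqI iffI)
  fix \<alpha> \<beta> assume a: "\<alpha> \<in> {\<alpha> \<in> twos L. dm L \<alpha> \<in> hom L X Y}" "\<beta> \<in> {\<alpha> \<in> twos L. dm L \<alpha> \<in> hom L X Y}"
    "on2 extension \<alpha> = on2 extension \<beta>"
  have "dm L \<alpha> = dm L \<beta>" by (rule alg_mor_of_inj) (use a in \<open>auto simp: hom_def\<close>)
  moreover have "cd L \<alpha> = cd L \<beta>" by (rule alg_mor_of_inj) (use a in \<open>auto simp: hom_def\<close>)
  ultimately show "\<alpha> = \<beta>" using cell_inj a by auto
next
  fix \<Theta> assume "\<Theta> \<in> on2 extension ` {\<alpha> \<in> twos L. dm L \<alpha> \<in> hom L X Y}"
  thus "\<Theta> \<in> {\<beta> \<in> twos (TAlg w B M). dm (TAlg w B M) \<beta> \<in> hom (TAlg w B M) (alg_of X) (alg_of Y)}"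
    using structure_cellsD(1,4)[OF ext_cells] by (auto simp: hom_def)
next
  fix \<Theta> assume "\<Theta> \<in> {\<beta> \<in> twos (TAlg w B M). dm (TAlg w B M) \<beta> \<in> hom (TAlg w B M) (alg_of X) (alg_of Y)}"
  thus "\<Theta> \<in> on2 extension ` {\<alpha> \<in> twos L. dm L \<alpha> \<in> hom L X Y}"
    using cell_surj[of \<Theta> X Y] assms by (force simp: hom_def)
qed

text \<open>Isomorphisms of algebras in \<open>B\<close> are strict, so they are isomorphisms for every weakness.\<close>
lemma ess_surj_extension:
  assumes "algebra B M Y" shows "\<exists>X \<in> obs L. isomorphic (TAlg w B M) (alg_of X) Y"
proof -
  obtain K k where Y: "Y = (K, k)" by (cases Y)
  note K = algebraD[OF assms[unfolded Y]]
  obtain X u v where X: "X \<in> obs L" and u: "u \<in> hom B (H0 X) K" and v: "v \<in> hom B K (H0 X)"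
    and vu: "v \<cdot> u = id1 B (H0 X)" and uv: "u \<cdot> v = id1 B K" and ua: "u \<cdot> a X = k \<cdot> T1 u"
    using ess_surj[OF assms[unfolded Y]] by blast
  have aX: "a X \<in> ones B" "src B (a X) = T0 (H0 X)" "tgt B (a X) = H0 X"
    using algebraD[OF alg[OF X]] by auto
  note [simp] = X aX K(1-4) homD[OF u] homD[OF v]
  have Tuv: "T1 u \<cdot> T1 v = id1 B (T0 K)" using T.on1_comp'[of v u] uv by simp
  \<comment> \<open>The inverse of a strict isomorphism is strict.\<close>
  have "v \<cdot> k = v \<cdot> ((k \<cdot> T1 u) \<cdot> T1 v)" by (simp add: Tuv)
  also have "\<dots> = (v \<cdot> u) \<cdot> (a X \<cdot> T1 v)" unfolding ua[symmetric] by simp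
  also have "\<dots> = a X \<cdot> T1 v" unfolding vu by simp
  finally have vk: "v \<cdot> k = a X \<cdot> T1 v" .
  define U where "U = AlgMor (alg_of X) Y u (id2 B (u \<cdot> a X))"
  define V where "V = AlgMor Y (alg_of X) v (id2 B (v \<cdot> k))"
  have sU: "strict_morphism B M U" and sV: "strict_morphism B M V"
    using assms ua vk by (auto simp: strict_morphism_sel U_def V_def Y)
  have "alg_comp1 w B M V U = alg_id1 B (alg_of X)"
    by (subst strict_alg_comp1(1)[OF sU sV]) (simp_all add: U_def V_def vu alg_id1_def)
  moreover have "alg_comp1 w B M U V = alg_id1 B Y"
    by (subst strict_alg_comp1(1)[OF sV sU]) (simp_all add: U_def V_def uv alg_id1_def Y)
  ultimately have "isomorphic (TAlg w B M) (alg_of X) Y"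
    unfolding isomorphic_def using strict_w_morphism[OF sU] strict_w_morphism[OF sV]
    by (intro bexI[of _ U] bexI[of _ V]) (simp_all add: hom_def, simp_all add: U_def V_def)
  thus ?thesis using X by blast
qed

lemma two_equivalence_extension: "two_equivalence L (TAlg w B M) extension"
  using two_functor_extension ess_surj_extension bij_loose bij_cells
  by (simp add: two_equivalence_def)

lemma two_isomorphism_extension:
  assumes "bij_betw alg_of (obs L) {X. algebra B M X}"
  shows "two_isomorphism L (TAlg w B M) extension"
proof -
  have inj: "X = Y" if "alg_of X = alg_of Y" "X \<in> obs L" "Y \<in> obs L" for X Y
    using assms that by (auto simp: bij_betw_def inj_on_def)
  have surj: "\<exists>X \<in> obs L. alg_of X = Z" if "algebra B M Z" for Z
    using assms that unfolding bij_betw_def by (metis imageE mem_Collect_eq)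
  have par: "src L f = src L g \<and> tgt L f = tgt L g" if "alg_mor_of str_cell f = alg_mor_of str_cell g" "f \<in> ones L" "g \<in> ones L" for f g
    using inj[of "src L f" "src L g"] inj[of "tgt L f" "tgt L g"] that by (auto simp: alg_mor_of_def)
  have b1: "bij_betw (on1 extension) (ones L) (ones (TAlg w B M))"
    unfolding bij_betw_def
  proof (intro conjI inj_onI set_eqI iffI)
    fix f g assume "f \<in> ones L" "g \<in> ones L" "on1 extension f = on1 extension g"
    thus "f = g" using alg_mor_of_inj[of f g] par[of f g] by simp
  next
    fix F assume "F \<in> on1 extension ` ones L"
    thus "F \<in> ones (TAlg w B M)" using structure_cellsD(1)[OF ext_cells] by auto
  next
    fix F assume F: "F \<in> ones (TAlg w B M)"
    hence wF: "w_morphism w B M F" by simp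
    obtain X Y where "X \<in> obs L" "Y \<in> obs L" "asrc F = alg_of X" "atgt F = alg_of Y"
      using surj w_morphism_typing(1,2)[OF wF] by metis
    thus "F \<in> on1 extension ` ones L" using alg_mor_of_surj[OF wF] by (force simp: hom_def)
  qed
  have b2: "bij_betw (on2 extension) (twos L) (twos (TAlg w B M))"
    unfolding bij_betw_def
  proof (intro conjI inj_onI set_eqI iffI)
    fix \<alpha> \<beta> assume a: "\<alpha> \<in> twos L" "\<beta> \<in> twos L" "on2 extension \<alpha> = on2 extension \<beta>"
    have "dm L \<alpha> = dm L \<beta>" using alg_mor_of_inj[of "dm L \<alpha>" "dm L \<beta>"] par[of "dm L \<alpha>" "dm L \<beta>"] a by simp
    moreover have "cd L \<alpha> = cd L \<beta>" using alg_mor_of_inj[of "cd L \<alpha>" "cd L \<beta>"] par[of "cd L \<alpha>" "cd L \<beta>"] a by simp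
    ultimately show "\<alpha> = \<beta>" using cell_inj a by auto
  next
    fix \<Theta> assume "\<Theta> \<in> on2 extension ` twos L"
    thus "\<Theta> \<in> twos (TAlg w B M)" using structure_cellsD(4)[OF ext_cells] by auto
  next
    fix \<Theta> assume t: "\<Theta> \<in> twos (TAlg w B M)"
    hence wF: "w_morphism w B M (adm \<Theta>)" by (auto dest: algebra_cellD)
    obtain X Y where "X \<in> obs L" "Y \<in> obs L" "asrc (adm \<Theta>) = alg_of X" "atgt (adm \<Theta>) = alg_of Y"
      using surj w_morphism_typing(1,2)[OF wF] by metis
    thus "\<Theta> \<in> on2 extension ` twos L" using cell_surj[OF t] by force
  qed
  show ?thesis using two_functor_extension b1 b2 assms by (simp add: two_isomorphism_def)
qed

lemma extension_unique:
  assumes E': "f_functor A (TAlg_F w B M) E'"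
    and tight: "\<And>f. tight A f \<Longrightarrow> struct (on1 E' f) = id2 B (H1 f \<cdot> a (src L f))"
    and ob: "\<And>X. X \<in> obs L \<Longrightarrow> on0 E' X = alg_of X"
    and H': "eq_on L (forget \<circ>\<^sub>2 E') H"
  shows "eq_on L E' extension"
proof -
  interpret E': two_functor L "TAlg w B M" E' using E' by (simp add: f_functor_def)
  define s where "s f = struct (on1 E' f)" for f
  have H1: "f \<in> ones L \<Longrightarrow> und1 (on1 E' f) = H1 f" and H2: "\<alpha> \<in> twos L \<Longrightarrow> und2 (on2 E' \<alpha>) = H2 \<alpha>" for f \<alpha>
    using H' by (auto simp: eq_on_def comp_map2_def forget_def)
  have 1: "on1 E' f = alg_mor_of s f" if "f \<in> ones L" for f
    using E'.on1_one[OF that] H1[OF that] that ob[of "src L f"] ob[of "tgt L f"]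
    by (simp add: alg_mor_of_def s_def alg_mor.expand)
  have 2: "on2 E' \<alpha> = AlgCell (alg_mor_of s (dm L \<alpha>)) (alg_mor_of s (cd L \<alpha>)) (H2 \<alpha>)" if "\<alpha> \<in> twos L" for \<alpha>
    using E'.on2_two[OF that] H2[OF that] that 1 by (simp add: alg_cell.expand)
  have "structure_cells w s" unfolding structure_cells_def
  proof (intro conjI ballI allI impI)
    fix f assume "f \<in> ones L" thus "w_morphism w B M (alg_mor_of s f)" using E'.on1_one(1)[of f] 1 by simp
  next
    fix f assume "tight A f" thus "s f = id2 B (H1 f \<cdot> a (src L f))" using tight by (simp add: s_def)
  next
    fix f g assume fg: "f \<in> ones L" "g \<in> ones L" "tgt L f = src L g"
    thus "alg_mor_of s (g \<cdot>\<^bsub>L\<^esub> f) = alg_comp1 w B M (alg_mor_of s g) (alg_mor_of s f)"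
      using E'.on1_comp'[OF fg] 1[OF fg(1)] 1[OF fg(2)] 1[of "g \<cdot>\<^bsub>L\<^esub> f"] by simp
  next
    fix \<alpha> assume "\<alpha> \<in> twos L"
    thus "algebra_cell w (alg_mor_of s (dm L \<alpha>)) (alg_mor_of s (cd L \<alpha>)) (H2 \<alpha>)" using E'.on2_two(1)[of \<alpha>] 2 by simp
  qed
  hence "s f = str_cell f" if "f \<in> ones L" for f using ext_unique that by blast
  hence "alg_mor_of s f = alg_mor_of str_cell f" if "f \<in> ones L" for f using that by (simp add: alg_mor_of_def)
  thus ?thesis using 1 2 ob by (simp add: eq_on_def)
qed

end

section \<open>Doctrinal adjunction implies doctrinality\<close>
lemma (in two_category) adjunction_co: "adjunction (co C) \<epsilon> f g \<eta> \<longleftrightarrow> adjunction C \<eta> g f \<epsilon>"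
  by (auto simp: adjunction_def hom_def)

lemma ex1_triple_eq: "\<lbrakk>\<exists>!(x, y, z). P x y z; P x y z; P x' y' z'\<rbrakk> \<Longrightarrow> x = x' \<and> y = y' \<and> z = z'"
  by auto

text \<open>
  A lifted reflection has counit over an identity, which is an identity since \<open>H\<close> reflects them.  For
  a tight square between reflections, the 2-cell \<open>\<eta>2 \<lhd> (r \<cdot> g1)\<close> from \<open>r \<cdot> g1\<close> to \<open>g2 \<cdot> s\<close> is the mate
  of the square; if the square becomes a morphism of reflections under \<open>H\<close>, then \<open>H\<close> sends this mate to
  an identity, so \<open>g2 \<cdot> s = r \<cdot> g1\<close>, and local faithfulness gives the equation of units.
\<close>
lemma doctrinal_adjunction_imp_doctrinal:
  fixes A :: "('o, 'm, 'c, 'n, 'd) f_cat" and B :: "('o', 'm', 'c', 'n', 'd') f_cat"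
  assumes fH: "f_functor A B H"
    and ex: "\<And>f g \<epsilon> \<eta>. \<lbrakk>tight A f; adjunction (lam B) \<epsilon> (on1 H f) g \<eta>;
        ps \<Longrightarrow> invertible (lam B) \<epsilon> \<and> invertible (lam B) \<eta>\<rbrakk>
      \<Longrightarrow> \<exists>\<epsilon>' g' \<eta>'. adjunction (lam A) \<epsilon>' f g' \<eta>' \<and> (ps \<longrightarrow> invertible (lam A) \<epsilon>' \<and> invertible (lam A) \<eta>')
          \<and> on2 H \<epsilon>' = \<epsilon> \<and> on1 H g' = g \<and> on2 H \<eta>' = \<eta>"
    and uniq: "\<And>f g \<epsilon> \<eta> \<epsilon>1 g1 \<eta>1 \<epsilon>2 g2 \<eta>2. \<lbrakk>tight A f; adjunction (lam B) \<epsilon> (on1 H f) g \<eta>;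
        ps \<Longrightarrow> invertible (lam B) \<epsilon> \<and> invertible (lam B) \<eta>;
        adjunction (lam A) \<epsilon>1 f g1 \<eta>1; ps \<Longrightarrow> invertible (lam A) \<epsilon>1 \<and> invertible (lam A) \<eta>1;
        on2 H \<epsilon>1 = \<epsilon>; on1 H g1 = g; on2 H \<eta>1 = \<eta>;
        adjunction (lam A) \<epsilon>2 f g2 \<eta>2; ps \<Longrightarrow> invertible (lam A) \<epsilon>2 \<and> invertible (lam A) \<eta>2;
        on2 H \<epsilon>2 = \<epsilon>; on1 H g2 = g; on2 H \<eta>2 = \<eta>\<rbrakk> \<Longrightarrow> g1 = g2 \<and> \<eta>1 = \<eta>2"
    and lf: "locally_faithful A H" and ri: "reflects_identities A B H"
  shows "lifts_reflections ps A B H \<and> detects_reflection_morphisms ps A B H"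
proof -
  interpret A: f_category A using fH by (simp add: f_functor_def)
  interpret B: f_category B using fH by (simp add: f_functor_def)
  interpret H: two_functor "lam A" "lam B" H using fH by (simp add: f_functor_def)
  have tB: "tight A f \<Longrightarrow> tight B (on1 H f)" for f using fH by (simp add: f_functor_def)
  have "lifts_reflections ps A B H" unfolding lifts_reflections_def
  proof (intro allI impI, elim conjE)
    fix f g \<eta> assume f: "tight A f" and R: "reflection ps B (on1 H f) g \<eta>"
    define \<epsilon> where "\<epsilon> = id2 (lam B) (id1 (lam B) (tgt (lam B) (on1 H f)))"
    have [simp]: "f \<in> ones (lam A)" using f by simp
    have [simp]: "on0 H (tgt (lam A) f) \<in> obs (lam B)" by simp
    have adj: "adjunction (lam B) \<epsilon> (on1 H f) g \<eta>" and inv: "ps \<Longrightarrow> invertible (lam B) \<epsilon> \<and> invertible (lam B) \<eta>"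
      using R by (auto simp: reflection_def \<epsilon>_def)
    obtain \<epsilon>' g' \<eta>' where ad: "adjunction (lam A) \<epsilon>' f g' \<eta>'" and inv': "ps \<longrightarrow> invertible (lam A) \<eta>'"
      and e: "on2 H \<epsilon>' = \<epsilon>" "on1 H g' = g" "on2 H \<eta>' = \<eta>" using ex[OF f adj inv] by blast
    have c: "\<epsilon>' \<in> twos (lam A)" "cd (lam A) \<epsilon>' = id1 (lam A) (tgt (lam A) f)"
      using ad by (auto simp: adjunction_def cells_def)
    have "is_identity (lam B) (on2 H \<epsilon>')" unfolding e by (auto simp: \<epsilon>_def is_identity_def)
    hence "is_identity (lam A) \<epsilon>'" using ri c by (simp add: reflects_identities_def)
    then obtain h where "h \<in> ones (lam A)" "\<epsilon>' = id2 (lam A) h" by (auto simp: is_identity_def)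
    hence "\<epsilon>' = id2 (lam A) (id1 (lam A) (tgt (lam A) f))" using c by simp
    hence ref: "reflection ps A f g' \<eta>'" using ad f inv' by (simp add: reflection_def)
    show "\<exists>!(g', \<eta>'). reflection ps A f g' \<eta>' \<and> on1 H g' = g \<and> on2 H \<eta>' = \<eta>"
    proof (rule ex1I[of _ "(g', \<eta>')"])
      show "case (g', \<eta>') of (g', \<eta>') \<Rightarrow> reflection ps A f g' \<eta>' \<and> on1 H g' = g \<and> on2 H \<eta>' = \<eta>"
        using ref e by simp
    next
      fix z assume z: "case z of (g', \<eta>') \<Rightarrow> reflection ps A f g' \<eta>' \<and> on1 H g' = g \<and> on2 H \<eta>' = \<eta>"
      have id: "on2 H (id2 (lam A) (id1 (lam A) (tgt (lam A) f))) = \<epsilon>" by (simp add: \<epsilon>_def)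
      have "fst z = g' \<and> snd z = \<eta>'"
        by (rule uniq[OF f adj inv, of "id2 (lam A) (id1 (lam A) (tgt (lam A) f))" _ _ "id2 (lam A) (id1 (lam A) (tgt (lam A) f))"])
          (use z ref e id in \<open>auto simp: reflection_def\<close>)
      thus "z = (g', \<eta>')" by (simp add: prod_eq_iff)
    qed
  qed
  moreover have "detects_reflection_morphisms ps A B H" unfolding detects_reflection_morphisms_def
  proof (intro allI impI, elim conjE)
    fix f1 g1 \<eta>1 f2 g2 \<eta>2 r s
    assume R1: "reflection ps A f1 g1 \<eta>1" and R2: "reflection ps A f2 g2 \<eta>2" and sq: "tight_square A f1 f2 r s"
    note R1' = R1[unfolded A.reflection_iff] and R2' = R2[unfolded A.reflection_iff]
    have f1: "tight A f1" "g1 \<in> ones (lam A)" "src (lam A) g1 = tgt (lam A) f1" "tgt (lam A) g1 = src (lam A) f1"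
      "\<eta>1 \<in> twos (lam A)" "dm (lam A) \<eta>1 = id1 (lam A) (src (lam A) f1)" "cd (lam A) \<eta>1 = g1 \<cdot>\<^bsub>lam A\<^esub> f1"
      "f1 \<cdot>\<^bsub>lam A\<^esub> g1 = id1 (lam A) (tgt (lam A) f1)" "\<eta>1 \<lhd>\<^bsub>lam A\<^esub> g1 = id2 (lam A) g1"
      using R1' by auto
    have f2: "tight A f2" "g2 \<in> ones (lam A)" "src (lam A) g2 = tgt (lam A) f2" "tgt (lam A) g2 = src (lam A) f2"
      "\<eta>2 \<in> twos (lam A)" "dm (lam A) \<eta>2 = id1 (lam A) (src (lam A) f2)" "cd (lam A) \<eta>2 = g2 \<cdot>\<^bsub>lam A\<^esub> f2"
      using R2' by auto
    have rs: "tight A r" "tight A s" "src (lam A) r = src (lam A) f1" "tgt (lam A) r = src (lam A) f2"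
      "src (lam A) s = tgt (lam A) f1" "tgt (lam A) s = tgt (lam A) f2" and fr: "f2 \<cdot>\<^bsub>lam A\<^esub> r = s \<cdot>\<^bsub>lam A\<^esub> f1"
      using sq by (auto simp: tight_square_def hom_def)
    note [simp] = f1 f2 rs fr A.incl.T.comp1_square[OF fr] A.incl.T.comp1_reduce[OF f1(8)]
    show "reflection_morphism A g1 \<eta>1 g2 \<eta>2 r s
      \<longleftrightarrow> reflection_morphism B (on1 H g1) (on2 H \<eta>1) (on1 H g2) (on2 H \<eta>2) (on1 H r) (on1 H s)"
    proof
      assume "reflection_morphism A g1 \<eta>1 g2 \<eta>2 r s"
      hence "on1 H (g2 \<cdot>\<^bsub>lam A\<^esub> s) = on1 H (r \<cdot>\<^bsub>lam A\<^esub> g1)" "on2 H (r \<rhd>\<^bsub>lam A\<^esub> \<eta>1) = on2 H (\<eta>2 \<lhd>\<^bsub>lam A\<^esub> r)"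
        by (simp_all only: reflection_morphism_def)
      thus "reflection_morphism B (on1 H g1) (on2 H \<eta>1) (on1 H g2) (on2 H \<eta>2) (on1 H r) (on1 H s)"
        by (simp add: reflection_morphism_def)
    next
      assume RB: "reflection_morphism B (on1 H g1) (on2 H \<eta>1) (on1 H g2) (on2 H \<eta>2) (on1 H r) (on1 H s)"
      \<comment> \<open>The mate of the square; its codomain is \<open>g2 \<cdot> f2 \<cdot> r \<cdot> g1 = g2 \<cdot> s \<cdot> f1 \<cdot> g1 = g2 \<cdot> s\<close>.\<close>
      define m where "m = \<eta>2 \<lhd>\<^bsub>lam A\<^esub> (r \<cdot>\<^bsub>lam A\<^esub> g1)"
      have m: "m \<in> twos (lam A)" "dm (lam A) m = r \<cdot>\<^bsub>lam A\<^esub> g1" "cd (lam A) m = g2 \<cdot>\<^bsub>lam A\<^esub> s"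
        by (simp_all add: m_def)
      have "on2 H m = (on2 H \<eta>2 \<lhd>\<^bsub>lam B\<^esub> on1 H r) \<lhd>\<^bsub>lam B\<^esub> on1 H g1" by (simp add: m_def)
      also have "\<dots> = (on1 H r \<rhd>\<^bsub>lam B\<^esub> on2 H \<eta>1) \<lhd>\<^bsub>lam B\<^esub> on1 H g1"
        using RB by (simp only: reflection_morphism_def)
      also have "\<dots> = on2 H (r \<rhd>\<^bsub>lam A\<^esub> (\<eta>1 \<lhd>\<^bsub>lam A\<^esub> g1))" by (simp del: f1(9))
      also have "\<dots> = id2 (lam B) (on1 H (r \<cdot>\<^bsub>lam A\<^esub> g1))" unfolding f1(9) by simp
      finally have "is_identity (lam B) (on2 H m)" by (auto simp: is_identity_def)
      hence "is_identity (lam A) m" using ri m by (simp add: reflects_identities_def)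
      then obtain h where "h \<in> ones (lam A)" "m = id2 (lam A) h" by (auto simp: is_identity_def)
      hence gs: "g2 \<cdot>\<^bsub>lam A\<^esub> s = r \<cdot>\<^bsub>lam A\<^esub> g1" using m by simp
      have "r \<rhd>\<^bsub>lam A\<^esub> \<eta>1 \<in> cells (lam A) r (r \<cdot>\<^bsub>lam A\<^esub> (g1 \<cdot>\<^bsub>lam A\<^esub> f1))" by (simp add: cells_def)
      moreover have "\<eta>2 \<lhd>\<^bsub>lam A\<^esub> r \<in> cells (lam A) r (r \<cdot>\<^bsub>lam A\<^esub> (g1 \<cdot>\<^bsub>lam A\<^esub> f1))"
        using A.incl.T.comp1_square(1)[OF gs, of f1] by (simp add: cells_def)
      moreover have "on2 H (r \<rhd>\<^bsub>lam A\<^esub> \<eta>1) = on2 H (\<eta>2 \<lhd>\<^bsub>lam A\<^esub> r)"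
        using RB by (simp add: reflection_morphism_def)
      ultimately have "r \<rhd>\<^bsub>lam A\<^esub> \<eta>1 = \<eta>2 \<lhd>\<^bsub>lam A\<^esub> r"
        using lf unfolding locally_faithful_def inj_on_def by blast
      thus "reflection_morphism A g1 \<eta>1 g2 \<eta>2 r s" using gs by (simp add: reflection_morphism_def)
    qed
  qed
  ultimately show ?thesis ..
qed

lemma f_functor_co:
  assumes "f_functor A B H" shows "f_functor (f_co A) (f_co B) H"
  using assms by (simp add: f_functor_def f_category_co two_functor_co)

theorem w_doctrinal_if_doctrinal_adjunction:
  assumes fH: "f_functor A B H" and da: "w_doctrinal_adjunction w A B H"
    and lf: "locally_faithful A H" and ri: "reflects_identities A B H"
  shows "w_doctrinal w A B H"
proof (cases w)
  case Lax
  note d = da[unfolded w_doctrinal_adjunction_def Lax weakness.case, rule_format, OF conjI]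
  have "lifts_reflections False A B H \<and> detects_reflection_morphisms False A B H"
  proof (rule doctrinal_adjunction_imp_doctrinal[OF fH _ _ lf ri], goal_cases)
    case (1 f g \<epsilon> \<eta>) thus ?case using ex1_implies_ex[OF d[of f \<epsilon> g \<eta>]] by auto
  next
    case (2 f g \<epsilon> \<eta> \<epsilon>1 g1 \<eta>1 \<epsilon>2 g2 \<eta>2)
    show ?case using ex1_triple_eq[OF d[OF 2(1,2)], of \<epsilon>1 g1 \<eta>1 \<epsilon>2 g2 \<eta>2] 2 by simp
  qed
  thus ?thesis using lf by (simp add: w_doctrinal_def w_Refl_def w_Morph_def Lax)
next
  case Pseudo
  note d = da[unfolded w_doctrinal_adjunction_def Pseudo weakness.case adjoint_equivalence_def, rule_format, OF conjI]
  have "lifts_reflections True A B H \<and> detects_reflection_morphisms True A B H"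
  proof (rule doctrinal_adjunction_imp_doctrinal[OF fH _ _ lf ri], goal_cases)
    case (1 f g \<epsilon> \<eta>) thus ?case using ex1_implies_ex[OF d[of f \<epsilon> g \<eta>]] by auto
  next
    case (2 f g \<epsilon> \<eta> \<epsilon>1 g1 \<eta>1 \<epsilon>2 g2 \<eta>2)
    from d[of f \<epsilon> g \<eta>] 2 have "\<exists>!(\<epsilon>', g', \<eta>'). (adjunction (lam A) \<epsilon>' f g' \<eta>' \<and> invertible (lam A) \<epsilon>' \<and> invertible (lam A) \<eta>')
       \<and> on2 H \<epsilon>' = \<epsilon> \<and> on1 H g' = g \<and> on2 H \<eta>' = \<eta>" by simp
    from ex1_triple_eq[OF this, of \<epsilon>1 g1 \<eta>1 \<epsilon>2 g2 \<eta>2] 2 show ?case by simp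
  qed
  thus ?thesis using lf by (simp add: w_doctrinal_def w_Refl_def w_Morph_def Pseudo)
next
  case Colax
  interpret A: f_category A using fH by (simp add: f_functor_def)
  interpret B: f_category B using fH by (simp add: f_functor_def)
  note d = da[unfolded w_doctrinal_adjunction_def Colax weakness.case, rule_format, OF conjI]
  have lf': "locally_faithful (f_co A) H" using lf by (auto simp: locally_faithful_def)
  have ri': "reflects_identities (f_co A) (f_co B) H" using ri by (simp add: reflects_identities_def)
  note co = A.incl.T.adjunction_co B.incl.T.adjunction_co
  have "lifts_reflections False (f_co A) (f_co B) H \<and> detects_reflection_morphisms False (f_co A) (f_co B) H"
  proof (rule doctrinal_adjunction_imp_doctrinal[OF f_functor_co[OF fH] _ _ lf' ri'], goal_cases)
    case (1 f g \<epsilon> \<eta>) thus ?case using ex1_implies_ex[OF d[of f \<eta> g \<epsilon>]] by (auto simp: co)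
  next
    case (2 f g \<epsilon> \<eta> \<epsilon>1 g1 \<eta>1 \<epsilon>2 g2 \<eta>2)
    show ?case using ex1_triple_eq[OF d[of f \<eta> g \<epsilon>], of \<eta>1 g1 \<epsilon>1 \<eta>2 g2 \<epsilon>2] 2 by (simp add: co)
  qed
  thus ?thesis using lf by (simp add: w_doctrinal_def w_Refl_def w_Morph_def Colax)
qed

section \<open>Monadicity\<close>
lemma inv_into_id: "x \<in> S \<Longrightarrow> inv_into S (\<lambda>x. x) x = x"
  using inv_into_f_f[of "\<lambda>x. x" S x] by simp

lemma tight_part_chordate:
  assumes "f_functor A (chordate B) H"
  shows "on0 (tight_part A (chordate B) H) = on0 H"
    "f \<in> ones (tau A) \<Longrightarrow> on1 (tight_part A (chordate B) H) f = on1 H (on1 (incl A) f)"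
    "\<alpha> \<in> twos (tau A) \<Longrightarrow> on2 (tight_part A (chordate B) H) \<alpha> = on2 H (on2 (incl A) \<alpha>)"
proof -
  interpret f_category A using assms by (simp add: f_functor_def)
  interpret H: two_functor "lam A" B H using assms by (simp add: f_functor_def)
  show "on0 (tight_part A (chordate B) H) = on0 H"
    "f \<in> ones (tau A) \<Longrightarrow> on1 (tight_part A (chordate B) H) f = on1 H (on1 (incl A) f)"
    "\<alpha> \<in> twos (tau A) \<Longrightarrow> on2 (tight_part A (chordate B) H) \<alpha> = on2 H (on2 (incl A) \<alpha>)"
    by (simp_all add: tight_part_def id_map2_def inv_into_id)
qed

context f_category begin

lemma tightE:
  assumes "tight A f"
  obtains f' where "f' \<in> ones (tau A)" "f = on1 (incl A) f'" "src (tau A) f' = src L f" "tgt (tau A) f' = tgt L f"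
  using assms by (auto simp: tight_def incl_ob)

lemma tight_cellE:
  assumes "\<alpha> \<in> twos L" "tight A (dm L \<alpha>)" "tight A (cd L \<alpha>)"
  obtains \<alpha>' where "\<alpha>' \<in> twos (tau A)" "\<alpha> = on2 (incl A) \<alpha>'"
proof -
  obtain f where f: "f \<in> ones (tau A)" "dm L \<alpha> = on1 (incl A) f" "src (tau A) f = src L (dm L \<alpha>)"
    "tgt (tau A) f = tgt L (dm L \<alpha>)" using tightE[OF assms(2)] by metis
  obtain g where g: "g \<in> ones (tau A)" "cd L \<alpha> = on1 (incl A) g" "src (tau A) g = src L (cd L \<alpha>)"
    "tgt (tau A) g = tgt L (cd L \<alpha>)" using tightE[OF assms(3)] by metis
  have "bij_betw (on2 (incl A)) (cells (tau A) f g) (cells L (on1 (incl A) f) (on1 (incl A) g))"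
    by (rule incl_locally_ff[of _ "src (tau A) f" "tgt (tau A) f"])
      (use f g assms incl.T.src_cd[OF assms(1)] incl.T.tgt_cd[OF assms(1)] in \<open>auto simp: hom_def\<close>)
  moreover have "\<alpha> \<in> cells L (on1 (incl A) f) (on1 (incl A) g)" using f g assms by (simp add: cells_def)
  ultimately obtain \<alpha>' where "\<alpha>' \<in> cells (tau A) f g" "\<alpha> = on2 (incl A) \<alpha>'" by (auto simp: bij_betw_def)
  thus ?thesis using that by (auto simp: cells_def)
qed

end

text \<open>
  Strict algebra morphisms and their 2-cells are determined by their boundary and their underlying
  cells, so the bijections on homs given by monadicity can be read as statements about \<open>B\<close>.
\<close>
lemma strict_comparison_if_monadic:
  fixes A :: "('a, 'm, 'c, 'n, 'd) f_cat"
  assumes fH: "f_functor A (chordate B) H"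
    and U: "U = tight_part A (chordate B) H"
    and mon: "monadic (tau A) B U F \<eta> \<epsilon>"
  shows "strict_comparison A B (induced_monad U F \<eta> \<epsilon>) H (\<lambda>X. on1 U (\<epsilon> X))"
proof -
  interpret f_category A using fH by (simp add: f_functor_def)
  interpret H: two_functor "lam A" B H using fH by (simp add: f_functor_def)
  define M where "M = induced_monad U F \<eta> \<epsilon>"
  define E where "E = comparison (tau A) B U \<epsilon>"
  have M: "two_monad B M" using mon two_monad_induced unfolding monadic_def M_def by blast
  interpret monad_on B M by unfold_locales (rule M)
  have eq: "two_equivalence (tau A) (TAlg_s B M) E" using mon by (simp add: monadic_def M_def E_def)
  interpret E: two_functor "tau A" "TAlg_s B M" E using eq by (simp add: two_equivalence_def)
  note U_simps = tight_part_chordate[OF fH, folded U]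
  define a where "a X = on1 U (\<epsilon> X)" for X
  have E0: "on0 E X = (on0 H X, a X)" for X by (simp add: E_def comparison_def a_def U_simps)
  have E1: "on1 E f = AlgMor (on0 E (src (tau A) f)) (on0 E (tgt (tau A) f)) (on1 H (on1 (incl A) f))
     (id2 B (on1 H (on1 (incl A) f) \<cdot>\<^bsub>B\<^esub> a (src (tau A) f)))" if "f \<in> ones (tau A)" for f
    using that by (simp add: E_def comparison_def a_def U_simps)
  have E2: "on2 E \<alpha> = AlgCell (on1 E (dm (tau A) \<alpha>)) (on1 E (cd (tau A) \<alpha>)) (on2 H (on2 (incl A) \<alpha>))"
    if "\<alpha> \<in> twos (tau A)" for \<alpha>
    using that by (simp add: E_def comparison_def U_simps Let_def)
  have ess: "\<exists>X \<in> obs (tau A). isomorphic (TAlg_s B M) (on0 E X) Y" if "algebra B M Y" for Y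
  proof -
    have "\<forall>Y \<in> obs (TAlg_s B M). \<exists>X \<in> obs (tau A). isomorphic (TAlg_s B M) (on0 E X) Y"
      using eq unfolding two_equivalence_def by blast
    thus ?thesis by (rule bspec) (use that in simp)
  qed
  have b1: "bij_betw (on1 E) (hom (tau A) X Y) (hom (TAlg_s B M) (on0 E X) (on0 E Y))"
    and b2: "bij_betw (on2 E) {\<alpha> \<in> twos (tau A). dm (tau A) \<alpha> \<in> hom (tau A) X Y}
            {\<beta> \<in> twos (TAlg_s B M). dm (TAlg_s B M) \<beta> \<in> hom (TAlg_s B M) (on0 E X) (on0 E Y)}"
    if "X \<in> obs (tau A)" "Y \<in> obs (tau A)" for X Y
    using eq that by (auto simp: two_equivalence_def)
  have alg: "algebra B M (on0 H X, a X)" if "X \<in> obs (lam A)" for X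
    using E.on0_ob[of X] that by (simp add: E0 obs_eq)
  have strict: "on1 H f \<cdot>\<^bsub>B\<^esub> a (src (lam A) f) = a (tgt (lam A) f) \<cdot>\<^bsub>B\<^esub> on1 (endo M) (on1 H f)" if f: "tight A f" for f
  proof -
    obtain f' where "f' \<in> ones (tau A)" "f = on1 (incl A) f'" "src (tau A) f' = src (lam A) f" "tgt (tau A) f' = tgt (lam A) f"
      using tightE[OF f] .
    thus ?thesis using E.on1_one(1)[of f'] by (simp add: strict_morphism_sel E1 E0)
  qed
  have E_inj: "f' = g'" if "f' \<in> ones (tau A)" "g' \<in> ones (tau A)" "src (tau A) f' = src (tau A) g'"
    "tgt (tau A) f' = tgt (tau A) g'" "on1 E f' = on1 E g'" for f' g'
    using b1[of "src (tau A) f'" "tgt (tau A) f'"] that by (auto simp: bij_betw_def inj_on_def hom_def)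
  have "strict_comparison A B M H a"
  proof (intro strict_comparison.intro strict_comparison_axioms.intro f_category_axioms monad_on_axioms, goal_cases)
    case 1 show ?case by (rule H.two_functor_axioms)
  next
    case (2 X) thus ?case by (rule alg)
  next
    case (3 f) thus ?case by (rule strict)
  next
    case (4 \<alpha>)
    obtain \<alpha>' where a': "\<alpha>' \<in> twos (tau A)" "\<alpha> = on2 (incl A) \<alpha>'" using tight_cellE[OF 4] .
    have "algebra_cell Lax (on1 E (dm (tau A) \<alpha>')) (on1 E (cd (tau A) \<alpha>')) (on2 H \<alpha>)"
      "strict_morphism B M (on1 E (dm (tau A) \<alpha>'))" "strict_morphism B M (on1 E (cd (tau A) \<alpha>'))"
      using E.on2_two(1)[OF a'(1)] E2[OF a'(1)] a' by auto
    thus ?case using a' by (simp add: algebra_cell_strict E1 E0 incl_ob)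
  next
    case (5 X Y h)
    have o: "X \<in> obs (tau A)" "Y \<in> obs (tau A)" using 5 obs_eq by auto
    have "AlgMor (on0 E X) (on0 E Y) h (id2 B (h \<cdot>\<^bsub>B\<^esub> a X)) \<in> hom (TAlg_s B M) (on0 E X) (on0 E Y)"
      using 5 alg by (simp add: hom_def strict_morphism_sel E0)
    hence "AlgMor (on0 E X) (on0 E Y) h (id2 B (h \<cdot>\<^bsub>B\<^esub> a X)) \<in> on1 E ` hom (tau A) X Y"
      by (simp only: bij_betw_imp_surj_on[OF b1[OF o]])
    then obtain f where f: "f \<in> hom (tau A) X Y" "on1 E f = AlgMor (on0 E X) (on0 E Y) h (id2 B (h \<cdot>\<^bsub>B\<^esub> a X))"
      by (elim imageE) simp
    hence "on1 H (on1 (incl A) f) = h" using E1[of f] by (simp add: hom_def)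
    thus ?case using f o by (intro exI[of _ "on1 (incl A) f"]) (auto simp: hom_def tight_def incl_ob)
  next
    case (6 f g)
    obtain f' where f: "f' \<in> ones (tau A)" "f = on1 (incl A) f'" "src (tau A) f' = src (lam A) f" "tgt (tau A) f' = tgt (lam A) f"
      using tightE[OF 6(1)] .
    obtain g' where g: "g' \<in> ones (tau A)" "g = on1 (incl A) g'" "src (tau A) g' = src (lam A) g" "tgt (tau A) g' = tgt (lam A) g"
      using tightE[OF 6(2)] .
    have "f' = g'"
      by (rule E_inj) (simp_all add: f(1,3,4) g(1,3,4) f(2)[symmetric] g(2)[symmetric] E1 6(3-5))
    thus ?case using f(2) g(2) by simp
  next
    case (7 f g \<gamma>)
    obtain f' where f: "f' \<in> ones (tau A)" "f = on1 (incl A) f'" "src (tau A) f' = src (lam A) f" "tgt (tau A) f' = tgt (lam A) f"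
      using tightE[OF 7(1)] .
    obtain g' where g: "g' \<in> ones (tau A)" "g = on1 (incl A) g'" "src (tau A) g' = src (lam A) g" "tgt (tau A) g' = tgt (lam A) g"
      using tightE[OF 7(2)] .
    let ?X = "src (lam A) f" and ?Y = "tgt (lam A) f"
    have o: "?X \<in> obs (tau A)" "?Y \<in> obs (tau A)" using tight_one[OF 7(1)] obs_eq by auto
    have s: "strict_morphism B M (on1 E f')" "strict_morphism B M (on1 E g')"
      using E.on1_one(1)[OF f(1)] E.on1_one(1)[OF g(1)] by auto
    have m: "asrc (on1 E f') = on0 E ?X" "atgt (on1 E f') = on0 E ?Y" "asrc (on1 E g') = on0 E ?X" "atgt (on1 E g') = on0 E ?Y"
      "und1 (on1 E f') = on1 H f" "und1 (on1 E g') = on1 H g" by (simp_all add: f(1,3,4) g(1,3,4) f(2)[symmetric] g(2)[symmetric] E1 7(3,4))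
    have "algebra_cell Lax (on1 E f') (on1 E g') \<gamma>"
      unfolding algebra_cell_strict[OF s] using m 7(5,6) by (simp add: E0)
    hence "AlgCell (on1 E f') (on1 E g') \<gamma> \<in> {\<beta> \<in> twos (TAlg_s B M). dm (TAlg_s B M) \<beta> \<in> hom (TAlg_s B M) (on0 E ?X) (on0 E ?Y)}"
      using s m by (simp add: hom_def)
    hence "AlgCell (on1 E f') (on1 E g') \<gamma> \<in> on2 E ` {\<alpha> \<in> twos (tau A). dm (tau A) \<alpha> \<in> hom (tau A) ?X ?Y}"
      by (simp only: bij_betw_imp_surj_on[OF b2[OF o]])
    then obtain \<delta> where "AlgCell (on1 E f') (on1 E g') \<gamma> = on2 E \<delta>"
      "\<delta> \<in> {\<alpha> \<in> twos (tau A). dm (tau A) \<alpha> \<in> hom (tau A) ?X ?Y}" by (rule imageE)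
    hence d: "\<delta> \<in> twos (tau A)" "dm (tau A) \<delta> \<in> hom (tau A) ?X ?Y" "on2 E \<delta> = AlgCell (on1 E f') (on1 E g') \<gamma>"
      by simp_all
    have "dm (tau A) \<delta> = f'" "cd (tau A) \<delta> = g'"
      using E_inj[of "dm (tau A) \<delta>" f'] E_inj[of "cd (tau A) \<delta>" g'] d E2[OF d(1)] f(1,3,4) g(1,3,4) 7(3,4)
      by (simp_all add: hom_def)
    moreover have "on2 H (on2 (incl A) \<delta>) = \<gamma>" using d(3) E2[OF d(1)] by simp
    ultimately show ?case using d(1) f(2) g(2) by (intro bexI[of _ "on2 (incl A) \<delta>"]) (auto simp: cells_def)
  next
    case (8 K k)
    obtain X where X: "X \<in> obs (tau A)" "isomorphic (TAlg_s B M) (on0 E X) (K, k)" using ess[OF 8] by auto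
    then obtain u v where uv: "strict_morphism B M u" "asrc u = on0 E X" "atgt u = (K, k)"
      "strict_morphism B M v" "asrc v = (K, k)" "atgt v = on0 E X"
      "alg_comp1 Lax B M v u = alg_id1 B (on0 E X)" "alg_comp1 Lax B M u v = alg_id1 B (K, k)"
      by (auto simp: isomorphic_def hom_def)
    show ?case
    proof (intro bexI conjI)
      show "und1 v \<cdot>\<^bsub>B\<^esub> und1 u = id1 B (on0 H X)" "und1 u \<cdot>\<^bsub>B\<^esub> und1 v = id1 B K"
        using arg_cong[OF uv(7), of und1] arg_cong[OF uv(8), of und1] by (simp_all add: E0)
      show "und1 u \<cdot>\<^bsub>B\<^esub> a X = k \<cdot>\<^bsub>B\<^esub> on1 (endo M) (und1 u)" "und1 u \<in> hom B (on0 H X) K" "und1 v \<in> hom B K (on0 H X)"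
        using uv(1-6) unfolding strict_morphism_sel by (simp_all add: E0 hom_def)
      show "X \<in> obs (lam A)" using X obs_eq by simp
    qed
  qed
  thus ?thesis by (simp add: M_def a_def[abs_def])
qed

lemma algebra_extension_exists:
  assumes fH: "f_functor A (chordate B) H" and sc: "strict_comparison A B M H a"
    and lim: "admits_limits (bar w) A" and limB: "admits_limits_of_arrows (bar w) B"
    and doc: "w_doctrinal w A (chordate B) H"
  shows "\<exists>str_cell. algebra_extension A B M H a w str_cell"
proof -
  interpret strict_comparison A B M H a by (rule sc)
  have ch: "f_category (chordate B)" using fH by (simp add: f_functor_def)
  show ?thesis
  proof (cases w)
    case Lax
    interpret doctrinal A B M H a False
    proof (rule doctrinal.intro[OF sc], rule doctrinal_axioms.intro, goal_cases)
      case 1 show ?case by (rule ch)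
    next
      case 2 thus ?case using lim by (simp add: admits_limits_def w_limit_def Lax)
    next
      case 3 thus ?case using limB by (simp add: admits_limits_of_arrows_def admits_limits_def w_limit_def Lax)
    next
      case 4 show ?case using doc by (simp add: w_doctrinal_def w_Refl_def Lax)
    next
      case 5 show ?case using doc by (simp add: w_doctrinal_def w_Morph_def Lax)
    next
      case 6 show ?case using doc by (simp add: w_doctrinal_def)
    qed
    show ?thesis using algebra_extension[unfolded if_False] Lax by blast
  next
    case Pseudo
    interpret doctrinal A B M H a True
    proof (rule doctrinal.intro[OF sc], rule doctrinal_axioms.intro, goal_cases)
      case 1 show ?case by (rule ch)
    next
      case 2 thus ?case using lim by (simp add: admits_limits_def w_limit_def Pseudo)
    next
      case 3 thus ?case using limB by (simp add: admits_limits_of_arrows_def admits_limits_def w_limit_def Pseudo)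
    next
      case 4 show ?case using doc by (simp add: w_doctrinal_def w_Refl_def Pseudo)
    next
      case 5 show ?case using doc by (simp add: w_doctrinal_def w_Morph_def Pseudo)
    next
      case 6 show ?case using doc by (simp add: w_doctrinal_def)
    qed
    show ?thesis using algebra_extension[unfolded if_True] Pseudo by blast
  next
    case Colax
    interpret c: strict_comparison "f_co A" "co B" M H a by (rule strict_comparison_co)
    have "locally_faithful (f_co A) H"
      using doc by (simp add: w_doctrinal_def locally_faithful_def)
    hence lf: "locally_faithful (f_co A) H" .
    have ch': "f_category (chordate (co B))" using f_category_co[OF ch] by simp
    interpret c: doctrinal "f_co A" "co B" M H a False
    proof (rule doctrinal.intro[OF strict_comparison_co], rule doctrinal_axioms.intro, goal_cases)
      case 1 show ?case by (rule ch')
    next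
      case 2 thus ?case using lim by (simp add: admits_limits_def w_limit_def Colax)
    next
      case 3 thus ?case using limB by (simp add: admits_limits_of_arrows_def admits_limits_def w_limit_def Colax)
    next
      case 4 show ?case using doc by (simp add: w_doctrinal_def w_Refl_def Colax)
    next
      case 5 show ?case using doc by (simp add: w_doctrinal_def w_Morph_def Colax)
    next
      case 6 show ?case using lf by (simp add: w_doctrinal_def)
    qed
    show ?thesis using algebra_extension_co[OF c.algebra_extension[unfolded if_False]] Colax by blast
  qed
qed

theorem theorem25:
  fixes A :: "('a, 'm, 'c, 'n, 'd) f_cat"
    and B :: "('b, 'k, 'e) two_cat"
    and H :: "('a, 'n, 'd, 'b, 'k, 'e) map2"
    and w :: weakness
    and H\<^sub>\<tau> :: "('a, 'm, 'c, 'b, 'k, 'e) map2"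
    and L :: "('b, 'k, 'e, 'a, 'm, 'c) map2"
    and \<eta> :: "'b \<Rightarrow> 'k" and \<epsilon> :: "'a \<Rightarrow> 'm"
    and T :: "('b, 'k, 'e) monad2"
    and E :: "('a, 'm, 'c, 'b \<times> 'k, ('b, 'k, 'e) alg_mor, ('b, 'k, 'e) alg_cell) map2"
  assumes "f_functor A (chordate B) H"
  defines "H\<^sub>\<tau> \<equiv> tight_part A (chordate B) H"
    and "T \<equiv> induced_monad H\<^sub>\<tau> L \<eta> \<epsilon>"
    and "E \<equiv> comparison (tau A) B H\<^sub>\<tau> \<epsilon>"
  shows
    "(w_doctrinal_adjunction w A (chordate B) H \<and> locally_faithful A H
        \<and> reflects_identities A (chordate B) H
      \<longrightarrow> w_doctrinal w A (chordate B) H)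
   \<and> (monadic (tau A) B H\<^sub>\<tau> L \<eta> \<epsilon>
        \<and> admits_limits (bar w) A
        \<and> admits_limits_of_arrows (bar w) B
        \<and> w_doctrinal w A (chordate B) H
      \<longrightarrow> (\<exists>E\<^sub>w. f_equivalence A (TAlg_F w B T) E\<^sub>w
            \<and> eq_on (tau A) (E\<^sub>w \<circ>\<^sub>2 incl A) (incl (TAlg_F w B T) \<circ>\<^sub>2 E)
            \<and> eq_on (lam A) (forget \<circ>\<^sub>2 E\<^sub>w) H
            \<and> (\<forall>E'. f_functor A (TAlg_F w B T) E'
                 \<and> eq_on (tau A) (E' \<circ>\<^sub>2 incl A) (incl (TAlg_F w B T) \<circ>\<^sub>2 E)
                 \<and> eq_on (lam A) (forget \<circ>\<^sub>2 E') H
                 \<longrightarrow> eq_on (lam A) E' E\<^sub>w)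
            \<and> (strictly_monadic (tau A) B H\<^sub>\<tau> L \<eta> \<epsilon>
                 \<longrightarrow> f_isomorphism A (TAlg_F w B T) E\<^sub>w)))"
proof (intro conjI impI, goal_cases)
  case 1
  thus ?case using w_doctrinal_if_doctrinal_adjunction[OF assms(1)] by blast
next
  case 2
  hence mon: "monadic (tau A) B H\<^sub>\<tau> L \<eta> \<epsilon>" and lim: "admits_limits (bar w) A"
    and limB: "admits_limits_of_arrows (bar w) B" and doc: "w_doctrinal w A (chordate B) H" by auto
  note U = tight_part_chordate[OF assms(1), folded H\<^sub>\<tau>_def]
  define a where "a X = on1 H\<^sub>\<tau> (\<epsilon> X)" for X
  have sc: "strict_comparison A B T H a"
    using strict_comparison_if_monadic[OF assms(1) _ mon] H\<^sub>\<tau>_def T_def by (simp add: a_def[abs_def])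
  obtain str_cell where "algebra_extension A B T H a w str_cell"
    using algebra_extension_exists[OF assms(1) sc lim limB doc] by auto
  then interpret algebra_extension A B T H a w str_cell .
  note D = structure_cellsD[OF ext_cells]
  have E0: "on0 E X = alg_of X" for X by (simp add: E_def comparison_def a_def alg_of_def U)
  have E1: "on1 E f = alg_mor_of str_cell (on1 (incl A) f)" if "f \<in> ones (tau A)" for f
    using that D(2)[of "on1 (incl A) f"]
    by (simp add: E_def comparison_def a_def U alg_mor_of_def alg_of_def incl_ob tight_def)
  have E2: "on2 E \<alpha> = on2 extension (on2 (incl A) \<alpha>)" if "\<alpha> \<in> twos (tau A)" for \<alpha>
  proof -
    have "on2 E \<alpha> = AlgCell (on1 E (dm (tau A) \<alpha>)) (on1 E (cd (tau A) \<alpha>)) (on2 H\<^sub>\<tau> \<alpha>)"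
      by (simp add: E_def comparison_def Let_def)
    thus ?thesis using that by (simp add: E1 U)
  qed
  have over: "eq_on (tau A) (extension \<circ>\<^sub>2 incl A) (incl (TAlg_F w B T) \<circ>\<^sub>2 E)"
    using E0 E1 E2 by (simp add: eq_on_def comp_map2_def incl_ob)
  have forget: "eq_on (lam A) (forget \<circ>\<^sub>2 extension) H"
    by (simp add: eq_on_def comp_map2_def forget_def)
  have E: "two_equivalence (tau A) (TAlg_s B T) E"
    using mon by (simp add: monadic_def E_def T_def)
  then interpret E: two_functor "tau A" "TAlg_s B T" E by (simp add: two_equivalence_def)
  have tp: "eq_on (tau A) E (tight_part A (TAlg_F w B T) extension)"
    unfolding eq_on_def
  proof (intro conjI ballI)
    fix X show "on0 E X = on0 (tight_part A (TAlg_F w B T) extension) X" by (simp add: tight_part_def E0)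
  next
    fix f assume f: "f \<in> ones (tau A)"
    thus "on1 E f = on1 (tight_part A (TAlg_F w B T) extension) f"
      using E.on1_one(1)[OF f] E1[OF f] by (simp add: tight_part_def inv_into_id)
  next
    fix \<alpha> assume \<alpha>: "\<alpha> \<in> twos (tau A)"
    have "on2 E \<alpha> \<in> twos (TAlg_s B T)" using E.on2_two(1)[OF \<alpha>] .
    thus "on2 E \<alpha> = on2 (tight_part A (TAlg_F w B T) extension) \<alpha>"
      using inv_into_id[of "on2 E \<alpha>" "twos (TAlg_s B T)"] E2[OF \<alpha>]
      by (simp only: tight_part_def TAlg_F_simps id_map2_simps map2.simps)
  qed
  have equiv: "f_equivalence A (TAlg_F w B T) extension"
    using f_functor_extension two_equivalence_cong[OF E tp] two_equivalence_extension
    by (simp add: f_equivalence_def)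
  have uniq: "eq_on (lam A) E' extension"
    if "f_functor A (TAlg_F w B T) E'" "eq_on (tau A) (E' \<circ>\<^sub>2 incl A) (incl (TAlg_F w B T) \<circ>\<^sub>2 E)"
      "eq_on (lam A) (forget \<circ>\<^sub>2 E') H" for E'
  proof (rule extension_unique[OF that(1) _ _ that(3)])
    fix f assume "tight A f"
    then obtain f' where f: "f' \<in> ones (tau A)" "f = on1 (incl A) f'" by (rule tightE)
    have "on1 E' f = alg_mor_of str_cell f" using that(2) f E1 by (simp add: eq_on_def comp_map2_def)
    thus "struct (on1 E' f) = id2 B (H1 f \<cdot>\<^bsub>B\<^esub> a (src (lam A) f))" using D(2)[OF \<open>tight A f\<close>] by simp
  next
    fix X assume "X \<in> obs (lam A)"
    thus "on0 E' X = alg_of X" using that(2) obs_eq E0 by (simp add: eq_on_def comp_map2_def incl_ob)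
  qed
  have iso: "f_isomorphism A (TAlg_F w B T) extension" if "strictly_monadic (tau A) B H\<^sub>\<tau> L \<eta> \<epsilon>"
  proof -
    have Ei: "two_isomorphism (tau A) (TAlg_s B T) E"
      using that by (simp add: strictly_monadic_def E_def T_def)
    have "bij_betw (on0 E) (obs (tau A)) {X. algebra B T X}" using Ei by (simp add: two_isomorphism_def)
    moreover have "on0 E = alg_of" using E0 by (rule HOL.ext)
    ultimately have "bij_betw alg_of (obs (lam A)) {X. algebra B T X}" by (simp only: obs_eq)
    thus ?thesis using f_functor_extension two_isomorphism_cong[OF Ei tp] two_isomorphism_extension
      by (simp add: f_isomorphism_def)
  qed
  show ?case using equiv over forget uniq iso by blast
qed

end
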